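(* Let $(\alpha,\beta)$ be an s-malleable deformation of tracial von Neumann algebras $M\subseteq\widetilde M$. Then any $Q\in\mathrm{Rig}(\alpha)$ with $Q'\cap\widetilde M\subseteq M$ is contained in a unique $P\in\mathrm{MaxRig}(\alpha)$.
   Context: A tracial von Neumann algebra $(M,\tau)$ is a von Neumann algebra with a faithful normal tracial state $\tau$; $\|x\|_2=\tau(x^*x)^{1/2}$. Inclusions $M\subseteq\widetilde M$ of tracial von Neumann algebras are unital and trace-preserving; von Neumann subalgebras $Q\leq M$ are unital. $(Q)_1$ is the (operator norm) unit ball of $Q$. $\mathrm{Aut}(\widetilde M)$ is the group of trace-preserving $*$-automorphisms of $\widetilde M$. An s-malleable deformation $(\alpha,\beta)$ of $M$ inside $\widetilde M$ consists of an action (group homomorphism) $\alpha:\mathbb R\to\mathrm{Aut}(\widetilde M)$ with $\|\alpha_t(x)-x\|_2\to0$ as $t\to0$ for each $x\in\widetilde M$, together with $\beta\in\mathrm{Aut}(\widetilde M)$ satisfying $\beta|_M=\mathrm{id}$, $\beta^2=\mathrm{id}$ and $\beta\alpha_t=\alpha_{-t}\beta$ for all $t\in\mathbb R$. For a von Neumann subalgebra $Q\leq M$ put $\epsilon_t(Q)=\sup_{x\in(Q)_1}\|\alpha_t(x)-x\|_2$. $Q$ is $\alpha$-rigid if $\epsilon_t(Q)\to0$ as $t\to0$. $\mathrm{Rig}(\alpha)$ is the collection of all $\alpha$-rigid von Neumann subalgebras of $M$, and $\mathrm{MaxRig}(\alpha)$ is the collection of $P\in\mathrm{Rig}(\alpha)$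 that are maximal in $\mathrm{Rig}(\alpha)$ with respect to inclusion. *)

theory Defs
  imports "HOL-Analysis.Analysis"
begin

section \<open>Complex Hilbert spaces and their bounded operators\<close>

text \<open>
  Norm, topology, completeness and positive definiteness are those of the underlying real Hilbert
  space. The inner product is linear in its first argument.
\<close>

class complex_hilbert_space = real_inner + complete_space +
  fixes scaleC :: "complex \<Rightarrow> 'a \<Rightarrow> 'a"  (infixr "*\<^sub>C" 75)
    and cinner :: "'a \<Rightarrow> 'a \<Rightarrow> complex"
  assumes scaleC_add_right: "c *\<^sub>C (x + y) = c *\<^sub>C x + c *\<^sub>C y"
    and scaleC_add_left: "(c + d) *\<^sub>C x = c *\<^sub>C x + d *\<^sub>C x"
    and scaleC_scaleC: "c *\<^sub>C (d *\<^sub>C x) = (c * d) *\<^sub>C x"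
    and scaleR_eq_scaleC: "r *\<^sub>R x = complex_of_real r *\<^sub>C x"
    and cinner_commute: "cinner x y = cnj (cinner y x)"
    and cinner_add_left: "cinner (x + y) z = cinner x z + cinner y z"
    and cinner_scaleC_left: "cinner (c *\<^sub>C x) y = c * cinner x y"
    and inner_eq_Re_cinner: "inner x y = Re (cinner x y)"

text \<open>
  Operators are elements of the library type of bounded real-linear maps; \<open>bounded_ops\<close> singles
  out the complex-linear ones. Product, unit, addition and operator norm are those of the library.
\<close>

type_synonym 'h operator = "'h \<Rightarrow>\<^sub>L 'h"

definition bounded_ops :: "'h::complex_hilbert_space operator set" where
  "bounded_ops = {x. \<forall>c \<xi>. blinfun_apply x (c *\<^sub>C \<xi>) = c *\<^sub>C blinfun_apply x \<xi>}"

definition op_scaleC :: "complex \<Rightarrow> 'h::complex_hilbert_space operator \<Rightarrow> 'h operator" where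
  "op_scaleC c x = Blinfun (\<lambda>\<xi>. c *\<^sub>C blinfun_apply x \<xi>)"

text \<open>The adjoint is meaningful on \<open>bounded_ops\<close>, where it exists by the Riesz representation theorem.\<close>

definition op_adj :: "'h::complex_hilbert_space operator \<Rightarrow> 'h operator" where
  "op_adj x = (THE y. \<forall>\<xi> \<eta>. cinner (blinfun_apply x \<xi>) \<eta> = cinner \<xi> (blinfun_apply y \<eta>))"


section \<open>Tracial von Neumann algebras\<close>

definition commutant :: "'h::complex_hilbert_space operator set \<Rightarrow> 'h operator set" where
  "commutant S = {x \<in> bounded_ops. \<forall>y\<in>S. x o\<^sub>L y = y o\<^sub>L x}"

text \<open>
  A self-adjoint set of operators equal to its bicommutant is automatically a subalgebra containing
  the identity operator. In particular, inclusions of von Neumann algebras acting on the same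
  Hilbert space are unital.
\<close>

definition von_neumann_algebra :: "'h::complex_hilbert_space operator set \<Rightarrow> bool" where
  "von_neumann_algebra M \<longleftrightarrow>
     M \<subseteq> bounded_ops \<and> (\<forall>x\<in>M. op_adj x \<in> M) \<and> commutant (commutant M) = M"

definition ultraweak_topology :: "'h::complex_hilbert_space operator topology" where
  "ultraweak_topology = topology_generated_by
     {(\<lambda>x. \<Sum>n. cinner (blinfun_apply x (\<xi> n)) (\<eta> n)) -` U | (\<xi> :: nat \<Rightarrow> 'h) (\<eta> :: nat \<Rightarrow> 'h) U.
        summable (\<lambda>n. (norm (\<xi> n))\<^sup>2) \<and> summable (\<lambda>n. (norm (\<eta> n))\<^sup>2) \<and> open U}"

text \<open>Values of a functional outside \<open>M\<close> are irrelevant. Normality is ultraweak continuity on \<open>M\<close>.\<close>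

definition state_on ::
  "'h::complex_hilbert_space operator set \<Rightarrow> ('h operator \<Rightarrow> complex) \<Rightarrow> bool" where
  "state_on M \<tau> \<longleftrightarrow>
     (\<forall>x\<in>M. \<forall>y\<in>M. \<tau> (x + y) = \<tau> x + \<tau> y) \<and>
     (\<forall>c. \<forall>x\<in>M. \<tau> (op_scaleC c x) = c * \<tau> x) \<and>
     (\<forall>x\<in>M. \<tau> (op_adj x o\<^sub>L x) \<in> \<real> \<and> 0 \<le> Re (\<tau> (op_adj x o\<^sub>L x))) \<and>
     \<tau> id_blinfun = 1"

definition faithful_on ::
  "'h::complex_hilbert_space operator set \<Rightarrow> ('h operator \<Rightarrow> complex) \<Rightarrow> bool" where
  "faithful_on M \<tau> \<longleftrightarrow> (\<forall>x\<in>M. \<tau> (op_adj x o\<^sub>L x) = 0 \<longrightarrow> x = 0)"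

definition normal_on ::
  "'h::complex_hilbert_space operator set \<Rightarrow> ('h operator \<Rightarrow> complex) \<Rightarrow> bool" where
  "normal_on M \<tau> \<longleftrightarrow> continuous_map (subtopology ultraweak_topology M) euclidean \<tau>"

definition tracial_on ::
  "'h::complex_hilbert_space operator set \<Rightarrow> ('h operator \<Rightarrow> complex) \<Rightarrow> bool" where
  "tracial_on M \<tau> \<longleftrightarrow> (\<forall>x\<in>M. \<forall>y\<in>M. \<tau> (x o\<^sub>L y) = \<tau> (y o\<^sub>L x))"

definition tracial_von_neumann_algebra ::
  "'h::complex_hilbert_space operator set \<Rightarrow> ('h operator \<Rightarrow> complex) \<Rightarrow> bool" where
  "tracial_von_neumann_algebra M \<tau> \<longleftrightarrow>
     von_neumann_algebra M \<and> state_on M \<tau> \<and> faithful_on M \<tau> \<and> normal_on M \<tau> \<and> tracial_on M \<tau>"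

definition tracial_inclusion ::
  "'h::complex_hilbert_space operator set \<Rightarrow> ('h operator \<Rightarrow> complex) \<Rightarrow>
   'h operator set \<Rightarrow> ('h operator \<Rightarrow> complex) \<Rightarrow> bool" where
  "tracial_inclusion M \<tau>\<^sub>M N \<tau> \<longleftrightarrow>
     tracial_von_neumann_algebra M \<tau>\<^sub>M \<and> tracial_von_neumann_algebra N \<tau> \<and>
     M \<subseteq> N \<and> (\<forall>x\<in>M. \<tau> x = \<tau>\<^sub>M x)"

definition norm2 ::
  "('h::complex_hilbert_space operator \<Rightarrow> complex) \<Rightarrow> 'h operator \<Rightarrow> real" where
  "norm2 \<tau> x = sqrt (Re (\<tau> (op_adj x o\<^sub>L x)))"

text \<open>Automorphisms are functions on all operators of which only the restriction to \<open>N\<close> matters.\<close>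

definition tracial_Aut ::
  "'h::complex_hilbert_space operator set \<Rightarrow> ('h operator \<Rightarrow> complex) \<Rightarrow>
   ('h operator \<Rightarrow> 'h operator) set" where
  "tracial_Aut N \<tau> = {\<theta>. bij_betw \<theta> N N \<and>
     (\<forall>x\<in>N. \<forall>y\<in>N. \<theta> (x + y) = \<theta> x + \<theta> y) \<and>
     (\<forall>c. \<forall>x\<in>N. \<theta> (op_scaleC c x) = op_scaleC c (\<theta> x)) \<and>
     (\<forall>x\<in>N. \<forall>y\<in>N. \<theta> (x o\<^sub>L y) = \<theta> x o\<^sub>L \<theta> y) \<and>
     (\<forall>x\<in>N. \<theta> (op_adj x) = op_adj (\<theta> x)) \<and>
     (\<forall>x\<in>N. \<tau> (\<theta> x) = \<tau> x)}"


section \<open>S-malleable deformations and rigid subalgebras\<close>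

definition s_malleable_deformation ::
  "'h::complex_hilbert_space operator set \<Rightarrow> 'h operator set \<Rightarrow> ('h operator \<Rightarrow> complex) \<Rightarrow>
   (real \<Rightarrow> 'h operator \<Rightarrow> 'h operator) \<Rightarrow> ('h operator \<Rightarrow> 'h operator) \<Rightarrow> bool" where
  "s_malleable_deformation M N \<tau> \<alpha> \<beta> \<longleftrightarrow>
     (\<forall>t. \<alpha> t \<in> tracial_Aut N \<tau>) \<and>
     (\<forall>s t. \<forall>x\<in>N. \<alpha> (s + t) x = \<alpha> s (\<alpha> t x)) \<and>
     (\<forall>x\<in>N. ((\<lambda>t. norm2 \<tau> (\<alpha> t x - x)) \<longlongrightarrow> 0) (at 0)) \<and>
     \<beta> \<in> tracial_Aut N \<tau> \<and>
     (\<forall>x\<in>M. \<beta> x = x) \<and>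
     (\<forall>x\<in>N. \<beta> (\<beta> x) = x) \<and>
     (\<forall>t. \<forall>x\<in>N. \<beta> (\<alpha> t x) = \<alpha> (- t) (\<beta> x))"

definition rigidity_defect ::
  "('h::complex_hilbert_space operator \<Rightarrow> complex) \<Rightarrow> (real \<Rightarrow> 'h operator \<Rightarrow> 'h operator) \<Rightarrow>
   real \<Rightarrow> 'h operator set \<Rightarrow> real" where
  "rigidity_defect \<tau> \<alpha> t Q = (SUP x\<in>{x \<in> Q. norm x \<le> 1}. norm2 \<tau> (\<alpha> t x - x))"

definition Rig ::
  "'h::complex_hilbert_space operator set \<Rightarrow> ('h operator \<Rightarrow> complex) \<Rightarrow>
   (real \<Rightarrow> 'h operator \<Rightarrow> 'h operator) \<Rightarrow> 'h operator set set" where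
  "Rig M \<tau> \<alpha> = {Q. von_neumann_algebra Q \<and> Q \<subseteq> M \<and>
     ((\<lambda>t. rigidity_defect \<tau> \<alpha> t Q) \<longlongrightarrow> 0) (at 0)}"

definition MaxRig ::
  "'h::complex_hilbert_space operator set \<Rightarrow> ('h operator \<Rightarrow> complex) \<Rightarrow>
   (real \<Rightarrow> 'h operator \<Rightarrow> 'h operator) \<Rightarrow> 'h operator set set" where
  "MaxRig M \<tau> \<alpha> = {P \<in> Rig M \<tau> \<alpha>. \<forall>P'\<in>Rig M \<tau> \<alpha>. P \<subseteq> P' \<longrightarrow> P' = P}"

end

theory Submission
  imports Defs
begin

text \<open>
  For a subalgebra \<open>P\<close> write \<open>I\<^sub>t(P)\<close> for the set of all \<open>w \<in> N\<close> with \<open>\<alpha>\<^sub>t(x) w = w x\<close> for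
  every \<open>x \<in> P\<close> (\<open>intertwiners t P\<close>). The theorem holds because the rigid algebras containing \<open>Q\<close>
  have a largest element, and that element can be written down: it is
  \<open>E = {x \<in> M. \<beta>(v\<^sup>\<dagger> \<alpha>\<^sub>t(x) w) = v\<^sup>\<dagger> \<alpha>\<^sub>t(x) w for all t and all v, w \<in> I\<^sub>t(Q)}\<close> (\<open>rigid_envelope Q\<close>).

  \<^item> Rigidity produces intertwiners. If \<open>\<alpha>\<^sub>t\<close> moves the unitaries \<open>u\<close> of \<open>P\<close> by at most \<open>\<epsilon>\<close> in trace
    norm, the element of least trace norm in the closed convex hull of the \<open>\<alpha>\<^sub>t(u) u\<^sup>\<dagger>\<close> is a
    contraction in \<open>I\<^sub>t(P)\<close> at distance at most \<open>\<epsilon>\<close> from the identity (\<open>exists_intertwiner\<close>).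

  \<^item> If \<open>P\<close> is rigid and contains \<open>Q\<close>, then \<open>I\<^sub>t(P)\<close> has full support for every \<open>t\<close>, not only for
    small \<open>t\<close> (\<open>intertwiners_nondegenerate\<close>). Let \<open>q\<^sub>t\<close> be the projection onto the joint kernel of
    \<open>I\<^sub>t(P)\<close>. It commutes with \<open>P\<close>, hence lies in \<open>Q' \<inter> N \<subseteq> M\<close> and is fixed by \<open>\<beta>\<close>; as \<open>\<beta>\<close>
    exchanges \<open>I\<^sub>t(P)\<close> and \<open>I\<^sub>-\<^sub>t(P)\<close>, left and right supports correspond under \<open>\<alpha>\<^sub>t\<close>, and multiplying
    intertwiners gives \<open>q\<^sub>n\<^sub>s \<le> q\<^sub>s\<close>. Since \<open>q\<^sub>s\<close> tends to \<open>0\<close> with \<open>s\<close>, it follows that \<open>q\<^sub>t = 0\<close>.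

  \<^item> If \<open>P \<supseteq> Q\<close> is rigid, then \<open>P \<subseteq> E\<close>. For \<open>x \<in> P\<close>, \<open>v, w \<in> I\<^sub>t(Q)\<close> and \<open>u, u' \<in> I\<^sub>t(P)\<close> one has
    \<open>v\<^sup>\<dagger> \<alpha>\<^sub>t(x) u u'\<^sup>\<dagger> w = (v\<^sup>\<dagger> u) x (u'\<^sup>\<dagger> w) \<in> M\<close>, because \<open>v\<^sup>\<dagger> u\<close> and \<open>u'\<^sup>\<dagger> w\<close> lie in
    \<open>Q' \<inter> N \<subseteq> M\<close>; by full support the products \<open>u u'\<^sup>\<dagger>\<close> approximate the identity
    (\<open>beta_fixed_of_insertion\<close>, \<open>rigid_subset_envelope\<close>). The same insertion argument shows that \<open>E\<close> is
    closed under products.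

  \<^item> \<open>E\<close> is a von Neumann algebra, since inside \<open>M\<close> it is cut out by linear conditions \<open>\<tau>(g x) = 0\<close>, and
    such conditions pass from a unital self-adjoint algebra to its bicommutant
    (\<open>tau_vanishes_on_bicommutant\<close>, \<open>rigid_envelope_vna\<close>).

  \<^item> \<open>E\<close> is rigid. For \<open>x\<close> in its unit ball and \<open>v \<in> I\<^sub>t(Q)\<close> near the identity, \<open>\<alpha>\<^sub>t(x)\<close> is close to the
    \<open>\<beta>\<close>-fixed element \<open>v\<^sup>\<dagger> \<alpha>\<^sub>t(x) v\<close>; applying \<open>\<beta>\<close>, so is \<open>\<alpha>\<^sub>-\<^sub>t(x)\<close>. Hence the rigidity defect of \<open>E\<close>
    at \<open>2t\<close> is at most four times that of \<open>Q\<close> at \<open>t\<close> (\<open>norm2_alpha_double_le\<close>).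

  Two analytic facts about a normal trace carry the argument: \<open>|\<tau>(x)| \<le> \<parallel>x \<zeta>\<parallel>\<close> for a single
  vector \<open>\<zeta>\<close> of the amplified Hilbert space (\<open>tau_dominated\<close>), which reduces the bicommutant step to a
  projection argument in that space, and completeness of the unit ball in the trace norm
  (\<open>unit_ball_norm2_complete\<close>), which comes from compactness in the weak operator topology.
\<close>

notation blinfun_compose (infixl "\<cdot>" 70)
notation blinfun_apply (infixr "\<rhd>" 95)
notation op_adj ("_\<^sup>\<dagger>" [1000] 1000)

section \<open>Orthogonal projections and the Riesz representation\<close>

lemma quadratic_nonneg_imp_linear_coeff_zero:
  fixes a b :: real
  assumes "\<And>t. 0 \<le> a * t\<^sup>2 - 2 * b * t" shows "b = 0"
proof (rule ccontr)
  assume b: "b \<noteq> 0"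
  \<comment> \<open>at \<open>t = s b\<close> the quadratic term is too small to compensate the linear one\<close>
  define s where "s = 1 / (\<bar>a\<bar> + 1)"
  have s: "s > 0" "\<bar>a\<bar> * s < 1" by (auto simp: s_def divide_simps)
  have "0 \<le> a * (s*b)\<^sup>2 - 2 * b * (s*b)" by (rule assms)
  also have "\<dots> = s * b\<^sup>2 * (a * s - 2)" by (simp add: power2_eq_square algebra_simps)
  also have "\<dots> < 0"
  proof -
    have "a * s < 2" using s mult_right_mono[OF abs_ge_self[of a], of s] by linarith
    thus ?thesis using s b by (simp add: mult_pos_neg)
  qed
  finally show False by simp
qed

text \<open>
  By the parallelogram law a sequence in \<open>V\<close> that minimises the distance to \<open>x\<close> is Cauchy. Its
  limit \<open>p\<close> is a closest point, and comparing \<open>p\<close> with \<open>p + t w\<close> for small \<open>t\<close> gives orthogonality.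
\<close>

lemma exists_orthogonal_projection:
  fixes V :: "'a::{real_inner,complete_space} set"
  assumes "subspace V" "closed V"
  shows "\<exists>p\<in>V. \<forall>v\<in>V. inner (x - p) v = 0"
proof -
  define D where "D = (\<lambda>v. (norm (x - v))\<^sup>2) ` V"
  define d where "d = Inf D"
  have ne: "D \<noteq> {}" using subspace_0[OF assms(1)] by (auto simp: D_def)
  have bdd: "bdd_below D" by (auto simp: D_def bdd_below_def intro!: exI[of _ 0])
  have dle: "d \<le> (norm (x - v))\<^sup>2" if "v \<in> V" for v
    unfolding d_def using that by (intro cInf_lower bdd) (auto simp: D_def)
  have "\<exists>v\<in>V. (norm (x - v))\<^sup>2 < d + 1 / Suc n" for n
    using cInf_lessD[OF ne, of "d + 1 / Suc n"] by (auto simp: d_def D_def)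
  then obtain v where v: "\<And>n. v n \<in> V" "\<And>n. (norm (x - v n))\<^sup>2 < d + 1 / Suc n" by metis
  have close: "(norm (v m - v n))\<^sup>2 \<le> 2 / Suc m + 2 / Suc n" for m n
  proof -
    have "(1/2) *\<^sub>R (v m + v n) \<in> V"
      by (intro subspace_scale subspace_add assms v)
    hence "d \<le> (norm (x - (1/2) *\<^sub>R (v m + v n)))\<^sup>2" by (rule dle)
    moreover have "(norm (v m - v n))\<^sup>2 = 2 * (norm (x - v m))\<^sup>2 + 2 * (norm (x - v n))\<^sup>2
        - 4 * (norm (x - (1/2) *\<^sub>R (v m + v n)))\<^sup>2"
      unfolding power2_norm_eq_inner by (simp add: inner_simps inner_commute algebra_simps)
    ultimately show ?thesis using v(2)[of m] v(2)[of n] by simp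
  qed
  have "Cauchy v"
  proof (rule metric_CauchyI)
    fix e :: real assume e: "e > 0"
    obtain k where k: "1 / real (Suc k) < e\<^sup>2 / 4" using nat_approx_posE[of "e\<^sup>2/4"] e by auto
    show "\<exists>M. \<forall>m\<ge>M. \<forall>n\<ge>M. dist (v m) (v n) < e"
    proof (intro exI allI impI)
      fix m n assume mn: "m \<ge> k" "n \<ge> k"
      have "1 / real (Suc m) \<le> 1 / real (Suc k)" "1 / real (Suc n) \<le> 1 / real (Suc k)"
        using mn by (auto intro!: divide_left_mono)
      hence "2 / Suc m + 2 / Suc n \<le> 4 * (1 / real (Suc k))" by simp
      hence "(norm (v m - v n))\<^sup>2 < e\<^sup>2" using close[of m n] k by linarith
      thus "dist (v m) (v n) < e" using e by (simp add: dist_norm power2_less_imp_less)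
    qed
  qed
  then obtain p where p: "v \<longlonglongrightarrow> p" using Cauchy_convergent convergent_def by blast
  have pV: "p \<in> V" using closed_sequentially[OF assms(2), of v p] v p by auto
  have "(\<lambda>n. (norm (x - v n))\<^sup>2) \<longlonglongrightarrow> (norm (x - p))\<^sup>2" by (intro tendsto_intros p)
  moreover have "(\<lambda>n. d + 1 / real (Suc n)) \<longlonglongrightarrow> d + 0"
    by (intro tendsto_add tendsto_const LIMSEQ_Suc[OF lim_1_over_n])
  ultimately have "(norm (x - p))\<^sup>2 \<le> d + 0"
    by (rule LIMSEQ_le) (use v(2) less_imp_le in blast)
  hence pd: "(norm (x - p))\<^sup>2 \<le> d" by simp
  have "inner (x - p) w = 0" if w: "w \<in> V" for w
  proof (rule quadratic_nonneg_imp_linear_coeff_zero)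
    fix t :: real
    have "p + t *\<^sub>R w \<in> V" by (intro subspace_add subspace_scale assms w pV)
    from dle[OF this] pd have "(norm (x - p))\<^sup>2 \<le> (norm (x - (p + t *\<^sub>R w)))\<^sup>2" by linarith
    also have "\<dots> = (norm (x - p))\<^sup>2 + (norm w)\<^sup>2 * t\<^sup>2 - 2 * inner (x - p) w * t"
      unfolding power2_norm_eq_inner
      by (simp add: inner_simps inner_commute algebra_simps power2_eq_square)
    finally show "0 \<le> (norm w)\<^sup>2 * t\<^sup>2 - 2 * inner (x - p) w * t" by simp
  qed
  thus ?thesis using pV by blast
qed

definition orth_proj :: "'a::{real_inner,complete_space} set \<Rightarrow> 'a \<Rightarrow>\<^sub>L 'a" where
  "orth_proj V = Blinfun (\<lambda>x. SOME p. p \<in> V \<and> (\<forall>v\<in>V. inner (x - p) v = 0))"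

lemma orthogonal_projection_unique:
  fixes V :: "'a::real_inner set"
  assumes "subspace V" "p \<in> V" "\<forall>v\<in>V. inner (x - p) v = 0" "q \<in> V" "\<forall>v\<in>V. inner (x - q) v = 0"
  shows "p = q"
proof -
  have m: "p - q \<in> V" by (intro subspace_diff assms)
  have "inner (p - q) (p - q) = inner (x - q) (p - q) - inner (x - p) (p - q)"
    by (simp add: inner_simps)
  also have "\<dots> = 0" using assms m by auto
  finally show ?thesis by simp
qed

lemma orth_proj:
  fixes V :: "'a::{real_inner,complete_space} set"
  assumes V: "subspace V" "closed V"
  shows orth_proj_mem: "orth_proj V x \<in> V"
    and orth_proj_orthogonal: "v \<in> V \<Longrightarrow> inner (x - orth_proj V x) v = 0"
proof -
  define P where "P = (\<lambda>x. SOME p. p \<in> V \<and> (\<forall>v\<in>V. inner (x - p) v = 0))"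
  have P: "P x \<in> V" "\<forall>v\<in>V. inner (x - P x) v = 0" for x
    using someI_ex[of "\<lambda>p. p \<in> V \<and> (\<forall>v\<in>V. inner (x - p) v = 0)"]
      exists_orthogonal_projection[OF V, of x] unfolding P_def by blast+
  have U: "P x = q" if "q \<in> V" "\<forall>v\<in>V. inner (x - q) v = 0" for x q
    using orthogonal_projection_unique[OF V(1)] P that by blast
  have "bounded_linear P"
  proof (rule bounded_linear_intro)
    show "P (x + y) = P x + P y" for x y
    proof (rule U)
      show "P x + P y \<in> V" by (intro subspace_add V P)
      show "\<forall>v\<in>V. inner (x + y - (P x + P y)) v = 0"
      proof
        fix v assume v: "v \<in> V"
        have "inner (x + y - (P x + P y)) v = inner (x - P x) v + inner (y - P y) v"
          by (simp add: inner_simps)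
        thus "inner (x + y - (P x + P y)) v = 0" using P(2) v by simp
      qed
    qed
    show "P (r *\<^sub>R x) = r *\<^sub>R P x" for r x
    proof (rule U)
      show "r *\<^sub>R P x \<in> V" by (intro subspace_scale V P)
      show "\<forall>v\<in>V. inner (r *\<^sub>R x - r *\<^sub>R P x) v = 0"
        using P(2)[of x] by (metis scaleR_diff_right inner_scaleR_left mult_zero_right)
    qed
    show "norm (P x) \<le> norm x * 1" for x
    proof -
      have "inner (P x) (P x) = inner x (P x)" using P(2)[of x] P(1)[of x]
        by (auto simp: inner_simps)
      hence "(norm (P x))\<^sup>2 \<le> norm x * norm (P x)"
        using norm_cauchy_schwarz[of x "P x"] by (simp add: power2_norm_eq_inner)
      thus ?thesis by (cases "norm (P x) = 0") (auto simp: power2_eq_square mult_le_cancel_right)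
    qed
  qed
  hence "blinfun_apply (orth_proj V) = P"
    unfolding orth_proj_def P_def[symmetric] by (rule bounded_linear_Blinfun_apply)
  thus "orth_proj V x \<in> V" "v \<in> V \<Longrightarrow> inner (x - orth_proj V x) v = 0" using P by auto
qed

lemma orth_proj_eqI:
  fixes V :: "'a::{real_inner,complete_space} set"
  assumes "subspace V" "closed V" "q \<in> V" "\<And>v. v \<in> V \<Longrightarrow> inner (x - q) v = 0"
  shows "orth_proj V x = q"
  using orthogonal_projection_unique[OF assms(1)] orth_proj_mem[OF assms(1,2)]
    orth_proj_orthogonal[OF assms(1,2)] assms(3,4) by metis

lemma orth_proj_fixes:
  fixes V :: "'a::{real_inner,complete_space} set"
  assumes "subspace V" "closed V" "x \<in> V" shows "orth_proj V x = x"
  by (rule orth_proj_eqI) (use assms in auto)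

lemma orth_proj_selfadjoint:
  fixes V :: "'a::{real_inner,complete_space} set"
  assumes V: "subspace V" "closed V"
  shows "inner (orth_proj V x) y = inner x (orth_proj V y)"
proof -
  have "inner (x - orth_proj V x) (orth_proj V y) = 0" "inner (y - orth_proj V y) (orth_proj V x) = 0"
    using orth_proj_mem[OF V] orth_proj_orthogonal[OF V] by auto
  thus ?thesis by (simp add: inner_simps inner_commute)
qed

text \<open>
  As \<open>g\<close> is the adjoint of \<open>f\<close> and preserves \<open>V\<close>, the map \<open>f\<close> preserves the orthogonal complement
  of \<open>V\<close> as well as \<open>V\<close>. Taking \<open>f\<close> to be multiplication by a complex scalar also shows that
  projections onto complex subspaces are complex linear.
\<close>

lemma orth_proj_commutes:
  fixes V :: "'a::{real_inner,complete_space} set"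
  assumes V: "subspace V" "closed V"
    and f: "\<And>v. v \<in> V \<Longrightarrow> f v \<in> V" "\<And>v. v \<in> V \<Longrightarrow> g v \<in> V"
    and adj: "\<And>x y. inner (f x) y = inner x (g y)"
    and add: "\<And>x y. f (x - y) = f x - f y"
  shows "orth_proj V (f x) = f (orth_proj V x)"
proof (rule orth_proj_eqI[OF V])
  show "f (orth_proj V x) \<in> V" by (intro f orth_proj_mem V)
  fix v assume "v \<in> V"
  have "inner (f x - f (orth_proj V x)) v = inner (x - orth_proj V x) (g v)"
    by (simp add: add[symmetric] adj)
  also have "\<dots> = 0" by (intro orth_proj_orthogonal V f \<open>v \<in> V\<close>)
  finally show "inner (f x - f (orth_proj V x)) v = 0" .
qed

text \<open>
  A vector orthogonal to the kernel of \<open>f\<close> represents \<open>f\<close> up to a factor.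
\<close>

lemma riesz_representation:
  fixes f :: "'a::{real_inner,complete_space} \<Rightarrow> real"
  assumes "bounded_linear f"
  shows "\<exists>z. \<forall>x. f x = inner z x"
proof -
  interpret bounded_linear f by (rule assms)
  define V where "V = {x. f x = 0}"
  have V: "subspace V" "closed V"
    unfolding V_def using closed_Collect_eq[of f "\<lambda>_. 0"] linear_continuous_on[OF assms]
    by (auto simp: subspace_def add scale zero)
  show ?thesis
  proof (cases "\<exists>w. f w \<noteq> 0")
    case False thus ?thesis by (intro exI[of _ 0]) auto
  next
    case True
    then obtain w where w: "f w \<noteq> 0" by blast
    define u where "u = w - orth_proj V w"
    have fu: "f u = f w" using orth_proj_mem[OF V, of w] by (auto simp: u_def diff V_def)
    hence u0: "u \<noteq> 0" using w zero by auto
    have uV: "inner u v = 0" if "v \<in> V" for v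
      unfolding u_def by (rule orth_proj_orthogonal[OF V that])
    have "f x = inner ((f u / inner u u) *\<^sub>R u) x" for x
    proof -
      have "x - (f x / f u) *\<^sub>R u \<in> V" using w fu by (auto simp: V_def diff scale)
      from uV[OF this] have "inner u x = (f x / f u) * inner u u" by (simp add: inner_simps)
      thus ?thesis using u0 w fu by (simp add: field_simps)
    qed
    thus ?thesis by blast
  qed
qed

text \<open>
  Riesz representation in the second variable. Adjoints are obtained in this way, and so are weak
  limits of operators, which exist at first only as limits of their matrix coefficients.
\<close>

lemma bounded_form_operator:
  fixes B :: "'a::{real_inner,complete_space} \<Rightarrow> 'a \<Rightarrow> real"
  assumes add1: "\<And>x x' y. B (x + x') y = B x y + B x' y"
    and scale1: "\<And>r x y. B (r *\<^sub>R x) y = r * B x y"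
    and add2: "\<And>x y y'. B x (y + y') = B x y + B x y'"
    and scale2: "\<And>r x y. B x (r *\<^sub>R y) = r * B x y"
    and bd: "\<And>x y. \<bar>B x y\<bar> \<le> C * norm x * norm y" and C: "0 \<le> C"
  shows "\<exists>T :: 'a \<Rightarrow>\<^sub>L 'a. norm T \<le> C \<and> (\<forall>x y. inner (T \<rhd> x) y = B x y)"
proof -
  have "bounded_linear (B x)" for x
  proof (rule bounded_linear_intro)
    show "norm (B x y) \<le> norm y * (C * norm x)" for y using bd[of x y] by (simp add: mult_ac)
  qed (auto simp: add2 scale2)
  hence "\<forall>x. \<exists>z. \<forall>y. B x y = inner z y" by (intro allI riesz_representation)
  then obtain t where t: "\<And>x y. B x y = inner (t x) y" by metis
  have nt: "norm (t x) \<le> C * norm x" for x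
  proof -
    have "(norm (t x))\<^sup>2 \<le> C * norm x * norm (t x)"
      using bd[of x "t x"] by (simp add: t power2_norm_eq_inner)
    thus ?thesis by (cases "norm (t x) = 0") (auto simp: power2_eq_square mult_le_cancel_right C)
  qed
  have "bounded_linear t"
  proof (rule bounded_linear_intro)
    show "t (x + y) = t x + t y" for x y
      by (rule vector_eq_rdot[THEN iffD1]) (auto simp: t[symmetric] inner_simps add1)
    show "t (r *\<^sub>R x) = r *\<^sub>R t x" for r x
      by (rule vector_eq_rdot[THEN iffD1]) (auto simp: t[symmetric] inner_simps scale1)
    show "norm (t x) \<le> norm x * C" for x using nt[of x] by (simp add: mult_ac)
  qed
  hence a: "blinfun_apply (Blinfun t) = t" by (rule bounded_linear_Blinfun_apply)
  show ?thesis
    by (rule exI[of _ "Blinfun t"]) (auto simp: a t intro!: norm_blinfun_bound C nt)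
qed

section \<open>Complex-linear operators and their adjoints\<close>

lemma scaleC_zero_right [simp]: "c *\<^sub>C (0::'h::complex_hilbert_space) = 0"
  using scaleC_add_right[of c 0 "0::'h"] by simp
lemma scaleC_minus_right: "c *\<^sub>C (- x) = - (c *\<^sub>C (x::'h::complex_hilbert_space))"
  using scaleC_add_right[of c x "-x"] by (simp add: eq_neg_iff_add_eq_0 add.commute)
lemma scaleC_diff_right: "c *\<^sub>C (x - y) = c *\<^sub>C x - c *\<^sub>C (y::'h::complex_hilbert_space)"
  using scaleC_add_right[of c x "-y"] by (simp add: scaleC_minus_right)
lemma scaleC_one [simp]: "1 *\<^sub>C (x::'h::complex_hilbert_space) = x"
  using scaleR_eq_scaleC[of 1 x] by simp

lemma cinner_scaleC_right: "cinner x (c *\<^sub>C y) = cnj c * cinner x (y::'h::complex_hilbert_space)"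
  by (metis cinner_commute cinner_scaleC_left complex_cnj_mult)

lemma inner_scaleC_left: "inner (c *\<^sub>C x) y = inner x (cnj c *\<^sub>C (y::'h::complex_hilbert_space))"
  by (simp add: inner_eq_Re_cinner cinner_scaleC_left cinner_scaleC_right)

text \<open>
  The complex inner product is determined by the real one, so that for complex-linear operators
  it is enough to compare real inner products.
\<close>

lemma cinner_eq_inner: "cinner x y = Complex (inner x y) (inner x (\<i> *\<^sub>C (y::'h::complex_hilbert_space)))"
  by (simp add: complex_eq_iff inner_eq_Re_cinner cinner_scaleC_right)

lemma norm_scaleC: "norm (c *\<^sub>C x) = cmod c * norm (x::'h::complex_hilbert_space)"
proof -
  have "(norm (c *\<^sub>C x))\<^sup>2 = Re (cnj c * c * cinner x x)"
    by (simp add: power2_norm_eq_inner inner_eq_Re_cinner cinner_scaleC_right cinner_scaleC_left mult_ac)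
  also have "\<dots> = Re (complex_of_real ((cmod c)\<^sup>2) * cinner x x)"
    by (simp only: complex_norm_square mult.commute)
  also have "\<dots> = (cmod c * norm x)\<^sup>2"
    by (simp add: power2_norm_eq_inner inner_eq_Re_cinner power_mult_distrib)
  finally show ?thesis by (simp add: power2_eq_iff_nonneg)
qed

lemma norm_cinner_le: "cmod (cinner x y) \<le> norm x * norm (y::'h::complex_hilbert_space)"
proof (cases "cinner x y = 0")
  case False
  \<comment> \<open>rotating \<open>x\<close> by the phase \<open>c\<close> makes the inner product real and nonnegative\<close>
  define c where "c = cnj (sgn (cinner x y))"
  have c: "cmod c = 1" using False by (simp add: c_def norm_sgn)
  have "c * cinner x y = complex_of_real (cmod (cinner x y))"
    using False complex_norm_square[of "cinner x y"]
    by (simp add: c_def sgn_eq divide_simps power2_eq_square mult.commute)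
  hence "cmod (cinner x y) = inner (c *\<^sub>C x) y"
    by (simp add: inner_eq_Re_cinner cinner_scaleC_left)
  also have "\<dots> \<le> norm (c *\<^sub>C x) * norm y" by (rule norm_cauchy_schwarz)
  finally show ?thesis by (simp add: norm_scaleC c)
qed simp

lemma bounded_linear_scaleC: "bounded_linear (\<lambda>x::'h::complex_hilbert_space. c *\<^sub>C x)"
proof (rule bounded_linear_intro)
  show "c *\<^sub>C (r *\<^sub>R x) = r *\<^sub>R (c *\<^sub>C (x::'h))" for r x
    by (simp add: scaleR_eq_scaleC scaleC_scaleC mult.commute)
  show "norm (c *\<^sub>C x) \<le> norm x * cmod c" for x :: 'h by (simp add: norm_scaleC)
qed (rule scaleC_add_right)

lemma op_scaleC_apply [simp]: "op_scaleC c x \<rhd> \<xi> = c *\<^sub>C x \<rhd> \<xi>"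
  unfolding op_scaleC_def
  by (subst bounded_linear_Blinfun_apply)
    (auto intro!: bounded_linear_compose[OF bounded_linear_scaleC] blinfun.bounded_linear_right)

lemma scaleR_eq_op_scaleC: "r *\<^sub>R x = op_scaleC (complex_of_real r) x"
  by (rule blinfun_eqI) (simp add: blinfun.scaleR_left scaleR_eq_scaleC)

lemma bounded_opsD: "x \<in> bounded_ops \<Longrightarrow> x \<rhd> (c *\<^sub>C \<xi>) = c *\<^sub>C x \<rhd> \<xi>"
  by (simp add: bounded_ops_def)

lemma bounded_ops_compose: "x \<in> bounded_ops \<Longrightarrow> y \<in> bounded_ops \<Longrightarrow> x \<cdot> y \<in> bounded_ops"
  by (simp add: bounded_ops_def)
lemma bounded_ops_add: "x \<in> bounded_ops \<Longrightarrow> y \<in> bounded_ops \<Longrightarrow> x + y \<in> bounded_ops"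
  by (simp add: bounded_ops_def blinfun.add_left scaleC_add_right)
lemma bounded_ops_scaleC: "x \<in> bounded_ops \<Longrightarrow> op_scaleC c x \<in> bounded_ops"
  by (simp add: bounded_ops_def scaleC_scaleC mult.commute)
lemma bounded_ops_id: "id_blinfun \<in> bounded_ops"
  by (simp add: bounded_ops_def)

text \<open>
  The real adjoint of a complex-linear operator is again complex linear, hence also its adjoint for
  the complex inner product.
\<close>

lemma exists_adjoint:
  assumes x: "x \<in> bounded_ops"
  shows "\<exists>y. \<forall>\<xi> \<eta>. cinner (x \<rhd> \<xi>) \<eta> = cinner \<xi> (y \<rhd> \<eta>)"
proof -
  have "\<exists>T. norm T \<le> norm x \<and> (\<forall>\<eta> \<xi>. inner (T \<rhd> \<eta>) \<xi> = inner \<eta> (x \<rhd> \<xi>))"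
  proof (rule bounded_form_operator)
    show "\<bar>inner \<eta> (x \<rhd> \<xi>)\<bar> \<le> norm x * norm \<eta> * norm \<xi>" for \<eta> \<xi>
    proof -
      have "\<bar>inner \<eta> (x \<rhd> \<xi>)\<bar> \<le> norm \<eta> * norm (x \<rhd> \<xi>)"
        by (rule Cauchy_Schwarz_ineq2)
      also have "\<dots> \<le> norm \<eta> * (norm x * norm \<xi>)" by (intro mult_left_mono norm_blinfun) auto
      finally show ?thesis by (simp add: mult_ac)
    qed
  qed (auto simp: inner_simps blinfun.bilinear_simps)
  then obtain T where T: "\<And>\<eta> \<xi>. inner (T \<rhd> \<eta>) \<xi> = inner \<eta> (x \<rhd> \<xi>)" by blast
  have TC: "T \<rhd> (c *\<^sub>C \<eta>) = c *\<^sub>C T \<rhd> \<eta>" for c \<eta>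
  proof (rule vector_eq_rdot[THEN iffD1], rule allI)
    fix \<xi>
    show "inner (T \<rhd> (c *\<^sub>C \<eta>)) \<xi> = inner (c *\<^sub>C T \<rhd> \<eta>) \<xi>"
      by (simp only: T inner_scaleC_left bounded_opsD[OF x])
  qed
  show ?thesis
  proof (intro exI[of _ T] allI)
    have T': "inner (x \<rhd> \<xi>) \<eta> = inner \<xi> (T \<rhd> \<eta>)" for \<xi> \<eta>
      by (metis T inner_commute)
    fix \<xi> \<eta>
    show "cinner (x \<rhd> \<xi>) \<eta> = cinner \<xi> (T \<rhd> \<eta>)"
      by (simp add: cinner_eq_inner TC[symmetric] T')
  qed
qed

lemma adjoint_unique:
  fixes x :: "'h::complex_hilbert_space operator"
  assumes "\<And>\<xi> \<eta>. inner (x \<rhd> \<xi>) \<eta> = inner \<xi> (y \<rhd> \<eta>)"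
    "\<And>\<xi> \<eta>. inner (x \<rhd> \<xi>) \<eta> = inner \<xi> (z \<rhd> \<eta>)"
  shows "y = z"
  by (rule blinfun_eqI, rule vector_eq_ldot[THEN iffD1]) (metis assms)

lemma cinner_op_adj:
  assumes x: "x \<in> bounded_ops"
  shows "cinner (x \<rhd> \<xi>) \<eta> = cinner \<xi> (x\<^sup>\<dagger> \<rhd> \<eta>)"
proof -
  have "\<exists>!y. \<forall>\<xi> \<eta>. cinner (x \<rhd> \<xi>) \<eta> = cinner \<xi> (y \<rhd> \<eta>)"
  proof (rule ex_ex1I[OF exists_adjoint[OF x]])
    fix y z assume "\<forall>\<xi> \<eta>. cinner (x \<rhd> \<xi>) \<eta> = cinner \<xi> (y \<rhd> \<eta>)"
      "\<forall>\<xi> \<eta>. cinner (x \<rhd> \<xi>) \<eta> = cinner \<xi> (z \<rhd> \<eta>)"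
    thus "y = z" by (intro adjoint_unique[of x y z]) (metis inner_eq_Re_cinner)+
  qed
  from theI'[OF this] show ?thesis unfolding op_adj_def by blast
qed

lemma inner_op_adj:
  "x \<in> bounded_ops \<Longrightarrow> inner (x \<rhd> \<xi>) \<eta> = inner \<xi> (x\<^sup>\<dagger> \<rhd> \<eta>)"
  by (simp add: inner_eq_Re_cinner cinner_op_adj)

lemma inner_op_adj_left:
  "x \<in> bounded_ops \<Longrightarrow> inner (x\<^sup>\<dagger> \<rhd> \<xi>) \<eta> = inner \<xi> (x \<rhd> \<eta>)"
  by (metis inner_commute inner_op_adj)

lemma op_adj_eqI:
  assumes "x \<in> bounded_ops" "\<And>\<xi> \<eta>. inner (x \<rhd> \<xi>) \<eta> = inner \<xi> (y \<rhd> \<eta>)"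
  shows "x\<^sup>\<dagger> = y"
  by (rule adjoint_unique[of x]) (use assms in \<open>simp_all add: inner_op_adj[symmetric]\<close>)

lemma bounded_ops_adj: assumes x: "x \<in> bounded_ops" shows "x\<^sup>\<dagger> \<in> bounded_ops"
  unfolding bounded_ops_def mem_Collect_eq
proof (intro allI)
  fix c \<eta> show "x\<^sup>\<dagger> \<rhd> (c *\<^sub>C \<eta>) = c *\<^sub>C x\<^sup>\<dagger> \<rhd> \<eta>"
  proof (rule vector_eq_rdot[THEN iffD1], rule allI)
    fix \<xi>
    show "inner (x\<^sup>\<dagger> \<rhd> (c *\<^sub>C \<eta>)) \<xi> = inner (c *\<^sub>C x\<^sup>\<dagger> \<rhd> \<eta>) \<xi>"
      by (simp only: inner_op_adj_left[OF x] inner_scaleC_left bounded_opsD[OF x])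
  qed
qed

lemma op_adj_adj: "x \<in> bounded_ops \<Longrightarrow> (x\<^sup>\<dagger>)\<^sup>\<dagger> = x"
  by (intro op_adj_eqI bounded_ops_adj inner_op_adj_left)
lemma op_adj_compose: "x \<in> bounded_ops \<Longrightarrow> y \<in> bounded_ops \<Longrightarrow> (x \<cdot> y)\<^sup>\<dagger> = y\<^sup>\<dagger> \<cdot> x\<^sup>\<dagger>"
  by (intro op_adj_eqI bounded_ops_compose) (auto simp: inner_op_adj)
lemma op_adj_add: "x \<in> bounded_ops \<Longrightarrow> y \<in> bounded_ops \<Longrightarrow> (x + y)\<^sup>\<dagger> = x\<^sup>\<dagger> + y\<^sup>\<dagger>"
  by (intro op_adj_eqI bounded_ops_add) (auto simp: inner_op_adj blinfun.add_left inner_simps)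
lemma op_adj_scaleC: "x \<in> bounded_ops \<Longrightarrow> (op_scaleC c x)\<^sup>\<dagger> = op_scaleC (cnj c) (x\<^sup>\<dagger>)"
  by (intro op_adj_eqI bounded_ops_scaleC)
    (auto simp: inner_scaleC_left inner_op_adj bounded_opsD bounded_ops_adj)
lemma op_adj_id: "id_blinfun\<^sup>\<dagger> = id_blinfun"
  by (intro op_adj_eqI bounded_ops_id) auto

lemma norm_op_adj_le: assumes x: "x \<in> bounded_ops" shows "norm (x\<^sup>\<dagger>) \<le> norm x"
proof (rule norm_blinfun_bound)
  fix \<xi>
  have "(norm (x\<^sup>\<dagger> \<rhd> \<xi>))\<^sup>2 = inner \<xi> (x \<rhd> x\<^sup>\<dagger> \<rhd> \<xi>)"
    by (simp add: power2_norm_eq_inner inner_op_adj_left[OF x])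
  also have "\<dots> \<le> norm \<xi> * norm (x \<rhd> x\<^sup>\<dagger> \<rhd> \<xi>)" by (rule norm_cauchy_schwarz)
  also have "\<dots> \<le> norm \<xi> * (norm x * norm (x\<^sup>\<dagger> \<rhd> \<xi>))"
    by (intro mult_left_mono norm_blinfun) auto
  finally show "norm (x\<^sup>\<dagger> \<rhd> \<xi>) \<le> norm x * norm \<xi>"
    by (cases "norm (x\<^sup>\<dagger> \<rhd> \<xi>) = 0") (auto simp: power2_eq_square mult_ac)
qed simp

lemma op_scaleC_compose_left: "op_scaleC c x \<cdot> y = op_scaleC c (x \<cdot> y)"
  by (rule blinfun_eqI) simp
lemma op_scaleC_compose_right: "x \<in> bounded_ops \<Longrightarrow> x \<cdot> op_scaleC c y = op_scaleC c (x \<cdot> y)"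
  by (rule blinfun_eqI) (simp add: bounded_opsD)
lemma op_scaleC_scaleC: "op_scaleC c (op_scaleC d x) = op_scaleC (c * d) x"
  by (rule blinfun_eqI) (simp add: scaleC_scaleC)
lemma op_scaleC_one: "op_scaleC 1 x = x"
  by (rule blinfun_eqI) simp
lemma op_scaleC_minus_one: "op_scaleC (-1) x = - x"
  using scaleR_eq_op_scaleC[of "-1" x] by simp
lemma op_scaleC_minus_left: "op_scaleC (- c) x = - op_scaleC c x"
  using op_scaleC_scaleC[of "-1" c x] by (simp add: op_scaleC_minus_one)

lemma compose_assoc: "(x \<cdot> y) \<cdot> z = x \<cdot> (y \<cdot> z)"
  by (rule blinfun_eqI) simp
lemma compose_id [simp]: "x \<cdot> id_blinfun = x" "id_blinfun \<cdot> x = x"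
  by (auto intro: blinfun_eqI)

lemmas compose_linear =
  bounded_bilinear.add_left[OF bounded_bilinear_blinfun_compose]
  bounded_bilinear.add_right[OF bounded_bilinear_blinfun_compose]
  bounded_bilinear.diff_left[OF bounded_bilinear_blinfun_compose]
  bounded_bilinear.diff_right[OF bounded_bilinear_blinfun_compose]
  bounded_bilinear.minus_left[OF bounded_bilinear_blinfun_compose]
  bounded_bilinear.minus_right[OF bounded_bilinear_blinfun_compose]
  bounded_bilinear.scaleR_left[OF bounded_bilinear_blinfun_compose]
  bounded_bilinear.scaleR_right[OF bounded_bilinear_blinfun_compose]

section \<open>Commutants and the algebra structure\<close>

lemma commutant_antimono: "S \<subseteq> T \<Longrightarrow> commutant T \<subseteq> commutant S"
  by (auto simp: commutant_def)
lemma commutantD: "x \<in> commutant S \<Longrightarrow> y \<in> S \<Longrightarrow> x \<cdot> y = y \<cdot> x"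
  by (auto simp: commutant_def)
lemma commutant_bounded: "commutant S \<subseteq> bounded_ops"
  by (auto simp: commutant_def)
lemma subset_bicommutant: "S \<subseteq> bounded_ops \<Longrightarrow> S \<subseteq> commutant (commutant S)"
  by (auto simp: commutant_def)

lemma commutant_adj:
  assumes S: "S \<subseteq> bounded_ops" "\<And>y. y \<in> S \<Longrightarrow> y\<^sup>\<dagger> \<in> S" and x: "x \<in> commutant S"
  shows "x\<^sup>\<dagger> \<in> commutant S"
  unfolding commutant_def mem_Collect_eq
proof (intro conjI ballI)
  have xb: "x \<in> bounded_ops" using x commutant_bounded by blast
  show "x\<^sup>\<dagger> \<in> bounded_ops" by (rule bounded_ops_adj[OF xb])
  fix y assume y: "y \<in> S"
  hence yb: "y \<in> bounded_ops" using S by blast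
  have "x \<cdot> y\<^sup>\<dagger> = y\<^sup>\<dagger> \<cdot> x" by (rule commutantD[OF x S(2)[OF y]])
  hence "(x \<cdot> y\<^sup>\<dagger>)\<^sup>\<dagger> = (y\<^sup>\<dagger> \<cdot> x)\<^sup>\<dagger>" by simp
  thus "x\<^sup>\<dagger> \<cdot> y = y \<cdot> x\<^sup>\<dagger>"
    by (simp add: op_adj_compose xb yb bounded_ops_adj op_adj_adj)
qed

lemma commutant_id: "id_blinfun \<in> commutant S"
  by (simp add: commutant_def bounded_ops_id)
lemma commutant_add: "x \<in> commutant S \<Longrightarrow> y \<in> commutant S \<Longrightarrow> x + y \<in> commutant S"
  by (auto simp: commutant_def bounded_ops_add compose_linear)
lemma commutant_compose: "x \<in> commutant S \<Longrightarrow> y \<in> commutant S \<Longrightarrow> x \<cdot> y \<in> commutant S"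
  by (auto simp: commutant_def bounded_ops_compose) (metis compose_assoc)
lemma commutant_scaleC:
  "S \<subseteq> bounded_ops \<Longrightarrow> x \<in> commutant S \<Longrightarrow> op_scaleC c x \<in> commutant S"
  by (auto simp: commutant_def bounded_ops_scaleC op_scaleC_compose_left)
     (metis op_scaleC_compose_right subsetD)

lemma
  assumes M: "von_neumann_algebra M"
  shows vna_bounded: "M \<subseteq> bounded_ops"
    and vna_adj: "x \<in> M \<Longrightarrow> x\<^sup>\<dagger> \<in> M"
    and vna_bicommutant: "commutant (commutant M) = M"
    and vna_id: "id_blinfun \<in> M"
    and vna_add: "x \<in> M \<Longrightarrow> y \<in> M \<Longrightarrow> x + y \<in> M"
    and vna_compose: "x \<in> M \<Longrightarrow> y \<in> M \<Longrightarrow> x \<cdot> y \<in> M"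
    and vna_scaleC: "x \<in> M \<Longrightarrow> op_scaleC c x \<in> M"
proof -
  show *: "M \<subseteq> bounded_ops" "x \<in> M \<Longrightarrow> x\<^sup>\<dagger> \<in> M" "commutant (commutant M) = M"
    using M by (auto simp: von_neumann_algebra_def)
  show "id_blinfun \<in> M" using commutant_id *(3) by metis
  show "x \<in> M \<Longrightarrow> y \<in> M \<Longrightarrow> x + y \<in> M" using commutant_add *(3) by metis
  show "x \<in> M \<Longrightarrow> y \<in> M \<Longrightarrow> x \<cdot> y \<in> M" using commutant_compose *(3) by metis
  show "x \<in> M \<Longrightarrow> op_scaleC c x \<in> M" using commutant_scaleC[OF commutant_bounded] *(3) by metis
qed

lemma vna_diff: "von_neumann_algebra M \<Longrightarrow> x \<in> M \<Longrightarrow> y \<in> M \<Longrightarrow> x - y \<in> M"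
  using vna_add[of M x "op_scaleC (-1) y"] vna_scaleC[of M y "-1"]
    by (simp add: op_scaleC_minus_one)
lemma vna_zero: "von_neumann_algebra M \<Longrightarrow> 0 \<in> M"
  using vna_diff[of M id_blinfun id_blinfun] vna_id by auto
lemma vna_scaleR: "von_neumann_algebra M \<Longrightarrow> x \<in> M \<Longrightarrow> r *\<^sub>R x \<in> M"
  by (simp add: scaleR_eq_op_scaleC vna_scaleC)
lemma vna_minus: "von_neumann_algebra M \<Longrightarrow> x \<in> M \<Longrightarrow> - x \<in> M"
  using vna_scaleC[of M x "-1"] by (simp add: op_scaleC_minus_one)

lemma orth_proj_bounded_ops:
  fixes V :: "'h::complex_hilbert_space set"
  assumes V: "subspace V" "closed V" "\<And>c v. v \<in> V \<Longrightarrow> c *\<^sub>C v \<in> V"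
  shows "orth_proj V \<in> bounded_ops"
  unfolding bounded_ops_def mem_Collect_eq
proof (intro allI)
  fix c \<xi> show "orth_proj V \<rhd> (c *\<^sub>C \<xi>) = c *\<^sub>C orth_proj V \<rhd> \<xi>"
    by (rule orth_proj_commutes[where g="\<lambda>v. cnj c *\<^sub>C v"])
      (use V in \<open>auto simp: inner_scaleC_left scaleC_diff_right\<close>)
qed

text \<open>
  For \<open>S\<close> the commutant of a von Neumann algebra, this turns the invariance of a closed subspace
  under \<open>S\<close> into membership of its projection in the algebra.
\<close>

lemma orth_proj_in_commutant:
  fixes V :: "'h::complex_hilbert_space set"
  assumes V: "subspace V" "closed V" "\<And>c v. v \<in> V \<Longrightarrow> c *\<^sub>C v \<in> V"
    and S: "S \<subseteq> bounded_ops" "\<And>y. y \<in> S \<Longrightarrow> y\<^sup>\<dagger> \<in> S"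
    and inv: "\<And>y v. y \<in> S \<Longrightarrow> v \<in> V \<Longrightarrow> y \<rhd> v \<in> V"
  shows "orth_proj V \<in> commutant S"
  unfolding commutant_def mem_Collect_eq
proof (intro conjI ballI orth_proj_bounded_ops V)
  fix y assume y: "y \<in> S"
  show "orth_proj V \<cdot> y = y \<cdot> orth_proj V"
    by (rule blinfun_eqI, simp, rule orth_proj_commutes[where g="blinfun_apply (y\<^sup>\<dagger>)"])
      (use V S inv y in \<open>auto simp: inner_op_adj subset_iff blinfun.diff_right\<close>)
qed

lemma orth_proj_adj:
  fixes V :: "'h::complex_hilbert_space set"
  assumes V: "subspace V" "closed V" "\<And>c v. v \<in> V \<Longrightarrow> c *\<^sub>C v \<in> V"
  shows "(orth_proj V)\<^sup>\<dagger> = orth_proj V"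
  by (intro op_adj_eqI orth_proj_bounded_ops V orth_proj_selfadjoint)

section \<open>The countable amplification of a Hilbert space\<close>

text \<open>
  The Hilbert sum of countably many copies of \<open>'h\<close>. An ultraweakly continuous functional is a
  vector functional of the diagonal action on this space, and the closed subspaces of it carry the
  projection argument behind the bicommutant theorem.
\<close>

typedef (overloaded) 'h l2 = "{f :: nat \<Rightarrow> 'h::complex_hilbert_space. summable (\<lambda>n. (norm (f n))\<^sup>2)}"
  morphisms l2_nth Abs_l2
  by (rule exI[of _ "\<lambda>_. 0"]) simp

setup_lifting type_definition_l2

lemma summable_l2: "summable (\<lambda>n. (norm (l2_nth f n))\<^sup>2)"
  using l2_nth[of f] by simp

lemma l2_eqI: "(\<And>n. l2_nth f n = l2_nth g n) \<Longrightarrow> f = g"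
  by (metis l2_nth_inject ext)

lemma norm_add_square_le: "(norm (a + b))\<^sup>2 \<le> 2 * (norm a)\<^sup>2 + 2 * (norm (b::'a::real_inner))\<^sup>2"
proof -
  have "(norm (a + b))\<^sup>2 + (norm (a - b))\<^sup>2 = 2 * (norm a)\<^sup>2 + 2 * (norm b)\<^sup>2"
    unfolding power2_norm_eq_inner by (simp add: inner_simps inner_commute)
  thus ?thesis by (smt (verit) zero_le_power2)
qed

lemma product_le_squares: "(a::real) * b \<le> a\<^sup>2 + b\<^sup>2"
  using zero_le_power2[of "a - b"] zero_le_power2[of "a + b"]
    by (simp add: power2_eq_square algebra_simps)

lemma summable_l2_bound:
  fixes u :: "nat \<Rightarrow> 'a::banach"
  assumes "\<And>n. norm (u n) \<le> c * (norm (l2_nth f n))\<^sup>2 + d * (norm (l2_nth g n))\<^sup>2"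
  shows "summable u"
  by (rule summable_comparison_test'[of "\<lambda>n. c * (norm (l2_nth f n))\<^sup>2 + d * (norm (l2_nth g n))\<^sup>2"])
    (use assms in \<open>auto intro!: summable_add summable_mult summable_l2\<close>)

instantiation l2 :: (complex_hilbert_space) real_vector
begin
lift_definition zero_l2 :: "'a l2" is "\<lambda>_. 0" by simp
lift_definition plus_l2 :: "'a l2 \<Rightarrow> 'a l2 \<Rightarrow> 'a l2" is "\<lambda>f g n. f n + g n"
proof -
  fix f g :: "nat \<Rightarrow> 'a" assume "summable (\<lambda>n. (norm (f n))\<^sup>2)" "summable (\<lambda>n. (norm (g n))\<^sup>2)"
  hence "summable (\<lambda>n. 2 * (norm (f n))\<^sup>2 + 2 * (norm (g n))\<^sup>2)"
    by (intro summable_add summable_mult)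
  thus "summable (\<lambda>n. (norm (f n + g n))\<^sup>2)"
    by (rule summable_comparison_test'[of _ 0]) (simp add: norm_add_square_le)
qed
lift_definition uminus_l2 :: "'a l2 \<Rightarrow> 'a l2" is "\<lambda>f n. - f n" by simp
definition minus_l2 :: "'a l2 \<Rightarrow> 'a l2 \<Rightarrow> 'a l2" where "minus_l2 f g = f + - g"
lift_definition scaleR_l2 :: "real \<Rightarrow> 'a l2 \<Rightarrow> 'a l2" is "\<lambda>r f n. r *\<^sub>R f n"
  by (simp add: power_mult_distrib)
instance
proof
  note rep = zero_l2.rep_eq plus_l2.rep_eq uminus_l2.rep_eq minus_l2_def scaleR_l2.rep_eq
  fix f g h :: "'a l2" and r s :: real
  show "f + g + h = f + (g + h)" by (rule l2_eqI) (simp only: rep add.assoc)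
  show "f + g = g + f" by (rule l2_eqI) (simp only: rep add.commute)
  show "0 + f = f" by (rule l2_eqI) (simp only: rep add_0)
  show "- f + f = 0" by (rule l2_eqI) (simp only: rep left_minus)
  show "f - g = f + - g" by (rule minus_l2_def)
  show "r *\<^sub>R (f + g) = r *\<^sub>R f + r *\<^sub>R g" by (rule l2_eqI) (simp only: rep scaleR_add_right)
  show "(r + s) *\<^sub>R f = r *\<^sub>R f + s *\<^sub>R f" by (rule l2_eqI) (simp only: rep scaleR_add_left)
  show "r *\<^sub>R s *\<^sub>R f = (r * s) *\<^sub>R f" by (rule l2_eqI) (simp only: rep scaleR_scaleR)
  show "1 *\<^sub>R f = f" by (rule l2_eqI) (simp only: rep scaleR_one)
qed
end

lemma l2_nth_simps [simp]:
  "l2_nth 0 n = 0" "l2_nth (f + g) n = l2_nth f n + l2_nth g n" "l2_nth (- f) n = - l2_nth f n"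
  "l2_nth (f - g) n = l2_nth f n - l2_nth g n" "l2_nth (r *\<^sub>R f) n = r *\<^sub>R l2_nth f n"
proof -
  show "l2_nth (f - g) n = l2_nth f n - l2_nth g n"
    unfolding minus_l2_def plus_l2.rep_eq uminus_l2.rep_eq by (rule add_uminus_conv_diff)
qed (simp_all only: zero_l2.rep_eq plus_l2.rep_eq uminus_l2.rep_eq scaleR_l2.rep_eq)

lemma summable_inner_l2: "summable (\<lambda>n. inner (l2_nth f n) (l2_nth g n))"
proof (rule summable_l2_bound[of _ 1 f 1 g])
  fix n show "norm (inner (l2_nth f n) (l2_nth g n)) \<le> 1 * (norm (l2_nth f n))\<^sup>2 + 1 * (norm (l2_nth g n))\<^sup>2"
    using Cauchy_Schwarz_ineq2[of "l2_nth f n" "l2_nth g n"]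
      product_le_squares[of "norm (l2_nth f n)" "norm (l2_nth g n)"] by simp
qed

lemma summable_cinner_l2: "summable (\<lambda>n. cinner (l2_nth f n) (l2_nth g n))"
proof (rule summable_l2_bound[of _ 1 f 1 g])
  fix n show "norm (cinner (l2_nth f n) (l2_nth g n)) \<le> 1 * (norm (l2_nth f n))\<^sup>2 + 1 * (norm (l2_nth g n))\<^sup>2"
    using norm_cinner_le[of "l2_nth f n" "l2_nth g n"]
      product_le_squares[of "norm (l2_nth f n)" "norm (l2_nth g n)"] by simp
qed

instantiation l2 :: (complex_hilbert_space) real_inner
begin
definition inner_l2 :: "'a l2 \<Rightarrow> 'a l2 \<Rightarrow> real" where
  "inner_l2 f g = (\<Sum>n. inner (l2_nth f n) (l2_nth g n))"
definition norm_l2 :: "'a l2 \<Rightarrow> real" where "norm_l2 f = sqrt (inner f f)"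
definition sgn_l2 :: "'a l2 \<Rightarrow> 'a l2" where "sgn_l2 f = inverse (norm f) *\<^sub>R f"
definition dist_l2 :: "'a l2 \<Rightarrow> 'a l2 \<Rightarrow> real" where "dist_l2 f g = norm (f - g)"
definition uniformity_l2 :: "('a l2 \<times> 'a l2) filter" where
  "uniformity_l2 = (INF e\<in>{0<..}. principal {(f, g). dist f g < e})"
definition open_l2 :: "'a l2 set \<Rightarrow> bool" where
  "open_l2 U = (\<forall>f\<in>U. eventually (\<lambda>(f', g). f' = f \<longrightarrow> g \<in> U) uniformity)"
instance
proof
  fix f g h :: "'a l2" and r :: real
  show "dist f g = norm (f - g)" by (rule dist_l2_def)
  show "sgn f = inverse (norm f) *\<^sub>R f" by (rule sgn_l2_def)
  show "uniformity = (INF e\<in>{0<..}. principal {(f :: 'a l2, g). dist f g < e})"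
    by (rule uniformity_l2_def)
  show "open U = (\<forall>f\<in>U. eventually (\<lambda>(f', g). f' = f \<longrightarrow> g \<in> U) uniformity)" for U :: "'a l2 set"
    by (rule open_l2_def)
  show "norm f = sqrt (inner f f)" by (rule norm_l2_def)
  show "inner f g = inner g f" by (simp add: inner_l2_def inner_commute)
  show "inner (f + g) h = inner f h + inner g h"
    by (simp add: inner_l2_def inner_simps suminf_add summable_inner_l2)
  show "inner (r *\<^sub>R f) g = r * inner f g"
    by (simp add: inner_l2_def suminf_mult summable_inner_l2)
  have s: "summable (\<lambda>n. inner (l2_nth f n) (l2_nth f n))" by (rule summable_inner_l2)
  show "0 \<le> inner f f" unfolding inner_l2_def by (rule suminf_nonneg[OF s]) simp
  show "(inner f f = 0) = (f = 0)"
    unfolding inner_l2_def using suminf_eq_zero_iff[OF s] by (auto intro: l2_eqI)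
qed
end

lemma norm_l2_square: "(norm f)\<^sup>2 = (\<Sum>n. (norm (l2_nth f n))\<^sup>2)"
  unfolding power2_norm_eq_inner inner_l2_def by simp

lemma norm_l2_nth_le: "norm (l2_nth f n) \<le> norm f"
proof -
  have "(norm (l2_nth f n))\<^sup>2 = (\<Sum>k\<in>{n}. (norm (l2_nth f k))\<^sup>2)" by simp
  also have "\<dots> \<le> (norm f)\<^sup>2"
    unfolding norm_l2_square by (rule sum_le_suminf[OF summable_l2]) auto
  finally show ?thesis by (rule power2_le_imp_le) simp
qed

text \<open>
  Coordinates of a Cauchy sequence converge; the bound on the partial sums of the squared
  differences survives the limit and gives both square summability and convergence in norm.
\<close>

instance l2 :: (complex_hilbert_space) complete_space
proof
  fix X :: "nat \<Rightarrow> 'a l2" assume X: "Cauchy X"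
  have "Cauchy (\<lambda>k. l2_nth (X k) n)" for n
  proof (rule metric_CauchyI)
    fix e :: real assume "e > 0"
    then obtain K where "\<And>j k. j \<ge> K \<Longrightarrow> k \<ge> K \<Longrightarrow> dist (X j) (X k) < e" using metric_CauchyD[OF X]
      by blast
    thus "\<exists>K. \<forall>j\<ge>K. \<forall>k\<ge>K. dist (l2_nth (X j) n) (l2_nth (X k) n) < e"
      by (intro exI[of _ K] allI impI) (metis dist_norm l2_nth_simps(4) norm_l2_nth_le le_less_trans)
  qed
  hence "\<forall>n. \<exists>L. (\<lambda>k. l2_nth (X k) n) \<longlonglongrightarrow> L" using Cauchy_convergent convergent_def by blast
  then obtain L where L: "\<And>n. (\<lambda>k. l2_nth (X k) n) \<longlonglongrightarrow> L n" by metis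
  have part: "\<exists>K. \<forall>j\<ge>K. \<forall>m. (\<Sum>n<m. (norm (l2_nth (X j) n - L n))\<^sup>2) \<le> e\<^sup>2" if e: "e > 0" for e
  proof -
    obtain K where K: "\<And>j k. j \<ge> K \<Longrightarrow> k \<ge> K \<Longrightarrow> dist (X j) (X k) < e" using metric_CauchyD[OF X e]
      by blast
    show ?thesis
    proof (intro exI allI impI)
      fix j m assume j: "j \<ge> K"
      have "(\<Sum>n<m. (norm (l2_nth (X j) n - l2_nth (X k) n))\<^sup>2) \<le> e\<^sup>2" if k: "k \<ge> K" for k
      proof -
        have "(\<Sum>n<m. (norm (l2_nth (X j - X k) n))\<^sup>2) \<le> (norm (X j - X k))\<^sup>2"
          unfolding norm_l2_square by (rule sum_le_suminf[OF summable_l2]) auto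
        also have "\<dots> \<le> e\<^sup>2" using K[OF j k] by (intro power_mono) (auto simp: dist_norm)
        finally show ?thesis by simp
      qed
      thus "(\<Sum>n<m. (norm (l2_nth (X j) n - L n))\<^sup>2) \<le> e\<^sup>2"
        by (intro LIMSEQ_le_const2[of "\<lambda>k. \<Sum>n<m. (norm (l2_nth (X j) n - l2_nth (X k) n))\<^sup>2"])
          (auto intro!: tendsto_intros L)
    qed
  qed
  have diff: "summable (\<lambda>n. (norm (l2_nth (X j) n - L n))\<^sup>2)"
    if "\<forall>m. (\<Sum>n<m. (norm (l2_nth (X j) n - L n))\<^sup>2) \<le> e\<^sup>2" for j e
    by (rule summableI_nonneg_bounded) (use that in auto)
  define Y where "Y = Abs_l2 L"
  have "summable (\<lambda>n. (norm (L n))\<^sup>2)"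
  proof -
    obtain K where K: "\<forall>j\<ge>K. \<forall>m. (\<Sum>n<m. (norm (l2_nth (X j) n - L n))\<^sup>2) \<le> 1\<^sup>2"
      using part[of 1] by auto
    define D where "D = Abs_l2 (\<lambda>n. l2_nth (X K) n - L n)"
    have D: "l2_nth D n = l2_nth (X K) n - L n" for n
      unfolding D_def using diff[of K 1] K by (subst Abs_l2_inverse) auto
    show ?thesis using summable_l2[of "X K - D"] by (simp add: D)
  qed
  hence Y: "l2_nth Y n = L n" for n unfolding Y_def by (subst Abs_l2_inverse) auto
  have "X \<longlonglongrightarrow> Y"
  proof (rule metric_LIMSEQ_I)
    fix r :: real assume r: "r > 0"
    obtain K where K: "\<forall>j\<ge>K. \<forall>m. (\<Sum>n<m. (norm (l2_nth (X j) n - L n))\<^sup>2) \<le> (r/2)\<^sup>2"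
      using part[of "r/2"] r by auto
    have "dist (X j) Y < r" if j: "j \<ge> K" for j
    proof -
      have "(norm (X j - Y))\<^sup>2 \<le> (r/2)\<^sup>2"
        unfolding norm_l2_square
          by (rule suminf_le_const[OF summable_l2]) (use K j in \<open>simp add: Y\<close>)
      hence "norm (X j - Y) \<le> r/2" by (rule power2_le_imp_le) (use r in simp)
      thus ?thesis using r by (simp add: dist_norm)
    qed
    thus "\<exists>K. \<forall>j\<ge>K. dist (X j) Y < r" by blast
  qed
  thus "convergent X" by (auto simp: convergent_def)
qed

instantiation l2 :: (complex_hilbert_space) complex_hilbert_space
begin
lift_definition scaleC_l2 :: "complex \<Rightarrow> 'a l2 \<Rightarrow> 'a l2" is "\<lambda>c f n. c *\<^sub>C f n"
  by (simp add: norm_scaleC power_mult_distrib)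
definition cinner_l2 :: "'a l2 \<Rightarrow> 'a l2 \<Rightarrow> complex" where
  "cinner_l2 f g = (\<Sum>n. cinner (l2_nth f n) (l2_nth g n))"
instance
proof
  fix f g h :: "'a l2" and c d :: complex and r :: real
  show "c *\<^sub>C (f + g) = c *\<^sub>C f + c *\<^sub>C g" by transfer (simp add: scaleC_add_right)
  show "(c + d) *\<^sub>C f = c *\<^sub>C f + d *\<^sub>C f" by transfer (simp add: scaleC_add_left)
  show "c *\<^sub>C d *\<^sub>C f = (c * d) *\<^sub>C f" by transfer (simp add: scaleC_scaleC)
  show "r *\<^sub>R f = complex_of_real r *\<^sub>C f" by transfer (simp add: scaleR_eq_scaleC)
  show "cinner f g = cnj (cinner g f)"
  proof -
    have "(\<lambda>n. cnj (cinner (l2_nth g n) (l2_nth f n))) sums cnj (cinner g f)"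
      unfolding cinner_l2_def sums_cnj by (rule summable_sums[OF summable_cinner_l2])
    hence "(\<lambda>n. cinner (l2_nth f n) (l2_nth g n)) sums cnj (cinner g f)"
      by (simp add: cinner_commute[symmetric])
    thus ?thesis unfolding cinner_l2_def[of f g] by (rule sums_unique[symmetric])
  qed
  show "cinner (f + g) h = cinner f h + cinner g h"
    by (simp add: cinner_l2_def cinner_add_left suminf_add summable_cinner_l2)
  show "cinner (c *\<^sub>C f) g = c * cinner f g"
    by (simp add: cinner_l2_def scaleC_l2.rep_eq cinner_scaleC_left suminf_mult summable_cinner_l2)
  show "inner f g = Re (cinner f g)"
    unfolding cinner_l2_def inner_l2_def inner_eq_Re_cinner
    by (rule sums_unique[symmetric, OF sums_Re[OF summable_sums[OF summable_cinner_l2]]])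
qed
end

lemma l2_nth_scaleC [simp]: "l2_nth (c *\<^sub>C f) n = c *\<^sub>C l2_nth f n"
  by (simp add: scaleC_l2.rep_eq)

lift_definition l2_map :: "'h::complex_hilbert_space operator \<Rightarrow> 'h l2 \<Rightarrow> 'h l2" is "\<lambda>x f n. x \<rhd> f n"
proof -
  fix x :: "'h operator" and f :: "nat \<Rightarrow> 'h" assume s: "summable (\<lambda>n. (norm (f n))\<^sup>2)"
  show "summable (\<lambda>n. (norm (x \<rhd> f n))\<^sup>2)"
    by (rule summable_comparison_test'[OF summable_mult[OF s, of "(norm x)\<^sup>2"], of 0])
      (simp add: power_mult_distrib[symmetric] power_mono norm_blinfun)
qed

definition amplify :: "'h::complex_hilbert_space operator \<Rightarrow> 'h l2 operator" where
  "amplify x = Blinfun (l2_map x)"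

lemma norm_l2_map_le: "norm (l2_map x f) \<le> norm x * norm f"
proof -
  have "(norm (l2_map x f))\<^sup>2 \<le> (\<Sum>n. (norm x)\<^sup>2 * (norm (l2_nth f n))\<^sup>2)"
    unfolding norm_l2_square
    by (intro suminf_le summable_l2 summable_mult)
      (simp add: l2_map.rep_eq power_mult_distrib[symmetric] power_mono norm_blinfun)
  also have "\<dots> = (norm x * norm f)\<^sup>2"
    by (simp add: suminf_mult[OF summable_l2] norm_l2_square power_mult_distrib)
  finally show ?thesis by (rule power2_le_imp_le) simp
qed

lemma amplify_apply: "blinfun_apply (amplify x) = l2_map x"
  unfolding amplify_def
proof (rule bounded_linear_Blinfun_apply, rule bounded_linear_intro)
  show "norm (l2_map x f) \<le> norm f * norm x" for f using norm_l2_map_le[of x f]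
    by (simp add: mult.commute)
qed (auto intro!: l2_eqI simp: l2_map.rep_eq blinfun.bilinear_simps)

lemma l2_nth_amplify [simp]: "l2_nth (amplify x \<rhd> f) n = x \<rhd> l2_nth f n"
  by (simp add: amplify_apply l2_map.rep_eq)

lemma norm_amplify_le: "norm (amplify x \<rhd> f) \<le> norm x * norm f"
  by (simp add: amplify_apply norm_l2_map_le)

lemma amplify_compose: "amplify (x \<cdot> y) = amplify x \<cdot> amplify y"
  by (intro blinfun_eqI l2_eqI) simp
lemma amplify_diff: "amplify (x - y) = amplify x - amplify y"
  by (intro blinfun_eqI l2_eqI) (simp add: blinfun.diff_left)
lemma amplify_add: "amplify (x + y) = amplify x + amplify y"
  by (intro blinfun_eqI l2_eqI) (simp add: blinfun.add_left)
lemma amplify_scaleR: "amplify (r *\<^sub>R x) = r *\<^sub>R amplify x"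
  by (intro blinfun_eqI l2_eqI) (simp add: blinfun.scaleR_left)
lemma amplify_scaleC: "amplify (op_scaleC c x) = op_scaleC c (amplify x)"
  by (intro blinfun_eqI l2_eqI) simp
lemma amplify_bounded_ops: "x \<in> bounded_ops \<Longrightarrow> amplify x \<in> bounded_ops"
  unfolding bounded_ops_def by (auto intro!: l2_eqI)
lemma amplify_adj: "x \<in> bounded_ops \<Longrightarrow> (amplify x)\<^sup>\<dagger> = amplify (x\<^sup>\<dagger>)"
  by (intro op_adj_eqI amplify_bounded_ops) (simp_all add: inner_l2_def inner_op_adj)

lift_definition l2_unit :: "nat \<Rightarrow> 'h::complex_hilbert_space \<Rightarrow> 'h l2" is "\<lambda>n \<xi> k. if k = n then \<xi> else 0"
proof -
  fix n :: nat and \<xi> :: 'h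
  have "(\<lambda>k::nat. (norm (if k = n then \<xi> else 0))\<^sup>2) = (\<lambda>k. if k = n then (norm \<xi>)\<^sup>2 else 0)"
    by auto
  thus "summable (\<lambda>k. (norm (if k = n then \<xi> else 0))\<^sup>2)"
    using sums_summable[OF sums_single[of n "\<lambda>_. (norm \<xi>)\<^sup>2"]] by simp
qed

lemma inner_l2_unit: "inner f (l2_unit n \<eta>) = inner (l2_nth f n) \<eta>"
proof -
  have "(\<lambda>k. inner (l2_nth f k) (l2_nth (l2_unit n \<eta>) k)) = (\<lambda>k. if k = n then inner (l2_nth f k) \<eta> else 0)"
    by (auto simp: l2_unit.rep_eq)
  thus ?thesis unfolding inner_l2_def
    using sums_unique[OF sums_single[of n "\<lambda>k. inner (l2_nth f k) \<eta>"]] by simp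
qed

lemma norm_l2_unit: "norm (l2_unit n \<xi>) = norm \<xi>"
  by (simp add: norm_eq_sqrt_inner inner_l2_unit) (simp add: l2_unit.rep_eq)

lemma amplify_l2_unit: "amplify x \<rhd> l2_unit n \<xi> = l2_unit n (x \<rhd> \<xi>)"
  by (rule l2_eqI) (simp add: l2_unit.rep_eq)

text \<open>
  Operators on the amplified space are infinite matrices of operators on \<open>'h\<close>.
\<close>

definition l2_entry :: "'h::complex_hilbert_space l2 operator \<Rightarrow> nat \<Rightarrow> nat \<Rightarrow> 'h operator" where
  "l2_entry T m n = Blinfun (\<lambda>\<xi>. l2_nth (T \<rhd> l2_unit n \<xi>) m)"

lemma l2_entry_apply: "l2_entry T m n \<rhd> \<xi> = l2_nth (T \<rhd> l2_unit n \<xi>) m"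
proof -
  have add: "l2_unit n (\<xi> + \<eta>) = l2_unit n \<xi> + l2_unit n \<eta>" for \<xi> \<eta> :: 'a
    by (rule l2_eqI) (simp add: l2_unit.rep_eq)
  have scale: "l2_unit n (r *\<^sub>R \<xi>) = r *\<^sub>R l2_unit n \<xi>" for r and \<xi> :: 'a
    by (rule l2_eqI) (simp add: l2_unit.rep_eq)
  have "bounded_linear (\<lambda>\<xi>. l2_nth (T \<rhd> l2_unit n \<xi>) m)"
  proof (rule bounded_linear_intro)
    fix \<xi> :: 'a
    have "norm (l2_nth (T \<rhd> l2_unit n \<xi>) m) \<le> norm (T \<rhd> l2_unit n \<xi>)"
      by (rule norm_l2_nth_le)
    also have "\<dots> \<le> norm T * norm (l2_unit n \<xi>)" by (rule norm_blinfun)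
    finally show "norm (l2_nth (T \<rhd> l2_unit n \<xi>) m) \<le> norm \<xi> * norm T"
      by (simp add: norm_l2_unit mult.commute)
  qed (simp_all add: add scale blinfun.bilinear_simps)
  thus ?thesis unfolding l2_entry_def by (simp add: bounded_linear_Blinfun_apply)
qed

lemma l2_entry_bounded_ops:
  assumes T: "T \<in> bounded_ops" shows "l2_entry T m n \<in> bounded_ops"
  unfolding bounded_ops_def mem_Collect_eq
proof (intro allI)
  fix c and \<xi> :: 'a
  have "l2_unit n (c *\<^sub>C \<xi>) = c *\<^sub>C l2_unit n \<xi>" by (rule l2_eqI) (simp add: l2_unit.rep_eq)
  thus "l2_entry T m n \<rhd> (c *\<^sub>C \<xi>) = c *\<^sub>C l2_entry T m n \<rhd> \<xi>"
    by (simp add: l2_entry_apply bounded_opsD[OF T])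
qed

lemma l2_entry_commutes:
  assumes "T \<cdot> amplify x = amplify x \<cdot> T"
  shows "l2_entry T m n \<cdot> x = x \<cdot> l2_entry T m n"
proof (rule blinfun_eqI)
  fix \<xi>
  have "(T \<cdot> amplify x) \<rhd> l2_unit n \<xi> = (amplify x \<cdot> T) \<rhd> l2_unit n \<xi>"
    by (simp only: assms)
  thus "(l2_entry T m n \<cdot> x) \<rhd> \<xi> = (x \<cdot> l2_entry T m n) \<rhd> \<xi>"
    by (simp add: l2_entry_apply amplify_l2_unit)
qed

text \<open>
  A self-adjoint matrix commutes with a diagonal operator once each of its entries does. Moving
  the operators to the other side of the inner product makes it enough to test on the vectors
  \<open>l2_unit n \<eta>\<close>; this is why the entries are required to commute with the adjoint of \<open>x\<close>.
\<close>

lemma amplify_commutes_of_entries: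
  assumes x: "x \<in> bounded_ops" and T: "\<And>f g. inner (T \<rhd> f) g = inner f (T \<rhd> g)"
    and c: "\<And>m n. l2_entry T m n \<cdot> x\<^sup>\<dagger> = x\<^sup>\<dagger> \<cdot> l2_entry T m n"
  shows "T \<cdot> amplify x = amplify x \<cdot> T"
proof (intro blinfun_eqI l2_eqI)
  fix f n
  have *: "T \<rhd> amplify (x\<^sup>\<dagger>) \<rhd> l2_unit n \<eta> = amplify (x\<^sup>\<dagger>) \<rhd> T \<rhd> l2_unit n \<eta>" for \<eta>
  proof (rule l2_eqI)
    fix m
    have "(l2_entry T m n \<cdot> x\<^sup>\<dagger>) \<rhd> \<eta> = (x\<^sup>\<dagger> \<cdot> l2_entry T m n) \<rhd> \<eta>" by (simp only: c)
    thus "l2_nth (T \<rhd> amplify (x\<^sup>\<dagger>) \<rhd> l2_unit n \<eta>) m = l2_nth (amplify (x\<^sup>\<dagger>) \<rhd> T \<rhd> l2_unit n \<eta>) m"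
      by (simp add: l2_entry_apply amplify_l2_unit)
  qed
  note adj = inner_op_adj[OF amplify_bounded_ops[OF x], unfolded amplify_adj[OF x]]
  show "l2_nth ((T \<cdot> amplify x) \<rhd> f) n = l2_nth ((amplify x \<cdot> T) \<rhd> f) n"
  proof (rule vector_eq_rdot[THEN iffD1], rule allI)
    fix \<eta>
    have "inner (l2_nth ((T \<cdot> amplify x) \<rhd> f) n) \<eta> = inner (T \<rhd> amplify x \<rhd> f) (l2_unit n \<eta>)"
      by (simp only: inner_l2_unit blinfun_apply_blinfun_compose)
    also have "\<dots> = inner (amplify x \<rhd> T \<rhd> f) (l2_unit n \<eta>)"
      by (simp only: T adj *)
    finally show "inner (l2_nth ((T \<cdot> amplify x) \<rhd> f) n) \<eta> = inner (l2_nth ((amplify x \<cdot> T) \<rhd> f) n) \<eta>"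
      by (simp only: inner_l2_unit blinfun_apply_blinfun_compose)
  qed
qed

section \<open>Normality in terms of a single amplified vector\<close>

text \<open>
  Two vectors of the amplified space can be merged into one whose even and odd coordinates are
  theirs; so finitely many seminorms \<open>x \<mapsto> \<parallel>x f\<parallel>\<close> are dominated by a single one.
\<close>

lemma l2_interleave:
  fixes f g :: "'h::complex_hilbert_space l2"
  shows "\<exists>h. \<forall>x. (norm (amplify x \<rhd> h))\<^sup>2 = (norm (amplify x \<rhd> f))\<^sup>2 + (norm (amplify x \<rhd> g))\<^sup>2"
proof -
  define w where "w = (\<lambda>n. if even n then l2_nth f (n div 2) else l2_nth g ((n - 1) div 2))"
  have "(\<lambda>n. if even n then (norm (x \<rhd> l2_nth f (n div 2)))\<^sup>2 else (norm (x \<rhd> l2_nth g ((n - 1) div 2)))\<^sup>2)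
      sums ((norm (amplify x \<rhd> g))\<^sup>2 + (norm (amplify x \<rhd> f))\<^sup>2)" for x
    using sums_if[OF summable_sums[OF summable_l2[of "amplify x \<rhd> g"]] summable_sums[OF summable_l2[of "amplify x \<rhd> f"]]]
    unfolding norm_l2_square l2_nth_amplify .
  hence s: "(\<lambda>n. (norm (x \<rhd> w n))\<^sup>2) sums ((norm (amplify x \<rhd> f))\<^sup>2 + (norm (amplify x \<rhd> g))\<^sup>2)" for x
    unfolding w_def if_distrib[of "\<lambda>u. (norm (x \<rhd> u))\<^sup>2"] by (subst add.commute)
  have "summable (\<lambda>n. (norm (w n))\<^sup>2)" using sums_summable[OF s[of id_blinfun]] by simp
  hence w: "l2_nth (Abs_l2 w) n = w n" for n by (subst Abs_l2_inverse) auto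
  have "(norm (amplify x \<rhd> Abs_l2 w))\<^sup>2 = (norm (amplify x \<rhd> f))\<^sup>2 + (norm (amplify x \<rhd> g))\<^sup>2" for x
    unfolding norm_l2_square[of "amplify x \<rhd> Abs_l2 w"] using sums_unique[OF s[of x]]
      by (simp add: w)
  thus ?thesis by blast
qed

text \<open>
  A subbasic functional is \<open>x \<mapsto> \<langle>x f, g\<rangle>\<close> for vectors \<open>f, g\<close> of the amplified space and is bounded by
  \<open>\<parallel>x f\<parallel> \<parallel>g\<parallel>\<close>, so rescaling \<open>f\<close> handles a subbasic neighbourhood. Finite intersections are
  handled by interleaving.
\<close>

lemma ultraweak_neighbourhood_of_zero:
  fixes W :: "'h::complex_hilbert_space operator set"
  assumes "openin ultraweak_topology W" "0 \<in> W"
  shows "\<exists>\<zeta>. \<forall>x. norm (amplify x \<rhd> \<zeta>) < 1 \<longrightarrow> x \<in> W"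
proof -
  have "generate_topology_on {(\<lambda>x. \<Sum>n. cinner (x \<rhd> \<xi> n) (\<eta> n)) -` U | (\<xi> :: nat \<Rightarrow> 'h) (\<eta> :: nat \<Rightarrow> 'h) U.
        summable (\<lambda>n. (norm (\<xi> n))\<^sup>2) \<and> summable (\<lambda>n. (norm (\<eta> n))\<^sup>2) \<and> open U} W"
    using assms(1) unfolding ultraweak_topology_def by (simp add: openin_topology_generated_by_iff)
  thus ?thesis using assms(2)
  proof induction
    case Empty thus ?case by simp
  next
    case (Int a b)
    then obtain f g where f: "\<And>x. norm (amplify x \<rhd> f) < 1 \<Longrightarrow> x \<in> a"
      and g: "\<And>x. norm (amplify x \<rhd> g) < 1 \<Longrightarrow> x \<in> b" by blast
    obtain h where h: "\<And>x. (norm (amplify x \<rhd> h))\<^sup>2 = (norm (amplify x \<rhd> f))\<^sup>2 + (norm (amplify x \<rhd> g))\<^sup>2"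
      using l2_interleave by blast
    show ?case
    proof (intro exI allI impI)
      fix x assume "norm (amplify x \<rhd> h) < 1"
      hence "(norm (amplify x \<rhd> h))\<^sup>2 < 1\<^sup>2" by (intro power_strict_mono) auto
      hence "(norm (amplify x \<rhd> f))\<^sup>2 < 1\<^sup>2" "(norm (amplify x \<rhd> g))\<^sup>2 < 1\<^sup>2"
        using h[of x] by (auto intro: le_less_trans[rotated])
      hence "norm (amplify x \<rhd> f) < 1" "norm (amplify x \<rhd> g) < 1"
        by (auto simp: power_less_one_iff abs_square_less_1)
      thus "x \<in> a \<inter> b" using f g by blast
    qed
  next
    case (UN K)
    then obtain k where "k \<in> K" "0 \<in> k" by blast
    with UN.IH[of k] show ?case by blast
  next
    case (Basis s)
    then obtain \<xi> \<eta> U where s: "s = (\<lambda>x. \<Sum>n. cinner (x \<rhd> \<xi> n) (\<eta> n)) -` U"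
      and sm: "summable (\<lambda>n. (norm (\<xi> n))\<^sup>2)" "summable (\<lambda>n. (norm (\<eta> n))\<^sup>2)" and U: "open U"
        by blast
    define f where "f = Abs_l2 \<xi>"
    define g where "g = Abs_l2 \<eta>"
    have fg: "l2_nth f = \<xi>" "l2_nth g = \<eta>" using sm by (auto simp: f_def g_def Abs_l2_inverse)
    have \<psi>: "(\<Sum>n. cinner (x \<rhd> \<xi> n) (\<eta> n)) = cinner (amplify x \<rhd> f) g" for x
      by (simp add: cinner_l2_def fg)
    have "cinner (amplify 0 \<rhd> f) g = 0"
      using cinner_add_left[of 0 0 g] amplify_diff[of "0::'h operator" 0] by simp
    hence "0 \<in> U" using Basis.prems by (simp only: s \<psi> vimage_eq)
    then obtain \<delta> where \<delta>: "\<delta> > 0" "ball 0 \<delta> \<subseteq> U" using U openE by blast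
    define r where "r = (norm g + 1) / \<delta>"
    have r: "r > 0" using \<delta> by (simp add: r_def add_nonneg_pos)
    show ?case
    proof (intro exI allI impI)
      fix x assume a: "norm (amplify x \<rhd> (r *\<^sub>R f)) < 1"
      hence "r * norm (amplify x \<rhd> f) < 1" using r by (simp add: blinfun.scaleR_right)
      hence b: "(norm g + 1) * norm (amplify x \<rhd> f) < \<delta>" using \<delta> by (simp add: r_def field_simps)
      have "cmod (cinner (amplify x \<rhd> f) g) \<le> norm (amplify x \<rhd> f) * norm g"
        by (rule norm_cinner_le)
      also have "\<dots> \<le> (norm g + 1) * norm (amplify x \<rhd> f)"
        by (simp add: algebra_simps)
      also note b
      finally have "cinner (amplify x \<rhd> f) g \<in> U" using \<delta> by (auto simp: subset_iff)
      thus "x \<in> s" by (simp add: s \<psi>)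
    qed
  qed
qed

section \<open>Closed spans and joint kernels\<close>

lemma subspace_closure_of_subspace:
  fixes V :: "'a::real_normed_vector set"
  assumes "subspace V" shows "subspace (closure V)"
proof (rule subspaceI)
  show "0 \<in> closure V" using closure_subset subspace_0[OF assms] by blast
  show "x + y \<in> closure V" if xy: "x \<in> closure V" "y \<in> closure V" for x y
  proof -
    obtain f where f: "\<And>n. f n \<in> V" "f \<longlonglongrightarrow> x" using xy(1) by (auto simp: closure_sequential)
    obtain g where g: "\<And>n. g n \<in> V" "g \<longlonglongrightarrow> y" using xy(2) by (auto simp: closure_sequential)
    have "\<forall>n. f n + g n \<in> V" using f g subspace_add[OF assms] by blast
    moreover have "(\<lambda>n. f n + g n) \<longlonglongrightarrow> x + y" by (intro tendsto_add f g)
    ultimately show ?thesis unfolding closure_sequential by (intro exI[of _ "\<lambda>n. f n + g n"]) simp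
  qed
  show "c *\<^sub>R x \<in> closure V" if x: "x \<in> closure V" for c x
  proof -
    obtain f where f: "\<And>n. f n \<in> V" "f \<longlonglongrightarrow> x" using x by (auto simp: closure_sequential)
    have "\<forall>n. c *\<^sub>R f n \<in> V" using f subspace_scale[OF assms] by blast
    moreover have "(\<lambda>n. c *\<^sub>R f n) \<longlonglongrightarrow> c *\<^sub>R x" by (intro tendsto_intros f)
    ultimately show ?thesis unfolding closure_sequential by (intro exI[of _ "\<lambda>n. c *\<^sub>R f n"]) simp
  qed
qed

lemma closure_invariant:
  assumes "bounded_linear f" "\<And>v. v \<in> V \<Longrightarrow> f v \<in> V" "v \<in> closure V"
  shows "f v \<in> closure V"
  using image_closure_subset[of V f "closure V"] assms closure_subset
    linear_continuous_on[OF assms(1), of "closure V"] by blast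

text \<open>
  The joint kernel of a subset of \<open>N\<close> is invariant under the commutant of \<open>N\<close>. The projection
  onto it translates between annihilation of vectors and algebraic annihilation inside \<open>N\<close>, and only
  the latter is preserved by automorphisms.
\<close>

lemma kernel_projection:
  fixes S :: "'h::complex_hilbert_space operator set"
  assumes N: "von_neumann_algebra N" and S: "S \<subseteq> N"
  shows "\<exists>q\<in>N. q\<^sup>\<dagger> = q \<and> q \<cdot> q = q \<and> (\<forall>w\<in>S. w \<cdot> q = 0) \<and>
    (\<forall>\<eta>. (\<forall>w\<in>S. w \<rhd> \<eta> = 0) \<longrightarrow> q \<rhd> \<eta> = \<eta>)"
proof -
  define K where "K = {\<eta>. \<forall>w\<in>S. w \<rhd> \<eta> = 0}"
  have Sb: "w \<in> bounded_ops" if "w \<in> S" for w using that S vna_bounded[OF N] by blast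
  have sub: "subspace K" by (auto simp: K_def subspace_def blinfun.bilinear_simps)
  have "K = (\<Inter>w\<in>S. {\<eta>. w \<rhd> \<eta> = 0})" by (auto simp: K_def)
  moreover have "closed {\<eta>. w \<rhd> \<eta> = 0}" for w
    by (intro closed_Collect_eq continuous_intros)
  ultimately have cl: "closed K" by auto
  have sc: "c *\<^sub>C v \<in> K" if "v \<in> K" for c v using that Sb by (auto simp: K_def bounded_opsD)
  have "orth_proj K \<in> commutant (commutant N)"
  proof (rule orth_proj_in_commutant[OF sub cl sc commutant_bounded])
    show "y\<^sup>\<dagger> \<in> commutant N" if "y \<in> commutant N" for y
      by (rule commutant_adj[OF vna_bounded[OF N] vna_adj[OF N] that])
    show "y \<rhd> v \<in> K" if y: "y \<in> commutant N" and v: "v \<in> K" for y v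
      unfolding K_def mem_Collect_eq
    proof
      fix w assume w: "w \<in> S"
      have "(w \<cdot> y) \<rhd> v = (y \<cdot> w) \<rhd> v"
        using commutantD[OF y] w S by fastforce
      thus "w \<rhd> y \<rhd> v = 0" using v w by (simp add: K_def)
    qed
  qed
  hence "orth_proj K \<in> N" by (simp add: vna_bicommutant[OF N])
  moreover have "(orth_proj K)\<^sup>\<dagger> = orth_proj K" by (rule orth_proj_adj[OF sub cl sc])
  moreover have "orth_proj K \<cdot> orth_proj K = orth_proj K"
    by (rule blinfun_eqI) (simp add: orth_proj_fixes[OF sub cl] orth_proj_mem[OF sub cl])
  moreover have "w \<cdot> orth_proj K = 0" if "w \<in> S" for w
    using orth_proj_mem[OF sub cl] that by (intro blinfun_eqI) (auto simp: K_def)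
  moreover have "orth_proj K \<rhd> \<eta> = \<eta>" if "\<forall>w\<in>S. w \<rhd> \<eta> = 0" for \<eta>
    by (rule orth_proj_fixes[OF sub cl]) (use that in \<open>simp add: K_def\<close>)
  ultimately show ?thesis by blast
qed

section \<open>Tracial von Neumann algebras\<close>

locale tracial_algebra =
  fixes N :: "'h::complex_hilbert_space operator set" and \<tau> :: "'h operator \<Rightarrow> complex"
  assumes tracial: "tracial_von_neumann_algebra N \<tau>"
begin

lemma vna: "von_neumann_algebra N"
  using tracial by (simp add: tracial_von_neumann_algebra_def)

lemma bounded [simp]: "x \<in> N \<Longrightarrow> x \<in> bounded_ops"
  using vna_bounded[OF vna] by blast

lemma closed_ops [simp]:
  "id_blinfun \<in> N" "0 \<in> N"
  "x \<in> N \<Longrightarrow> x\<^sup>\<dagger> \<in> N" "x \<in> N \<Longrightarrow> y \<in> N \<Longrightarrow> x + y \<in> N" "x \<in> N \<Longrightarrow> y \<in> N \<Longrightarrow> x - y \<in> N"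
  "x \<in> N \<Longrightarrow> - x \<in> N" "x \<in> N \<Longrightarrow> y \<in> N \<Longrightarrow> x \<cdot> y \<in> N" "x \<in> N \<Longrightarrow> op_scaleC c x \<in> N"
  "x \<in> N \<Longrightarrow> r *\<^sub>R x \<in> N"
  by (rule vna_id[OF vna] vna_zero[OF vna] vna_adj[OF vna] vna_add[OF vna] vna_diff[OF vna]
      vna_minus[OF vna] vna_compose[OF vna] vna_scaleC[OF vna] vna_scaleR[OF vna]; assumption)+

lemma adj_simps [simp]:
  "x \<in> N \<Longrightarrow> (x\<^sup>\<dagger>)\<^sup>\<dagger> = x" "x \<in> N \<Longrightarrow> y \<in> N \<Longrightarrow> (x \<cdot> y)\<^sup>\<dagger> = y\<^sup>\<dagger> \<cdot> x\<^sup>\<dagger>"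
  "x \<in> N \<Longrightarrow> y \<in> N \<Longrightarrow> (x + y)\<^sup>\<dagger> = x\<^sup>\<dagger> + y\<^sup>\<dagger>"
  "x \<in> N \<Longrightarrow> (op_scaleC c x)\<^sup>\<dagger> = op_scaleC (cnj c) (x\<^sup>\<dagger>)"
  by (simp_all add: op_adj_adj op_adj_compose op_adj_add op_adj_scaleC)

lemma adj_scaleR [simp]: "x \<in> N \<Longrightarrow> (r *\<^sub>R x)\<^sup>\<dagger> = r *\<^sub>R x\<^sup>\<dagger>"
  by (simp add: scaleR_eq_op_scaleC)
lemma adj_minus [simp]: "x \<in> N \<Longrightarrow> (- x)\<^sup>\<dagger> = - x\<^sup>\<dagger>"
  using adj_scaleR[of x "-1"] by simp
lemma adj_diff [simp]: "x \<in> N \<Longrightarrow> y \<in> N \<Longrightarrow> (x - y)\<^sup>\<dagger> = x\<^sup>\<dagger> - y\<^sup>\<dagger>"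
  using adj_simps(3)[of x "- y"] by simp

lemma
  assumes "x \<in> N" "y \<in> N"
  shows tau_add: "\<tau> (x + y) = \<tau> x + \<tau> y"
    and tau_commute: "\<tau> (x \<cdot> y) = \<tau> (y \<cdot> x)"
  using tracial assms by (auto simp: tracial_von_neumann_algebra_def state_on_def tracial_on_def)

lemma tau_scaleC: "x \<in> N \<Longrightarrow> \<tau> (op_scaleC c x) = c * \<tau> x"
  using tracial by (auto simp: tracial_von_neumann_algebra_def state_on_def)
lemma tau_scaleR: "x \<in> N \<Longrightarrow> \<tau> (r *\<^sub>R x) = of_real r * \<tau> x"
  by (simp add: scaleR_eq_op_scaleC tau_scaleC)
lemma tau_minus: "x \<in> N \<Longrightarrow> \<tau> (- x) = - \<tau> x"
  using tau_scaleR[of x "-1"] by simp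
lemma tau_diff: "x \<in> N \<Longrightarrow> y \<in> N \<Longrightarrow> \<tau> (x - y) = \<tau> x - \<tau> y"
  using tau_add[of x "- y"] by (simp add: tau_minus)
lemma tau_zero: "\<tau> 0 = 0"
  using tau_scaleR[of 0 0] by simp
lemma tau_id: "\<tau> id_blinfun = 1"
  using tracial by (simp add: tracial_von_neumann_algebra_def state_on_def)
lemma tau_positive: "x \<in> N \<Longrightarrow> Im (\<tau> (x\<^sup>\<dagger> \<cdot> x)) = 0" "x \<in> N \<Longrightarrow> 0 \<le> Re (\<tau> (x\<^sup>\<dagger> \<cdot> x))"
  using tracial by (auto simp: tracial_von_neumann_algebra_def state_on_def complex_is_Real_iff)
lemma tau_faithful: "x \<in> N \<Longrightarrow> \<tau> (x\<^sup>\<dagger> \<cdot> x) = 0 \<Longrightarrow> x = 0"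
  using tracial by (auto simp: tracial_von_neumann_algebra_def faithful_on_def)

subsection \<open>Normality of the trace\<close>

lemma tau_preimage_ultraweak:
  assumes "open U"
  shows "\<exists>W. openin ultraweak_topology W \<and> {x \<in> N. \<tau> x \<in> U} = W \<inter> N"
proof -
  have top: "topspace (ultraweak_topology :: 'h operator topology) = UNIV"
  proof -
    have "(\<lambda>x::'h operator. \<Sum>n::nat. cinner (x \<rhd> 0) (0::'h)) -` UNIV \<subseteq> topspace ultraweak_topology"
      unfolding ultraweak_topology_def topology_generated_by_topspace
      by (rule Union_upper, rule CollectI, rule exI[of _ "\<lambda>_. 0"], rule exI[of _ "\<lambda>_. 0"], rule exI[of _ UNIV]) simp
    thus ?thesis by auto
  qed
  have "continuous_map (subtopology ultraweak_topology N) euclidean \<tau>"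
    using tracial by (simp add: tracial_von_neumann_algebra_def normal_on_def)
  hence "openin (subtopology ultraweak_topology N) {x \<in> topspace (subtopology ultraweak_topology N). \<tau> x \<in> U}"
    using assms by (intro openin_continuous_map_preimage[of _ euclidean]) auto
  hence "openin (subtopology ultraweak_topology N) {x \<in> N. \<tau> x \<in> U}" by (simp add: top)
  thus ?thesis by (simp add: openin_subtopology)
qed

text \<open>
  Continuity of \<open>\<tau>\<close> at \<open>0\<close> gives \<open>|\<tau>(x)| < 1\<close> whenever \<open>\<parallel>x \<zeta>\<parallel> < 1\<close>; homogeneity does the rest.
\<close>

lemma tau_dominated: "\<exists>\<zeta>. \<forall>x\<in>N. cmod (\<tau> x) \<le> norm (amplify x \<rhd> \<zeta>)"
proof -
  obtain W where W: "openin ultraweak_topology W" "{x \<in> N. \<tau> x \<in> ball 0 1} = W \<inter> N"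
    using tau_preimage_ultraweak[of "ball 0 1"] by auto
  have "0 \<in> {x \<in> N. \<tau> x \<in> ball 0 1}" by (simp add: tau_zero)
  hence "0 \<in> W" using W by blast
  then obtain \<zeta> where \<zeta>: "\<And>x. norm (amplify x \<rhd> \<zeta>) < 1 \<Longrightarrow> x \<in> W"
    using ultraweak_neighbourhood_of_zero W by blast
  have small: "cmod (\<tau> x) < 1" if "x \<in> N" "norm (amplify x \<rhd> \<zeta>) < 1" for x
  proof -
    have "x \<in> {x \<in> N. \<tau> x \<in> ball 0 1}" using \<zeta> that W by blast
    thus ?thesis by simp
  qed
  have "cmod (\<tau> x) \<le> norm (amplify x \<rhd> \<zeta>)" if x: "x \<in> N" for x
  proof (rule dense_ge)
    fix r assume r: "norm (amplify x \<rhd> \<zeta>) < r"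
    hence r0: "r > 0" by (rule le_less_trans[OF norm_ge_zero])
    have "norm (amplify (inverse r *\<^sub>R x) \<rhd> \<zeta>) < 1"
      using r r0 by (simp add: amplify_scaleR blinfun.scaleR_left field_simps)
    hence "cmod (\<tau> (inverse r *\<^sub>R x)) < 1" using x by (intro small) auto
    thus "cmod (\<tau> x) \<le> r" using x r0
      by (simp add: tau_scaleR norm_mult norm_divide norm_inverse divide_simps)
  qed
  thus ?thesis by blast
qed

lemma tau_norm_bounded: "\<exists>C\<ge>0. \<forall>x\<in>N. cmod (\<tau> x) \<le> C * norm x"
proof -
  obtain \<zeta> where "\<And>x. x \<in> N \<Longrightarrow> cmod (\<tau> x) \<le> norm (amplify x \<rhd> \<zeta>)"
    using tau_dominated by blast
  hence "\<forall>x\<in>N. cmod (\<tau> x) \<le> norm \<zeta> * norm x"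
    using norm_amplify_le[of _ \<zeta>] by (fastforce simp: mult.commute intro: order_trans)
  thus ?thesis using norm_ge_zero by blast
qed

text \<open>
  On bounded sets the ultraweak topology is the weak operator topology: Tannery's theorem exchanges
  the limit with the series defining an ultraweak functional. The filter is arbitrary because weak
  limits of sequences exist only along a refinement of the sequence.
\<close>

lemma tau_tendsto:
  assumes x: "\<And>n. x n \<in> N" "y \<in> N" and R: "\<And>n. norm (x n) \<le> R" and G: "G \<noteq> bot"
    and lim: "\<And>\<xi> \<eta>. ((\<lambda>n. inner (x n \<rhd> \<xi>) \<eta>) \<longlongrightarrow> inner (y \<rhd> \<xi>) \<eta>) G"
  shows "((\<lambda>n. \<tau> (x n)) \<longlongrightarrow> \<tau> y) G"
proof -
  have ev: "eventually (\<lambda>n. x n \<in> W) G" if "openin ultraweak_topology W" "y \<in> W" for W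
  proof -
    have "generate_topology_on {(\<lambda>x. \<Sum>n. cinner (x \<rhd> \<xi> n) (\<eta> n)) -` U | (\<xi> :: nat \<Rightarrow> 'h) (\<eta> :: nat \<Rightarrow> 'h) U.
        summable (\<lambda>n. (norm (\<xi> n))\<^sup>2) \<and> summable (\<lambda>n. (norm (\<eta> n))\<^sup>2) \<and> open U} W"
      using that(1) unfolding ultraweak_topology_def by (simp add: openin_topology_generated_by_iff)
    thus ?thesis using that(2)
    proof induction
      case (Int a b)
      thus ?case by (auto simp: eventually_conj_iff)
    next
      case (UN K)
      then obtain k where k: "k \<in> K" "y \<in> k" by blast
      show ?case using UN.IH[OF k] by eventually_elim (use k in blast)
    next
      case (Basis s)
      then obtain \<xi> \<eta> U where s: "s = (\<lambda>x. \<Sum>n. cinner (x \<rhd> \<xi> n) (\<eta> n)) -` U"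
        and sm: "summable (\<lambda>n. (norm (\<xi> n))\<^sup>2)" "summable (\<lambda>n. (norm (\<eta> n))\<^sup>2)" and U: "open U"
          by blast
      have "((\<lambda>n. \<Sum>k. cinner (x n \<rhd> \<xi> k) (\<eta> k)) \<longlongrightarrow> (\<Sum>k. cinner (y \<rhd> \<xi> k) (\<eta> k))) G"
      proof (rule tannerys_theorem[THEN conjunct2, THEN conjunct2, OF _ _ _ G])
        show "((\<lambda>n. cinner (x n \<rhd> \<xi> k) (\<eta> k)) \<longlongrightarrow> cinner (y \<rhd> \<xi> k) (\<eta> k)) G" for k
          unfolding cinner_eq_inner by (intro tendsto_Complex lim)
        show "eventually (\<lambda>(k, n). norm (cinner (x n \<rhd> \<xi> k) (\<eta> k)) \<le> R * ((norm (\<xi> k))\<^sup>2 + (norm (\<eta> k))\<^sup>2)) (at_top \<times>\<^sub>F G)"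
        proof (rule always_eventually, safe)
          fix k n
          have "norm (cinner (x n \<rhd> \<xi> k) (\<eta> k)) \<le> norm (x n \<rhd> \<xi> k) * norm (\<eta> k)"
            by (rule norm_cinner_le)
          also have "\<dots> \<le> (R * norm (\<xi> k)) * norm (\<eta> k)"
            using norm_blinfun[of "x n" "\<xi> k"] mult_right_mono[OF R[of n] norm_ge_zero[of "\<xi> k"]]
            by (intro mult_right_mono) auto
          also have "\<dots> = R * (norm (\<xi> k) * norm (\<eta> k))" by simp
          also have "\<dots> \<le> R * ((norm (\<xi> k))\<^sup>2 + (norm (\<eta> k))\<^sup>2)"
            using R[of n] norm_ge_zero[of "x n"]
              by (intro mult_left_mono product_le_squares) linarith
          finally show "norm (cinner (x n \<rhd> \<xi> k) (\<eta> k)) \<le> R * ((norm (\<xi> k))\<^sup>2 + (norm (\<eta> k))\<^sup>2)" .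
        qed
        show "summable (\<lambda>k. R * ((norm (\<xi> k))\<^sup>2 + (norm (\<eta> k))\<^sup>2))"
          by (intro summable_mult summable_add sm)
      qed
      from topological_tendstoD[OF this U] show ?case using Basis.prems by (simp add: s)
    qed simp
  qed
  show ?thesis
  proof (rule topological_tendstoI)
    fix U assume U: "open U" "\<tau> y \<in> U"
    obtain W where W: "openin ultraweak_topology W" "{x \<in> N. \<tau> x \<in> U} = W \<inter> N"
      using tau_preimage_ultraweak[OF U(1)] by blast
    have "y \<in> W" using W x U by blast
    from ev[OF W(1) this] show "eventually (\<lambda>n. \<tau> (x n) \<in> U) G"
      by eventually_elim (use W x in blast)
  qed
qed

subsection \<open>A trace form of the bicommutant theorem\<close>

text \<open>
  The projection \<open>e\<close> onto the closure \<open>V\<close> of \<open>J \<zeta>\<close> commutes with the amplification of \<open>J\<close>, so its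
  matrix entries lie in the commutant of \<open>J\<close> and \<open>e\<close> commutes with the amplification of \<open>x\<close>.
  Nondegeneracy places \<open>\<zeta>\<close> itself in \<open>V\<close>. Hence \<open>x \<zeta>\<close> lies in \<open>V\<close>, that is, it is a limit of vectors
  \<open>a \<zeta>\<close> with \<open>a \<in> J\<close>, and \<open>|\<tau>(g (x - a))| \<le> \<parallel>g\<parallel> \<parallel>(x - a) \<zeta>\<parallel>\<close>.
\<close>

lemma tau_vanishes_on_bicommutant:
  assumes J: "J \<subseteq> N" "0 \<in> J" "\<And>a b. a \<in> J \<Longrightarrow> b \<in> J \<Longrightarrow> a + b \<in> J" "\<And>c a. a \<in> J \<Longrightarrow> op_scaleC c a \<in> J"
      "\<And>a b. a \<in> J \<Longrightarrow> b \<in> J \<Longrightarrow> a \<cdot> b \<in> J" "\<And>a. a \<in> J \<Longrightarrow> a\<^sup>\<dagger> \<in> J"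
    and nondeg: "\<And>y. y \<in> N \<Longrightarrow> (\<And>a. a \<in> J \<Longrightarrow> a \<cdot> y = 0) \<Longrightarrow> y = 0"
    and g: "g \<in> N" "\<And>a. a \<in> J \<Longrightarrow> \<tau> (g \<cdot> a) = 0"
    and x: "x \<in> commutant (commutant J)"
  shows "\<tau> (g \<cdot> x) = 0"
proof -
  obtain \<zeta> where \<zeta>: "\<And>x. x \<in> N \<Longrightarrow> cmod (\<tau> x) \<le> norm (amplify x \<rhd> \<zeta>)"
    using tau_dominated by blast
  have Jb: "J \<subseteq> bounded_ops" using J(1) by auto
  define V0 where "V0 = (\<lambda>a. amplify a \<rhd> \<zeta>) ` J"
  define V where "V = closure V0"
  have sub0: "subspace V0"
  proof (rule subspaceI)
    show "0 \<in> V0" unfolding V0_def using J(2) amplify_diff[of "0::'h operator" 0]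
      by (intro image_eqI[of _ _ 0]) auto
    show "u + v \<in> V0" if "u \<in> V0" "v \<in> V0" for u v
      using that J(3) unfolding V0_def
        by (auto simp: image_iff amplify_add[symmetric] blinfun.add_left[symmetric])
    show "r *\<^sub>R u \<in> V0" if u: "u \<in> V0" for r u
    proof -
      obtain a where a: "a \<in> J" "u = amplify a \<rhd> \<zeta>" using u by (auto simp: V0_def)
      have "r *\<^sub>R u = amplify (op_scaleC (complex_of_real r) a) \<rhd> \<zeta>"
        by (simp add: a(2) amplify_scaleC scaleR_eq_scaleC)
      thus ?thesis unfolding V0_def using J(4)[OF a(1)] by (rule image_eqI)
    qed
  qed
  have V: "subspace V" "closed V" unfolding V_def by (auto intro: subspace_closure_of_subspace sub0)
  have VC: "c *\<^sub>C v \<in> V" if "v \<in> V" for c v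
    unfolding V_def
  proof (rule closure_invariant[OF bounded_linear_scaleC])
    show "c *\<^sub>C u \<in> V0" if "u \<in> V0" for u
      using that J(4) unfolding V0_def
        by (auto simp: image_iff amplify_scaleC[symmetric] op_scaleC_apply[symmetric] simp del: op_scaleC_apply)
  qed (use that V_def in simp)
  have Vinv: "amplify a \<rhd> v \<in> V" if a: "a \<in> J" and v: "v \<in> V" for a v
    unfolding V_def
  proof (rule closure_invariant[OF blinfun.bounded_linear_right])
    show "amplify a \<rhd> u \<in> V0" if "u \<in> V0" for u
      using that a J(5) unfolding V0_def
      by (auto simp: image_iff amplify_compose[symmetric] blinfun_apply_blinfun_compose[symmetric] simp del: blinfun_apply_blinfun_compose)
  qed (use v V_def in simp)
  define e where "e = orth_proj V"
  have eC: "e \<in> commutant (amplify ` J)"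
    unfolding e_def
    by (rule orth_proj_in_commutant[OF V VC])
      (use Jb Vinv J(6) in \<open>auto simp: amplify_bounded_ops amplify_adj subset_iff\<close>)
  have ec: "e \<cdot> amplify a = amplify a \<cdot> e" if "a \<in> J" for a
    using commutantD[OF eC] that by blast
  obtain q where q: "q \<in> N" "\<And>w. w \<in> J \<Longrightarrow> w \<cdot> q = 0" "\<And>\<eta>. (\<And>w. w \<in> J \<Longrightarrow> w \<rhd> \<eta> = 0) \<Longrightarrow> q \<rhd> \<eta> = \<eta>"
    using kernel_projection[OF vna J(1)] by blast
  have "q = 0" by (rule nondeg) (use q in auto)
  hence ker: "\<eta> = 0" if "\<And>w. w \<in> J \<Longrightarrow> w \<rhd> \<eta> = 0" for \<eta>
    using q(3)[OF that] by simp
  \<comment> \<open>every element of \<open>J\<close> annihilates the coordinates of \<open>\<zeta> - e \<zeta>\<close>\<close>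
  have "\<zeta> - e \<rhd> \<zeta> = 0"
  proof (rule l2_eqI)
    fix n
    have "w \<rhd> l2_nth (\<zeta> - e \<rhd> \<zeta>) n = 0" if w: "w \<in> J" for w
    proof -
      have "amplify w \<rhd> \<zeta> \<in> V"
        unfolding V_def by (rule subsetD[OF closure_subset]) (use w in \<open>simp add: V0_def\<close>)
      hence "e \<rhd> amplify w \<rhd> \<zeta> = amplify w \<rhd> \<zeta>"
        unfolding e_def by (rule orth_proj_fixes[OF V])
      hence "(e \<cdot> amplify w) \<rhd> \<zeta> = amplify w \<rhd> \<zeta>" by simp
      hence "amplify w \<rhd> e \<rhd> \<zeta> = amplify w \<rhd> \<zeta>"
        by (simp add: ec[OF w])
      hence "l2_nth (amplify w \<rhd> (\<zeta> - e \<rhd> \<zeta>)) n = 0" by (simp add: blinfun.diff_right)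
      thus ?thesis by simp
    qed
    thus "l2_nth (\<zeta> - e \<rhd> \<zeta>) n = l2_nth 0 n" unfolding l2_nth_simps(1) by (rule ker)
  qed
  hence e\<zeta>: "e \<rhd> \<zeta> = \<zeta>" by simp
  have xN: "x \<in> N"
    using x commutant_antimono[OF commutant_antimono[OF J(1)]] vna_bicommutant[OF vna] by blast
  have xadj: "x\<^sup>\<dagger> \<in> commutant (commutant J)"
    by (rule commutant_adj[OF commutant_bounded _ x]) (rule commutant_adj[OF Jb J(6)])
  \<comment> \<open>the entries of a projection commuting with the amplified \<open>J\<close> commute with \<open>J\<close>\<close>
  have ent: "l2_entry e m n \<in> commutant J" for m n
    unfolding commutant_def using ec l2_entry_commutes l2_entry_bounded_ops eC commutant_bounded
      by blast
  have "e \<cdot> amplify x = amplify x \<cdot> e"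
  proof (rule amplify_commutes_of_entries)
    show "inner (e \<rhd> f) g = inner f (e \<rhd> g)" for f g
      unfolding e_def by (rule orth_proj_selfadjoint[OF V])
    show "l2_entry e m n \<cdot> x\<^sup>\<dagger> = x\<^sup>\<dagger> \<cdot> l2_entry e m n" for m n
      using commutantD[OF xadj ent] by simp
  qed (use xN in simp)
  hence "(e \<cdot> amplify x) \<rhd> \<zeta> = (amplify x \<cdot> e) \<rhd> \<zeta>" by simp
  hence "e \<rhd> amplify x \<rhd> \<zeta> = amplify x \<rhd> \<zeta>" by (simp add: e\<zeta>)
  hence xV: "amplify x \<rhd> \<zeta> \<in> V" unfolding e_def by (metis orth_proj_mem[OF V])
  have bd: "cmod (\<tau> (g \<cdot> x)) \<le> norm g * \<epsilon>" if \<epsilon>: "\<epsilon> > 0" for \<epsilon>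
  proof -
    obtain a where a: "a \<in> J" "dist (amplify a \<rhd> \<zeta>) (amplify x \<rhd> \<zeta>) < \<epsilon>"
      using xV \<epsilon> unfolding V_def V0_def closure_approachable by auto
    have aN: "a \<in> N" using a J by blast
    have "\<tau> (g \<cdot> x) = \<tau> (g \<cdot> (x - a))" using g a xN aN by (simp add: compose_linear tau_diff)
    also have "cmod \<dots> \<le> norm (amplify (g \<cdot> (x - a)) \<rhd> \<zeta>)" using g xN aN by (intro \<zeta>) auto
    also have "\<dots> \<le> norm g * norm (amplify (x - a) \<rhd> \<zeta>)"
      by (simp add: amplify_compose norm_amplify_le)
    also have "\<dots> \<le> norm g * \<epsilon>"
      using a(2)
        by (intro mult_left_mono) (auto simp: amplify_diff blinfun.diff_left dist_norm norm_minus_commute)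
    finally show ?thesis .
  qed
  have "cmod (\<tau> (g \<cdot> x)) \<le> 0"
  proof (rule field_le_epsilon)
    fix d :: real assume d: "d > 0"
    have "cmod (\<tau> (g \<cdot> x)) \<le> norm g * (d / (norm g + 1))" using d
      by (intro bd) (simp add: add_nonneg_pos)
    also have "\<dots> \<le> d" using d by (simp add: divide_simps add_nonneg_pos)
    finally show "cmod (\<tau> (g \<cdot> x)) \<le> 0 + d" by simp
  qed
  thus ?thesis by simp
qed

lemma span_closed:
  assumes S: "S \<subseteq> N" "\<And>c a. a \<in> S \<Longrightarrow> op_scaleC c a \<in> S"
    "\<And>a b. a \<in> S \<Longrightarrow> b \<in> S \<Longrightarrow> a \<cdot> b \<in> S" "\<And>a. a \<in> S \<Longrightarrow> a\<^sup>\<dagger> \<in> S"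
  shows "span S \<subseteq> N" "a \<in> span S \<Longrightarrow> op_scaleC c a \<in> span S" "a \<in> span S \<Longrightarrow> b \<in> span S \<Longrightarrow> a \<cdot> b \<in> span S"
    "a \<in> span S \<Longrightarrow> a\<^sup>\<dagger> \<in> span S"
proof -
  have "subspace N" by (rule subspaceI) auto
  thus SN: "span S \<subseteq> N" by (rule span_minimal[OF S(1)])
  show "op_scaleC c a \<in> span S" if "a \<in> span S"
    using that
  proof (induction rule: span_induct)
    case base show ?case
    proof (clarsimp simp: subspace_def, intro conjI allI impI)
      have "op_scaleC c (0::'h operator) = 0" by (rule blinfun_eqI) simp
      thus "op_scaleC c (0::'h operator) \<in> span S" by (simp add: span_zero)
      show "op_scaleC c (x + y) \<in> span S"
        if "op_scaleC c x \<in> span S" "op_scaleC c y \<in> span S" for x y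
      proof -
        have "op_scaleC c (x + y) = op_scaleC c x + op_scaleC c y"
          by (rule blinfun_eqI) (simp add: blinfun.add_left scaleC_add_right)
        thus ?thesis using that by (simp add: span_add)
      qed
      show "op_scaleC c (r *\<^sub>R x) \<in> span S" if "op_scaleC c x \<in> span S" for r x
      proof -
        have "op_scaleC c (r *\<^sub>R x) = r *\<^sub>R op_scaleC c x"
          by (simp add: scaleR_eq_op_scaleC op_scaleC_scaleC mult.commute)
        thus ?thesis using that by (simp add: span_scale)
      qed
    qed
  next
    case (step a) thus ?case using S(2) span_base by blast
  qed
  show "a \<cdot> b \<in> span S" if a: "a \<in> span S" and b: "b \<in> span S"
    using a
  proof (induction rule: span_induct)
    case base show ?case
      by (auto simp: subspace_def compose_linear span_zero span_add span_scale)
  next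
    case (step s)
    show ?case using b
    proof (induction rule: span_induct)
      case base show ?case
        by (auto simp: subspace_def compose_linear span_zero span_add span_scale)
    next
      case (step t) thus ?case using S(3) \<open>s \<in> S\<close> span_base by blast
    qed
  qed
  show "a\<^sup>\<dagger> \<in> span S" if a: "a \<in> span S"
  proof -
    have "a \<in> N \<and> a\<^sup>\<dagger> \<in> span S" using a
    proof (induction rule: span_induct)
      case base
      have "(0::'h operator)\<^sup>\<dagger> = 0" using adj_diff[of 0 0] by simp
      thus ?case by (auto simp: subspace_def span_zero span_add span_scale)
    next
      case (step s) thus ?case using S span_base by blast
    qed
    thus ?thesis by blast
  qed
qed

text \<open>
  The identity operator lies in every bicommutant, so a nondegenerate set acts, under the trace,
  like an approximate identity.
\<close>

lemma tau_vanishes_of_nondegenerate: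
  assumes S: "S \<subseteq> N" "\<And>c a. a \<in> S \<Longrightarrow> op_scaleC c a \<in> S"
      "\<And>a b. a \<in> S \<Longrightarrow> b \<in> S \<Longrightarrow> a \<cdot> b \<in> S" "\<And>a. a \<in> S \<Longrightarrow> a\<^sup>\<dagger> \<in> S"
    and nondeg: "\<And>y. y \<in> N \<Longrightarrow> (\<And>a. a \<in> S \<Longrightarrow> a \<cdot> y = 0) \<Longrightarrow> y = 0"
    and g: "g \<in> N" "\<And>a. a \<in> S \<Longrightarrow> \<tau> (g \<cdot> a) = 0"
  shows "\<tau> g = 0"
proof -
  note sp = span_closed[OF S]
  have "\<tau> (g \<cdot> id_blinfun) = 0"
  proof (rule tau_vanishes_on_bicommutant[of "span S"])
    show "\<tau> (g \<cdot> a) = 0" if "a \<in> span S" for a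
    proof -
      have "a \<in> N \<and> \<tau> (g \<cdot> a) = 0" using that
      proof (induction rule: span_induct)
        case base show ?case
          by (auto simp: subspace_def compose_linear tau_zero tau_add tau_scaleR g)
      next
        case (step a) thus ?case using g S by blast
      qed
      thus ?thesis by blast
    qed
    show "y = 0" if "y \<in> N" "\<And>a. a \<in> span S \<Longrightarrow> a \<cdot> y = 0" for y
      using nondeg that span_base by blast
  qed (use sp g in \<open>auto simp: span_zero span_add commutant_id intro: span_base\<close>)
  thus ?thesis by simp
qed

end

section \<open>The trace norm\<close>

text \<open>
  If \<open>g 0\<close> exceeded \<open>p A\<close>, iterating the quadratic inequality would make \<open>g\<close> grow like
  \<open>r ^ (2 ^ n)\<close> with \<open>r > A\<close>.
\<close>

lemma power_doubling_bound:
  fixes g :: "nat \<Rightarrow> real"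
  assumes sq: "\<And>n. (g n)\<^sup>2 \<le> p * g (Suc n)" and bd: "\<And>n. g n \<le> D * A ^ (2 ^ n)"
    and p: "0 \<le> p" and A: "0 \<le> A"
  shows "g 0 \<le> p * A"
proof (cases "p = 0")
  case True thus ?thesis using sq[of 0] by simp
next
  case False
  hence p0: "p > 0" using p by simp
  define r where "r = g 0 / p"
  show ?thesis
  proof (rule ccontr)
    assume "\<not> g 0 \<le> p * A"
    hence rA: "A < r" using p0 by (simp add: r_def field_simps)
    hence r0: "0 < r" using A by simp
    have low: "p * r ^ (2 ^ n) \<le> g n" for n
    proof (induction n)
      case 0 show ?case using p0 by (simp add: r_def)
    next
      case (Suc n)
      have "(p * r ^ (2 ^ n))\<^sup>2 \<le> (g n)\<^sup>2" using Suc p0 r0 by (intro power_mono) auto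
      also have "\<dots> \<le> p * g (Suc n)" by (rule sq)
      finally have "p * (p * r ^ (2 ^ Suc n)) \<le> p * g (Suc n)"
        by (simp add: power2_eq_square power_add[symmetric] mult_ac mult_2 flip: power_mult_distrib)
      thus ?case using p0 by simp
    qed
    show False
    proof (cases "A = 0")
      case True
      thus False using low[of 0] bd[of 0] p0 r0 mult_pos_pos[OF p0 r0] by simp
    next
      case False
      hence A0: "A > 0" using A by simp
      define s where "s = r / A"
      have s: "s > 1" using rA A0 by (simp add: s_def)
      obtain n where n: "D / p < s ^ n" using real_arch_pow[OF s] by blast
      have "s ^ n \<le> s ^ (2 ^ n)" using s less_exp[of n] by (intro power_increasing) auto
      hence "D / p < r ^ (2 ^ n) / A ^ (2 ^ n)" using n by (simp add: s_def power_divide)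
      hence "D * A ^ (2 ^ n) < p * r ^ (2 ^ n)" using p0 A0 by (simp add: field_simps)
      thus False using low[of n] bd[of n] by linarith
    qed
  qed
qed

context tracial_algebra
begin

text \<open>
  The real part of the inner product of \<open>L\<^sup>2(N, \<tau>)\<close>.
\<close>

definition tinner :: "'h operator \<Rightarrow> 'h operator \<Rightarrow> real" where
  "tinner x y = Re (\<tau> (y\<^sup>\<dagger> \<cdot> x))"

text \<open>
  Positivity of \<open>\<tau>((1 + c x)\<^sup>\<dagger> (1 + c x))\<close> makes \<open>c \<tau>(x) + cnj c \<tau>(x\<^sup>\<dagger>)\<close> real for every \<open>c\<close>; the values
  \<open>1\<close> and \<open>\<i>\<close> of \<open>c\<close> suffice.
\<close>

lemma tau_adj: assumes x: "x \<in> N" shows "\<tau> (x\<^sup>\<dagger>) = cnj (\<tau> x)"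
proof -
  have *: "Im (\<tau> ((id_blinfun + op_scaleC c x)\<^sup>\<dagger> \<cdot> (id_blinfun + op_scaleC c x))) = 0" for c
    using x by (intro tau_positive) auto
  have **: "(id_blinfun + op_scaleC c x)\<^sup>\<dagger> \<cdot> (id_blinfun + op_scaleC c x)
     = id_blinfun + op_scaleC c x + op_scaleC (cnj c) (x\<^sup>\<dagger>) + op_scaleC (cnj c * c) (x\<^sup>\<dagger> \<cdot> x)" for c
    using x
      by (simp add: compose_linear op_adj_id op_scaleC_compose_left op_scaleC_compose_right op_scaleC_scaleC)
  have "Im (c * \<tau> x + cnj c * \<tau> (x\<^sup>\<dagger>)) = 0" for c
  proof -
    have "\<tau> ((id_blinfun + op_scaleC c x)\<^sup>\<dagger> \<cdot> (id_blinfun + op_scaleC c x))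
      = 1 + c * \<tau> x + cnj c * \<tau> (x\<^sup>\<dagger>) + (cnj c * c) * \<tau> (x\<^sup>\<dagger> \<cdot> x)"
      unfolding ** using x by (simp add: tau_add tau_scaleC tau_id)
    moreover have "cnj c * c = complex_of_real ((cmod c)\<^sup>2)"
      by (simp only: complex_norm_square mult.commute)
    ultimately show ?thesis using *[of c] tau_positive(1)[OF x] by simp
  qed
  from this[of 1] this[of \<i>] show ?thesis by (simp add: complex_eq_iff)
qed

lemma tinner_sym: "x \<in> N \<Longrightarrow> y \<in> N \<Longrightarrow> tinner x y = tinner y x"
  using tau_adj[of "y\<^sup>\<dagger> \<cdot> x"] by (simp add: tinner_def)
lemma tinner_add_left: "x \<in> N \<Longrightarrow> y \<in> N \<Longrightarrow> z \<in> N \<Longrightarrow> tinner (x + y) z = tinner x z + tinner y z"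
  by (simp add: tinner_def compose_linear tau_add)
lemma tinner_add_right: "x \<in> N \<Longrightarrow> y \<in> N \<Longrightarrow> z \<in> N \<Longrightarrow> tinner x (y + z) = tinner x y + tinner x z"
  by (simp add: tinner_def compose_linear tau_add)
lemma tinner_diff_left: "x \<in> N \<Longrightarrow> y \<in> N \<Longrightarrow> z \<in> N \<Longrightarrow> tinner (x - y) z = tinner x z - tinner y z"
  by (simp add: tinner_def compose_linear tau_diff)
lemma tinner_diff_right: "x \<in> N \<Longrightarrow> y \<in> N \<Longrightarrow> z \<in> N \<Longrightarrow> tinner x (y - z) = tinner x y - tinner x z"
  by (simp add: tinner_def compose_linear tau_diff)
lemma tinner_scale_left: "x \<in> N \<Longrightarrow> y \<in> N \<Longrightarrow> tinner (r *\<^sub>R x) y = r * tinner x y"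
  by (simp add: tinner_def compose_linear tau_scaleR)
lemma tinner_scale_right: "x \<in> N \<Longrightarrow> y \<in> N \<Longrightarrow> tinner x (r *\<^sub>R y) = r * tinner x y"
  by (simp add: tinner_def compose_linear tau_scaleR)

lemmas tinner_simps = tinner_add_left tinner_add_right tinner_diff_left tinner_diff_right
  tinner_scale_left tinner_scale_right

lemma norm2_square: "x \<in> N \<Longrightarrow> (norm2 \<tau> x)\<^sup>2 = tinner x x"
  by (simp add: norm2_def tinner_def tau_positive)
lemma norm2_nonneg: "x \<in> N \<Longrightarrow> 0 \<le> norm2 \<tau> x"
  by (simp add: norm2_def tau_positive)

lemma norm2_eq_zero: "x \<in> N \<Longrightarrow> norm2 \<tau> x = 0 \<Longrightarrow> x = 0"
  using tau_positive[of x] by (intro tau_faithful) (simp_all add: norm2_def complex_eq_iff)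

lemma norm2_zero: "norm2 \<tau> 0 = 0"
  by (simp add: norm2_def tau_zero)

lemma tinner_cauchy_schwarz:
  assumes "x \<in> N" "y \<in> N" shows "tinner x y \<le> norm2 \<tau> x * norm2 \<tau> y"
proof -
  have q: "0 \<le> tinner x x + t\<^sup>2 * tinner y y - 2 * t * tinner x y" for t
  proof -
    have "0 \<le> (norm2 \<tau> (x - t *\<^sub>R y))\<^sup>2" by simp
    also have "\<dots> = tinner x x + t\<^sup>2 * tinner y y - 2 * t * tinner x y"
      using assms tinner_sym[of x y] norm2_square[of "x - t *\<^sub>R y"]
      by (simp add: tinner_simps algebra_simps power2_eq_square)
    finally show ?thesis .
  qed
  have "(tinner x y)\<^sup>2 \<le> tinner x x * tinner y y"
  proof (cases "tinner y y = 0")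
    case True
    hence "norm2 \<tau> y = 0" using norm2_square[OF assms(2)] by simp
    hence "y = 0" using norm2_eq_zero assms by blast
    thus ?thesis by (simp add: tinner_def tau_zero adj_diff[of 0 0, simplified])
  next
    case False
    hence y0: "tinner y y > 0" using norm2_square[OF assms(2)]
      by (metis zero_le_power2 less_eq_real_def)
    have "0 \<le> tinner y y * (tinner x x + (tinner x y / tinner y y)\<^sup>2 * tinner y y - 2 * (tinner x y / tinner y y) * tinner x y)"
      using q[of "tinner x y / tinner y y"] y0
        by (intro mult_nonneg_nonneg) (simp_all only: less_imp_le)
    also have "\<dots> = tinner x x * tinner y y - (tinner x y)\<^sup>2" using y0
      by (simp add: field_simps power2_eq_square)
    finally show ?thesis by simp
  qed
  also have "\<dots> = (norm2 \<tau> x * norm2 \<tau> y)\<^sup>2" using assms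
    by (simp add: norm2_square power_mult_distrib)
  finally show ?thesis
    using assms by (intro power2_le_imp_le[of "tinner x y"]) (auto simp: norm2_nonneg)
qed

lemma norm2_triangle: assumes "x \<in> N" "y \<in> N" shows "norm2 \<tau> (x + y) \<le> norm2 \<tau> x + norm2 \<tau> y"
proof (rule power2_le_imp_le)
  have "(norm2 \<tau> (x + y))\<^sup>2 = (norm2 \<tau> x)\<^sup>2 + (norm2 \<tau> y)\<^sup>2 + 2 * tinner x y"
    using assms tinner_sym[of x y] by (simp add: norm2_square tinner_simps)
  also have "\<dots> \<le> (norm2 \<tau> x + norm2 \<tau> y)\<^sup>2"
    using tinner_cauchy_schwarz[OF assms] by (simp add: power2_sum)
  finally show "(norm2 \<tau> (x + y))\<^sup>2 \<le> (norm2 \<tau> x + norm2 \<tau> y)\<^sup>2" .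
qed (use assms norm2_nonneg in auto)

lemma norm2_minus: "x \<in> N \<Longrightarrow> norm2 \<tau> (- x) = norm2 \<tau> x"
  by (simp add: norm2_def compose_linear)
lemma norm2_commute: "x \<in> N \<Longrightarrow> y \<in> N \<Longrightarrow> norm2 \<tau> (x - y) = norm2 \<tau> (y - x)"
  using norm2_minus[of "x - y"] by simp
lemma norm2_triangle3:
  "x \<in> N \<Longrightarrow> y \<in> N \<Longrightarrow> z \<in> N \<Longrightarrow> norm2 \<tau> (x - z) \<le> norm2 \<tau> (x - y) + norm2 \<tau> (y - z)"
  using norm2_triangle[of "x - y" "y - z"] by simp
lemma norm2_scale: "x \<in> N \<Longrightarrow> 0 \<le> r \<Longrightarrow> norm2 \<tau> (r *\<^sub>R x) = r * norm2 \<tau> x"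
  by (simp add: norm2_def compose_linear tau_scaleR real_sqrt_mult mult.assoc[symmetric])

lemma norm2_adj: "x \<in> N \<Longrightarrow> norm2 \<tau> (x\<^sup>\<dagger>) = norm2 \<tau> x"
  using tau_commute[of x "x\<^sup>\<dagger>"] by (simp add: norm2_def)

text \<open>
  With \<open>h = a\<^sup>\<dagger> a\<close> and \<open>\<phi>(y) = \<tau>(x\<^sup>\<dagger> y x)\<close>, the Cauchy-Schwarz inequality gives
  \<open>\<phi>(h)\<^sup>2 \<le> \<phi>(1) \<phi>(h\<^sup>2)\<close>. Iterating it and using that \<open>\<phi>\<close> is bounded in operator norm yields
  \<open>\<phi>(h) \<le> \<parallel>a\<parallel>\<^sup>2 \<phi>(1)\<close>.
\<close>

lemma norm2_compose_left:
  assumes a: "a \<in> N" and x: "x \<in> N" shows "norm2 \<tau> (a \<cdot> x) \<le> norm a * norm2 \<tau> x"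
proof -
  define H where "H = rec_nat (a\<^sup>\<dagger> \<cdot> a) (\<lambda>_ h. h \<cdot> h)"
  have H0: "H 0 = a\<^sup>\<dagger> \<cdot> a" and HS: "H (Suc n) = H n \<cdot> H n" for n by (simp_all add: H_def)
  have H: "H n \<in> N \<and> (H n)\<^sup>\<dagger> = H n" for n
    by (induction n) (use a in \<open>auto simp: H0 HS\<close>)
  have normH: "norm (H n) \<le> ((norm a)\<^sup>2) ^ (2 ^ n)" for n
  proof (induction n)
    case 0
    have "norm (a\<^sup>\<dagger> \<cdot> a) \<le> norm (a\<^sup>\<dagger>) * norm a" by (rule norm_blinfun_compose)
    also have "\<dots> \<le> norm a * norm a" using norm_op_adj_le[of a] a by (intro mult_right_mono) auto
    finally show ?case by (simp add: H0 power2_eq_square)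
  next
    case (Suc n)
    have "norm (H n \<cdot> H n) \<le> norm (H n) * norm (H n)" by (rule norm_blinfun_compose)
    also have "\<dots> \<le> ((norm a)\<^sup>2) ^ (2 ^ n) * ((norm a)\<^sup>2) ^ (2 ^ n)" by (intro mult_mono Suc) auto
    finally show ?case by (simp add: HS power_add[symmetric] mult_2)
  qed
  obtain C where C: "C \<ge> 0" "\<And>y. y \<in> N \<Longrightarrow> cmod (\<tau> y) \<le> C * norm y" using tau_norm_bounded by blast
  define g where "g = (\<lambda>n. tinner (H n \<cdot> x) x)"
  have "g 0 \<le> (norm2 \<tau> x)\<^sup>2 * (norm a)\<^sup>2"
  proof (rule power_doubling_bound)
    fix n
    have Hx: "H n \<cdot> x \<in> N" using H x by simp
    have "\<bar>g n\<bar> \<le> norm2 \<tau> (H n \<cdot> x) * norm2 \<tau> x"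
    proof -
      have "- g n = tinner (- (H n \<cdot> x)) x" using tinner_scale_left[OF Hx x, of "-1"]
        by (simp add: g_def)
      thus ?thesis
        using tinner_cauchy_schwarz[OF Hx x] tinner_cauchy_schwarz[of "- (H n \<cdot> x)" x] Hx x
        by (auto simp: g_def norm2_minus abs_le_iff)
    qed
    hence "(g n)\<^sup>2 \<le> (norm2 \<tau> (H n \<cdot> x) * norm2 \<tau> x)\<^sup>2" by (metis abs_ge_zero power2_abs power_mono)
    also have "\<dots> = (norm2 \<tau> x)\<^sup>2 * g (Suc n)"
      using Hx x H
        by (simp add: power_mult_distrib norm2_square[of "H n \<cdot> x"] g_def tinner_def HS compose_assoc)
    finally show "(g n)\<^sup>2 \<le> (norm2 \<tau> x)\<^sup>2 * g (Suc n)" .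
    have "g n \<le> cmod (\<tau> (x\<^sup>\<dagger> \<cdot> (H n \<cdot> x)))" unfolding g_def tinner_def by (rule complex_Re_le_cmod)
    also have "\<dots> \<le> C * norm (x\<^sup>\<dagger> \<cdot> (H n \<cdot> x))" using Hx x by (intro C) auto
    also have "\<dots> \<le> C * (norm (x\<^sup>\<dagger>) * (norm (H n) * norm x))"
      by (intro mult_left_mono C order_trans[OF norm_blinfun_compose] norm_blinfun_compose) auto
    also have "\<dots> \<le> C * (norm (x\<^sup>\<dagger>) * (((norm a)\<^sup>2) ^ (2 ^ n) * norm x))"
      by (intro mult_left_mono mult_right_mono normH C) auto
    finally show "g n \<le> (C * norm (x\<^sup>\<dagger>) * norm x) * ((norm a)\<^sup>2) ^ (2 ^ n)" by (simp add: mult_ac)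
  qed auto
  moreover have "g 0 = (norm2 \<tau> (a \<cdot> x))\<^sup>2" using a x
    by (simp add: g_def H0 norm2_square tinner_def compose_assoc)
  ultimately have "(norm2 \<tau> (a \<cdot> x))\<^sup>2 \<le> (norm a * norm2 \<tau> x)\<^sup>2"
    by (simp add: power_mult_distrib mult.commute)
  thus ?thesis by (rule power2_le_imp_le) (use x norm2_nonneg in auto)
qed

lemma norm2_compose_right:
  assumes a: "a \<in> N" and x: "x \<in> N" shows "norm2 \<tau> (x \<cdot> a) \<le> norm a * norm2 \<tau> x"
proof -
  have "norm2 \<tau> (x \<cdot> a) = norm2 \<tau> (a\<^sup>\<dagger> \<cdot> x\<^sup>\<dagger>)" using norm2_adj[of "x \<cdot> a"] a x by simp
  also have "\<dots> \<le> norm (a\<^sup>\<dagger>) * norm2 \<tau> (x\<^sup>\<dagger>)" using a x by (intro norm2_compose_left) auto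
  also have "\<dots> \<le> norm a * norm2 \<tau> x" using a x norm_op_adj_le[of a]
    by (simp add: norm2_adj norm2_nonneg mult_right_mono)
  finally show ?thesis .
qed

lemma norm2_le_norm: assumes x: "x \<in> N" shows "norm2 \<tau> x \<le> norm x"
proof -
  show ?thesis using norm2_compose_left[OF x closed_ops(1)]
    by (simp add: norm2_def op_adj_id tau_id)
qed

subsection \<open>Completeness of the unit ball in the trace norm\<close>

text \<open>
  The matrix coefficients of the \<open>c n\<close> stay in a product of compact intervals, so by Tychonoff's
  theorem they have a cluster point, and the cluster point is the coefficient function of an operator
  \<open>v\<close>. As a weak limit, \<open>v\<close> lies in the bicommutant of \<open>N\<close>. The trace is continuous on bounded sets
  along the clustering filter \<open>G\<close>, so the Cauchy estimate for \<open>c n - c m\<close> carries over to \<open>c n - v\<close>.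
\<close>

lemma unit_ball_norm2_complete:
  assumes c: "\<And>n::nat. c n \<in> N" "\<And>n. norm (c n) \<le> 1"
    and cauchy: "\<And>e. e > 0 \<Longrightarrow> \<exists>K. \<forall>m\<ge>K. \<forall>n\<ge>K. norm2 \<tau> (c m - c n) < e"
  shows "\<exists>v\<in>N. norm v \<le> 1 \<and> (\<lambda>n. norm2 \<tau> (c n - v)) \<longlonglongrightarrow> 0"
proof -
  define F where "F = (\<lambda>n (p :: 'h \<times> 'h). inner (c n \<rhd> fst p) (snd p))"
  define U where "U = (PiE UNIV (\<lambda>p :: 'h \<times> 'h. cball (0::real) (norm (fst p) * norm (snd p))))"
  have "compactin (product_topology (\<lambda>_. euclidean) UNIV) U"
    unfolding U_def compactin_PiE by (simp add: compactin_euclidean_iff)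
  hence U: "compact U" by (simp add: euclidean_product_topology compactin_euclidean_iff)
  have cbd: "norm (c n \<rhd> \<xi>) \<le> norm \<xi>" for n \<xi>
    using norm_blinfun[of "c n" \<xi>] mult_right_mono[OF c(2)[of n] norm_ge_zero[of \<xi>]] by simp
  have FU: "F n \<in> U" for n
    unfolding U_def F_def
    by (auto intro!: order_trans[OF Cauchy_Schwarz_ineq2] mult_right_mono cbd simp: PiE_UNIV_domain)
  have "eventually (\<lambda>x. x \<in> U) (filtermap F sequentially)" by (simp add: eventually_filtermap FU)
  moreover have "filtermap F sequentially \<noteq> bot" by (simp add: filtermap_bot_iff)
  ultimately obtain B where B: "B \<in> U" "inf (nhds B) (filtermap F sequentially) \<noteq> bot"
    using U unfolding compact_filter by blast
  \<comment> \<open>refining the index filter makes the cluster point \<open>B\<close> a limit\<close>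
  define G where "G = inf (filtercomap F (nhds B)) sequentially"
  have Gbot: "G \<noteq> bot"
  proof
    assume "G = bot"
    hence "eventually (\<lambda>_. False) G" by simp
    then obtain P Q where PQ: "eventually P (filtercomap F (nhds B))" "eventually Q sequentially" "\<And>n. P n \<Longrightarrow> Q n \<Longrightarrow> False"
      unfolding G_def eventually_inf by blast
    obtain R where R: "eventually R (nhds B)" "\<And>n. R (F n) \<Longrightarrow> P n" using PQ(1)
      unfolding eventually_filtercomap by blast
    have "eventually (\<lambda>y. \<not> R y) (filtermap F sequentially)"
      unfolding eventually_filtermap using PQ(2) by eventually_elim (use PQ(3) R(2) in blast)
    hence "eventually (\<lambda>_. False) (inf (nhds B) (filtermap F sequentially))"
      unfolding eventually_inf using R(1) by blast
    thus False using B(2) by (simp add: eventually_False)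
  qed
  have Gseq: "eventually P G" if "eventually P sequentially" for P
    using that unfolding G_def by (rule filter_leD[OF inf_le2])
  have "filterlim F (nhds B) G"
    unfolding G_def by (rule filterlim_mono[OF filterlim_filtercomap order_refl inf_le1])
  hence FB: "((\<lambda>n. F n p) \<longlongrightarrow> B p) G" for p
    using continuous_on_product_coordinates[of p] continuous_on_tendsto_compose[of UNIV "\<lambda>x. x p" F B G]
      by simp
  define b where "b = (\<lambda>\<xi> \<eta>. B (\<xi>, \<eta>))"
  have lim: "((\<lambda>n. inner (c n \<rhd> \<xi>) \<eta>) \<longlongrightarrow> b \<xi> \<eta>) G" for \<xi> \<eta>
    using FB[of "(\<xi>, \<eta>)"] by (simp add: F_def b_def)
  note uniq = tendsto_unique[OF Gbot]
  have "\<exists>T. norm T \<le> 1 \<and> (\<forall>\<xi> \<eta>. inner (T \<rhd> \<xi>) \<eta> = b \<xi> \<eta>)"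
  proof (rule bounded_form_operator)
    fix \<xi> \<xi>' \<eta> \<eta>' :: 'h and r :: real
    show "b (\<xi> + \<xi>') \<eta> = b \<xi> \<eta> + b \<xi>' \<eta>"
      using tendsto_add[OF lim[of \<xi> \<eta>] lim[of \<xi>' \<eta>]]
        by (intro uniq[OF lim]) (simp add: blinfun.add_right inner_simps)
    show "b (r *\<^sub>R \<xi>) \<eta> = r * b \<xi> \<eta>"
      using tendsto_mult_left[OF lim[of \<xi> \<eta>], of r]
        by (intro uniq[OF lim]) (simp add: blinfun.scaleR_right)
    show "b \<xi> (\<eta> + \<eta>') = b \<xi> \<eta> + b \<xi> \<eta>'"
      using tendsto_add[OF lim[of \<xi> \<eta>] lim[of \<xi> \<eta>']] by (intro uniq[OF lim]) (simp add: inner_simps)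
    show "b \<xi> (r *\<^sub>R \<eta>) = r * b \<xi> \<eta>"
      using tendsto_mult_left[OF lim[of \<xi> \<eta>], of r] by (intro uniq[OF lim]) simp
    show "\<bar>b \<xi> \<eta>\<bar> \<le> 1 * norm \<xi> * norm \<eta>"
    proof -
      have "B (\<xi>, \<eta>) \<in> cball 0 (norm \<xi> * norm \<eta>)" using B(1) unfolding U_def by (auto simp: PiE_iff)
      thus ?thesis by (simp add: b_def)
    qed
  qed simp
  then obtain v where v: "norm v \<le> 1" "\<And>\<xi> \<eta>. inner (v \<rhd> \<xi>) \<eta> = b \<xi> \<eta>" by blast
  note lim = lim[folded v(2)]
  have "v \<in> commutant (commutant N)"
    unfolding commutant_def[of "commutant N"] mem_Collect_eq
  proof (intro conjI ballI)
    show "v \<in> bounded_ops" unfolding bounded_ops_def mem_Collect_eq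
    proof (intro allI, rule vector_eq_rdot[THEN iffD1], rule allI)
      fix k and \<xi> \<eta> :: 'h
      have "((\<lambda>n. inner (c n \<rhd> (k *\<^sub>C \<xi>)) \<eta>) \<longlongrightarrow> inner (k *\<^sub>C v \<rhd> \<xi>) \<eta>) G"
        using lim[of \<xi> "cnj k *\<^sub>C \<eta>"] c(1) by (simp add: bounded_opsD inner_scaleC_left)
      thus "inner (v \<rhd> (k *\<^sub>C \<xi>)) \<eta> = inner (k *\<^sub>C v \<rhd> \<xi>) \<eta>" by (intro uniq[OF lim])
    qed
    fix y assume y: "y \<in> commutant N"
    hence yb: "y \<in> bounded_ops" using commutant_bounded by blast
    show "v \<cdot> y = y \<cdot> v"
    proof (rule blinfun_eqI, rule vector_eq_rdot[THEN iffD1], rule allI)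
      fix \<xi> \<eta> :: 'h
      have "c n \<rhd> y \<rhd> \<xi> = y \<rhd> c n \<rhd> \<xi>" for n
        using commutantD[OF y c(1)[of n]] by (metis blinfun_apply_blinfun_compose)
      hence "((\<lambda>n. inner (c n \<rhd> y \<rhd> \<xi>) \<eta>) \<longlongrightarrow> inner (y \<rhd> v \<rhd> \<xi>) \<eta>) G"
        using lim[of \<xi> "y\<^sup>\<dagger> \<rhd> \<eta>"] by (simp add: inner_op_adj[OF yb])
      from uniq[OF lim this] show "inner ((v \<cdot> y) \<rhd> \<xi>) \<eta> = inner ((y \<cdot> v) \<rhd> \<xi>) \<eta>" by simp
    qed
  qed
  hence vN: "v \<in> N" by (simp add: vna_bicommutant[OF vna])
  have tau_lim: "((\<lambda>m. \<tau> (y \<cdot> c m)) \<longlongrightarrow> \<tau> (y \<cdot> v)) G" if y: "y \<in> N" for y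
  proof (rule tau_tendsto[where R="norm y", OF _ _ _ Gbot])
    show "norm (y \<cdot> c m) \<le> norm y" for m
      using norm_blinfun_compose[of y "c m"] mult_left_mono[OF c(2)[of m] norm_ge_zero[of y]]
        by simp
    show "((\<lambda>n. inner ((y \<cdot> c n) \<rhd> \<xi>) \<eta>) \<longlongrightarrow> inner ((y \<cdot> v) \<rhd> \<xi>) \<eta>) G" for \<xi> \<eta>
      using lim[of \<xi> "y\<^sup>\<dagger> \<rhd> \<eta>"] y by (simp add: inner_op_adj)
  qed (use y c vN in auto)
  have conv: "\<exists>K. \<forall>n\<ge>K. norm2 \<tau> (c n - v) \<le> e" if e: "e > 0" for e
  proof -
    obtain K where K: "\<And>m n. m \<ge> K \<Longrightarrow> n \<ge> K \<Longrightarrow> norm2 \<tau> (c m - c n) < e" using cauchy[OF e] by blast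
    have "norm2 \<tau> (c n - v) \<le> e" if n: "n \<ge> K" for n
    proof -
      define d where "d = c n - v"
      have dN: "d \<in> N" using c vN by (simp add: d_def)
      have "((\<lambda>m. tinner (c n - c m) d) \<longlongrightarrow> tinner d d) G"
      proof -
        have "((\<lambda>m. \<tau> (d\<^sup>\<dagger> \<cdot> c n) - \<tau> (d\<^sup>\<dagger> \<cdot> c m)) \<longlongrightarrow> \<tau> (d\<^sup>\<dagger> \<cdot> c n) - \<tau> (d\<^sup>\<dagger> \<cdot> v)) G"
          using dN by (intro tendsto_intros tau_lim) auto
        hence "((\<lambda>m. Re (\<tau> (d\<^sup>\<dagger> \<cdot> c n) - \<tau> (d\<^sup>\<dagger> \<cdot> c m))) \<longlongrightarrow> Re (\<tau> (d\<^sup>\<dagger> \<cdot> c n) - \<tau> (d\<^sup>\<dagger> \<cdot> v))) G"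
          by (rule tendsto_Re)
        moreover have "\<tau> (d\<^sup>\<dagger> \<cdot> c n) - \<tau> (d\<^sup>\<dagger> \<cdot> v) = \<tau> (d\<^sup>\<dagger> \<cdot> d)"
          using dN c vN by (simp add: d_def compose_linear tau_diff del: adj_diff)
        ultimately show ?thesis using dN c vN by (simp add: tinner_def compose_linear tau_diff)
      qed
      moreover have "eventually (\<lambda>m. tinner (c n - c m) d \<le> e * norm2 \<tau> d) G"
      proof (rule Gseq)
        show "eventually (\<lambda>m. tinner (c n - c m) d \<le> e * norm2 \<tau> d) sequentially"
        proof (rule eventually_sequentiallyI)
          fix m assume "m \<ge> K"
          hence "norm2 \<tau> (c n - c m) \<le> e" using K[OF n] less_imp_le by blast
          hence "norm2 \<tau> (c n - c m) * norm2 \<tau> d \<le> e * norm2 \<tau> d" using norm2_nonneg[OF dN]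
            by (rule mult_right_mono)
          thus "tinner (c n - c m) d \<le> e * norm2 \<tau> d"
            using tinner_cauchy_schwarz[of "c n - c m" d] dN c by simp
        qed
      qed
      ultimately have "tinner d d \<le> e * norm2 \<tau> d" by (rule tendsto_upperbound[OF _ _ Gbot])
      hence "norm2 \<tau> d * norm2 \<tau> d \<le> e * norm2 \<tau> d" using norm2_square[OF dN]
        by (simp add: power2_eq_square)
      thus ?thesis using norm2_nonneg[OF dN] e unfolding d_def[symmetric]
        by (cases "norm2 \<tau> d = 0") (auto simp: mult_le_cancel_right)
    qed
    thus ?thesis by blast
  qed
  have "(\<lambda>n. norm2 \<tau> (c n - v)) \<longlonglongrightarrow> 0"
  proof (rule LIMSEQ_I)
    fix e :: real assume e: "e > 0"
    obtain K where K: "\<And>n. n \<ge> K \<Longrightarrow> norm2 \<tau> (c n - v) \<le> e / 2" using conv[of "e/2"] e by auto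
    have "norm (norm2 \<tau> (c n - v) - 0) < e" if "n \<ge> K" for n
      using K[OF that] norm2_nonneg[of "c n - v"] c vN e by simp
    thus "\<exists>K. \<forall>n\<ge>K. norm (norm2 \<tau> (c n - v) - 0) < e" by blast
  qed
  thus ?thesis using v vN by blast
qed

end

section \<open>Unitaries in a von Neumann algebra\<close>

instance complex_hilbert_space \<subseteq> banach ..

lemma neumann_series_inverse:
  fixes y :: "'a::banach \<Rightarrow>\<^sub>L 'a"
  assumes "norm y < 1"
  shows "\<exists>k. (id_blinfun - y) \<cdot> k = id_blinfun \<and> k \<cdot> (id_blinfun - y) = id_blinfun"
proof -
  define pw where "pw = rec_nat id_blinfun (\<lambda>_ z. y \<cdot> z)"
  have pw: "pw 0 = id_blinfun" "pw (Suc n) = y \<cdot> pw n" for n by (simp_all add: pw_def)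
  have pwr: "pw (Suc n) = pw n \<cdot> y" for n
    by (induction n) (simp add: pw, metis pw(2) compose_assoc)
  have nb: "norm (pw n) \<le> norm y ^ n" for n
  proof (induction n)
    case 0 show ?case by (simp add: pw norm_blinfun_id_le)
  next
    case (Suc n)
    have "norm (y \<cdot> pw n) \<le> norm y * norm (pw n)" by (rule norm_blinfun_compose)
    also have "\<dots> \<le> norm y * norm y ^ n" by (intro mult_left_mono Suc) auto
    finally show ?case by (simp add: pw)
  qed
  have sm: "summable pw"
    by (rule summable_comparison_test'[of "\<lambda>n. norm y ^ n"]) (use assms nb in auto)
  define k where "k = suminf pw"
  have head: "k = id_blinfun + (\<Sum>n. pw (Suc n))"
    using suminf_split_head[OF sm] by (simp add: k_def pw)
  have "y \<cdot> k = (\<Sum>n. pw (Suc n))"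
    unfolding k_def pw(2)
    by (rule bounded_linear.suminf[OF bounded_bilinear.bounded_linear_right[OF bounded_bilinear_blinfun_compose] sm])
  moreover have "k \<cdot> y = (\<Sum>n. pw (Suc n))"
    unfolding k_def pwr
    by (rule bounded_linear.suminf[OF bounded_bilinear.bounded_linear_left[OF bounded_bilinear_blinfun_compose] sm])
  ultimately have "y \<cdot> k = k - id_blinfun" "k \<cdot> y = k - id_blinfun"
    using head by (metis add_diff_cancel_left')+
  thus ?thesis by (intro exI[of _ k]) (simp add: compose_linear)
qed

lemma inverse_commutes:
  fixes a k b :: "'a::real_normed_vector \<Rightarrow>\<^sub>L 'a"
  assumes "a \<cdot> k = id_blinfun" "k \<cdot> a = id_blinfun" "b \<cdot> a = a \<cdot> b"
  shows "k \<cdot> b = b \<cdot> k"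
proof -
  have "k \<cdot> b = k \<cdot> (b \<cdot> a) \<cdot> k" by (simp add: compose_assoc assms(1))
  also have "\<dots> = (k \<cdot> a) \<cdot> b \<cdot> k" by (simp add: assms(3) compose_assoc)
  finally show ?thesis by (simp add: assms(2))
qed

text \<open>
  The inverse of \<open>a\<close> commutes with everything that commutes with \<open>a\<close>; applied to the scalars this
  gives complex linearity, applied to the commutant of \<open>P\<close> it gives membership in the bicommutant.
\<close>

lemma vna_inverse_mem:
  assumes P: "von_neumann_algebra P" and a: "a \<in> P" and inv: "a \<cdot> k = id_blinfun" "k \<cdot> a = id_blinfun"
  shows "k \<in> P"
proof -
  have ab: "a \<in> bounded_ops" using vna_bounded[OF P] a by blast
  have "k \<in> commutant (commutant P)"
    unfolding commutant_def[of "commutant P"] mem_Collect_eq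
  proof (intro conjI ballI)
    show "k \<in> bounded_ops" unfolding bounded_ops_def mem_Collect_eq
    proof (intro allI)
      fix c \<xi>
      have "op_scaleC c id_blinfun \<cdot> a = a \<cdot> op_scaleC c id_blinfun"
        by (simp add: op_scaleC_compose_left op_scaleC_compose_right[OF ab])
      from inverse_commutes[OF inv this]
      have "(k \<cdot> op_scaleC c id_blinfun) \<rhd> \<xi> = (op_scaleC c id_blinfun \<cdot> k) \<rhd> \<xi>" by simp
      thus "k \<rhd> (c *\<^sub>C \<xi>) = c *\<^sub>C k \<rhd> \<xi>" by simp
    qed
    show "k \<cdot> y = y \<cdot> k" if "y \<in> commutant P" for y
      by (rule inverse_commutes[OF inv commutantD[OF that a]])
  qed
  thus ?thesis by (simp add: vna_bicommutant[OF P])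
qed

definition unitary_op :: "'h::complex_hilbert_space operator \<Rightarrow> bool" where
  "unitary_op u \<longleftrightarrow> u\<^sup>\<dagger> \<cdot> u = id_blinfun \<and> u \<cdot> u\<^sup>\<dagger> = id_blinfun"

lemma norm_isometry_le_one:
  assumes w: "w \<in> bounded_ops" "w\<^sup>\<dagger> \<cdot> w = id_blinfun" shows "norm w \<le> 1"
proof (rule norm_blinfun_bound)
  fix \<xi>
  have "w\<^sup>\<dagger> \<rhd> w \<rhd> \<xi> = \<xi>"
    using arg_cong[OF w(2), of "\<lambda>z. z \<rhd> \<xi>"] by simp
  hence "(norm (w \<rhd> \<xi>))\<^sup>2 = (norm \<xi>)\<^sup>2"
    by (simp add: power2_norm_eq_inner inner_op_adj[OF w(1)])
  thus "norm (w \<rhd> \<xi>) \<le> 1 * norm \<xi>" by (simp add: power2_eq_iff_nonneg)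
qed simp

lemma norm_projection_le_one:
  assumes q: "q \<in> bounded_ops" "q\<^sup>\<dagger> = q" "q \<cdot> q = q" shows "norm q \<le> 1"
proof (rule norm_blinfun_bound)
  fix \<xi>
  have qq: "q \<rhd> q \<rhd> \<xi> = q \<rhd> \<xi>"
    using arg_cong[OF q(3), of "\<lambda>z. z \<rhd> \<xi>"] by simp
  have "(norm (q \<rhd> \<xi>))\<^sup>2 = inner \<xi> (q \<rhd> \<xi>)"
    by (simp add: power2_norm_eq_inner inner_op_adj[OF q(1)] q(2) qq)
  also have "\<dots> \<le> norm \<xi> * norm (q \<rhd> \<xi>)" by (rule norm_cauchy_schwarz)
  finally show "norm (q \<rhd> \<xi>) \<le> 1 * norm \<xi>"
    by (cases "norm (q \<rhd> \<xi>) = 0") (auto simp: power2_eq_square)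
qed simp

text \<open>
  With \<open>k = (1 + \<i> x)\<^sup>-\<^sup>1\<close> the operator \<open>2k - 1\<close> is the Cayley transform \<open>(1 - \<i> x) (1 + \<i> x)\<^sup>-\<^sup>1\<close>
  of \<open>x\<close>. It provides enough unitaries to recover \<open>x\<close> by purely algebraic operations.
\<close>

lemma cayley_transform:
  assumes P: "von_neumann_algebra P" and x: "x \<in> P" "x\<^sup>\<dagger> = x" "norm x < 1"
  shows "\<exists>k\<in>P. (id_blinfun + op_scaleC \<i> x) \<cdot> k = id_blinfun \<and> k \<cdot> (id_blinfun + op_scaleC \<i> x) = id_blinfun
     \<and> unitary_op (2 *\<^sub>R k - id_blinfun)"
proof -
  define y where "y = op_scaleC (-\<i>) x"
  have xb: "x \<in> bounded_ops" using vna_bounded[OF P] x by blast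
  have "norm y \<le> norm x"
    by (rule norm_blinfun_bound) (simp_all add: y_def norm_scaleC norm_blinfun)
  hence "norm y < 1" using x by simp
  then obtain k where k: "(id_blinfun - y) \<cdot> k = id_blinfun" "k \<cdot> (id_blinfun - y) = id_blinfun"
    using neumann_series_inverse by blast
  define a where "a = id_blinfun + op_scaleC \<i> x"
  have ay: "a = id_blinfun - y"
    unfolding a_def y_def by (simp add: op_scaleC_minus_left)
  have k: "a \<cdot> k = id_blinfun" "k \<cdot> a = id_blinfun" using k by (simp_all add: ay)
  have aP: "a \<in> P" unfolding a_def by (intro vna_add[OF P] vna_id[OF P] vna_scaleC[OF P] x)
  have kP: "k \<in> P" by (rule vna_inverse_mem[OF P aP k])
  have ab: "a \<in> bounded_ops" "k \<in> bounded_ops" using vna_bounded[OF P] aP kP by auto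
  have aa: "a\<^sup>\<dagger> = 2 *\<^sub>R id_blinfun - a"
    unfolding a_def using xb x(2)
    by (simp add: op_adj_add bounded_ops_id bounded_ops_scaleC op_adj_id op_adj_scaleC op_scaleC_minus_left scaleR_2)
  define u where "u = 2 *\<^sub>R k - id_blinfun"
  have u1: "u = a\<^sup>\<dagger> \<cdot> k" and u2: "u = k \<cdot> a\<^sup>\<dagger>"
    by (simp_all add: aa u_def compose_linear k)
  have ab': "a\<^sup>\<dagger> \<in> bounded_ops" "k\<^sup>\<dagger> \<in> bounded_ops" using ab bounded_ops_adj by auto
  have ka: "k\<^sup>\<dagger> \<cdot> a\<^sup>\<dagger> = id_blinfun" "a\<^sup>\<dagger> \<cdot> k\<^sup>\<dagger> = id_blinfun"
    using arg_cong[OF k(1), of op_adj] arg_cong[OF k(2), of op_adj] ab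
    by (simp_all add: op_adj_compose op_adj_id)
  have v1: "u\<^sup>\<dagger> = k\<^sup>\<dagger> \<cdot> a" unfolding u1 using ab ab' by (simp add: op_adj_compose op_adj_adj)
  have v2: "u\<^sup>\<dagger> = a \<cdot> k\<^sup>\<dagger>" unfolding u2 using ab ab' by (simp add: op_adj_compose op_adj_adj)
  have "u\<^sup>\<dagger> \<cdot> u = a \<cdot> (k\<^sup>\<dagger> \<cdot> a\<^sup>\<dagger>) \<cdot> k" unfolding v2 by (simp add: u1 compose_assoc)
  hence "u\<^sup>\<dagger> \<cdot> u = id_blinfun" by (simp add: ka k)
  moreover have "u \<cdot> u\<^sup>\<dagger> = k \<cdot> (a\<^sup>\<dagger> \<cdot> k\<^sup>\<dagger>) \<cdot> a" unfolding v1 by (simp add: u2 compose_assoc)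
  hence "u \<cdot> u\<^sup>\<dagger> = id_blinfun" by (simp add: ka k)
  ultimately have "unitary_op (2 *\<^sub>R k - id_blinfun)" unfolding u_def[symmetric] unitary_op_def
    by blast
  thus ?thesis using kP k unfolding a_def by blast
qed

section \<open>Intertwiners for nearly trivial automorphisms\<close>

context tracial_algebra
begin

lemma
  assumes "\<theta> \<in> tracial_Aut N \<tau>" "x \<in> N"
  shows aut_mem: "\<theta> x \<in> N"
    and aut_add: "y \<in> N \<Longrightarrow> \<theta> (x + y) = \<theta> x + \<theta> y"
    and aut_scaleC: "\<theta> (op_scaleC c x) = op_scaleC c (\<theta> x)"
    and aut_compose: "y \<in> N \<Longrightarrow> \<theta> (x \<cdot> y) = \<theta> x \<cdot> \<theta> y"
    and aut_adj: "\<theta> (x\<^sup>\<dagger>) = (\<theta> x)\<^sup>\<dagger>"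
    and aut_tau: "\<tau> (\<theta> x) = \<tau> x"
  using assms by (auto simp: tracial_Aut_def bij_betw_def)

lemma aut_inj: "\<theta> \<in> tracial_Aut N \<tau> \<Longrightarrow> x \<in> N \<Longrightarrow> y \<in> N \<Longrightarrow> \<theta> x = \<theta> y \<Longrightarrow> x = y"
  by (auto simp: tracial_Aut_def bij_betw_def inj_on_def)

lemma aut_minus: "\<theta> \<in> tracial_Aut N \<tau> \<Longrightarrow> x \<in> N \<Longrightarrow> \<theta> (- x) = - \<theta> x"
  using aut_scaleC[of \<theta> x "-1"] by (simp add: op_scaleC_minus_one)
lemma aut_diff: "\<theta> \<in> tracial_Aut N \<tau> \<Longrightarrow> x \<in> N \<Longrightarrow> y \<in> N \<Longrightarrow> \<theta> (x - y) = \<theta> x - \<theta> y"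
  using aut_add[of \<theta> x "- y"] by (simp add: aut_minus)
lemma aut_zero: "\<theta> \<in> tracial_Aut N \<tau> \<Longrightarrow> \<theta> 0 = 0"
  using aut_diff[of \<theta> 0 0] by simp
lemma aut_id: assumes \<theta>: "\<theta> \<in> tracial_Aut N \<tau>" shows "\<theta> id_blinfun = id_blinfun"
proof -
  obtain x where x: "x \<in> N" "\<theta> x = id_blinfun"
    using \<theta> closed_ops(1) unfolding tracial_Aut_def bij_betw_def
      by (metis (mono_tags, lifting) CollectD imageE)
  thus ?thesis using aut_compose[OF \<theta> closed_ops(1) x(1)] by simp
qed

lemma norm2_aut: "\<theta> \<in> tracial_Aut N \<tau> \<Longrightarrow> x \<in> N \<Longrightarrow> norm2 \<tau> (\<theta> x) = norm2 \<tau> x"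
  using aut_tau[of \<theta> "x\<^sup>\<dagger> \<cdot> x"] by (simp add: norm2_def aut_compose aut_adj)

text \<open>
  Intertwining the Cayley transform of a small self-adjoint \<open>x\<close> means intertwining the inverse of
  \<open>1 + \<i> x\<close>, hence \<open>x\<close> itself. Scaling and decomposing into real and imaginary parts gives the rest.
\<close>

lemma intertwines_of_unitaries:
  assumes P: "von_neumann_algebra P" "P \<subseteq> N" and \<theta>: "\<theta> \<in> tracial_Aut N \<tau>" and v: "v \<in> N"
    and un: "\<And>u. u \<in> P \<Longrightarrow> unitary_op u \<Longrightarrow> \<theta> u \<cdot> v = v \<cdot> u"
    and x: "x \<in> P"
  shows "\<theta> x \<cdot> v = v \<cdot> x"
proof -
  have small: "\<theta> x \<cdot> v = v \<cdot> x" if x: "x \<in> P" "x\<^sup>\<dagger> = x" "norm x < 1" for x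
  proof -
    define a where "a = id_blinfun + op_scaleC \<i> x"
    obtain k where k: "k \<in> P" "a \<cdot> k = id_blinfun" "k \<cdot> a = id_blinfun" "unitary_op (2 *\<^sub>R k - id_blinfun)"
      using cayley_transform[OF P(1) x] unfolding a_def by blast
    have mem: "x \<in> N" "k \<in> N" "a \<in> N" using x k P by (auto simp: a_def)
    have "2 *\<^sub>R k - id_blinfun \<in> P"
      by (intro vna_diff[OF P(1)] vna_scaleR[OF P(1)] vna_id[OF P(1)] k)
    from un[OF this k(4)] have "2 *\<^sub>R (\<theta> k \<cdot> v) = 2 *\<^sub>R (v \<cdot> k)"
      using mem v by (simp add: aut_diff[OF \<theta>] aut_id[OF \<theta>] compose_linear scaleR_eq_op_scaleC
          aut_scaleC[OF \<theta>] op_scaleC_compose_left op_scaleC_compose_right)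
    hence kv: "\<theta> k \<cdot> v = v \<cdot> k" by simp
    have "\<theta> a \<cdot> v = \<theta> a \<cdot> (v \<cdot> k \<cdot> a)" using k by (simp add: compose_assoc)
    also have "\<dots> = (\<theta> a \<cdot> \<theta> k) \<cdot> (v \<cdot> a)" by (simp add: kv[symmetric] compose_assoc)
    also have "\<theta> a \<cdot> \<theta> k = id_blinfun" using aut_compose[OF \<theta>, of a k] mem
      by (simp add: k aut_id[OF \<theta>])
    finally have "\<theta> a \<cdot> v = v \<cdot> a" by simp
    hence "op_scaleC \<i> (\<theta> x \<cdot> v) = op_scaleC \<i> (v \<cdot> x)"
      using mem v by (simp add: a_def aut_add[OF \<theta>] aut_id[OF \<theta>] aut_scaleC[OF \<theta>] compose_linear
          op_scaleC_compose_left op_scaleC_compose_right)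
    hence "op_scaleC (-\<i>) (op_scaleC \<i> (\<theta> x \<cdot> v)) = op_scaleC (-\<i>) (op_scaleC \<i> (v \<cdot> x))" by simp
    thus ?thesis by (simp add: op_scaleC_scaleC op_scaleC_one)
  qed
  have sa: "\<theta> x \<cdot> v = v \<cdot> x" if x: "x \<in> P" "x\<^sup>\<dagger> = x" for x
  proof -
    define r where "r = 1 / (norm x + 1)"
    have r: "r > 0" by (simp add: r_def add_nonneg_pos)
    have xN: "x \<in> N" using x P by blast
    have "\<theta> (r *\<^sub>R x) \<cdot> v = v \<cdot> (r *\<^sub>R x)"
    proof (rule small)
      show "r *\<^sub>R x \<in> P" by (rule vna_scaleR[OF P(1) x(1)])
      show "(r *\<^sub>R x)\<^sup>\<dagger> = r *\<^sub>R x" using x xN by simp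
      show "norm (r *\<^sub>R x) < 1" by (simp add: r_def divide_simps add_nonneg_pos)
    qed
    hence "r *\<^sub>R (\<theta> x \<cdot> v) = r *\<^sub>R (v \<cdot> x)"
      using xN v
        by (simp add: scaleR_eq_op_scaleC aut_scaleC[OF \<theta>] op_scaleC_compose_left op_scaleC_compose_right)
    thus ?thesis using r by simp
  qed
  have xN: "x \<in> N" using x P by blast
  define h where "h = x + x\<^sup>\<dagger>"
  define g where "g = op_scaleC \<i> (x - x\<^sup>\<dagger>)"
  have hP: "h \<in> P" unfolding h_def by (intro vna_add[OF P(1)] vna_adj[OF P(1)] x)
  have gP: "g \<in> P" unfolding g_def
    by (intro vna_scaleC[OF P(1)] vna_diff[OF P(1)] vna_adj[OF P(1)] x)
  have "h\<^sup>\<dagger> = h" using xN by (simp add: h_def add.commute)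
  moreover have "g\<^sup>\<dagger> = g"
  proof -
    have "g\<^sup>\<dagger> = op_scaleC (-\<i>) (x\<^sup>\<dagger> - x)" using xN by (simp add: g_def)
    also have "\<dots> = op_scaleC \<i> (op_scaleC (-1) (x\<^sup>\<dagger> - x))" by (simp add: op_scaleC_scaleC)
    finally show ?thesis by (simp add: op_scaleC_minus_one g_def)
  qed
  moreover have "2 *\<^sub>R x = h + op_scaleC (-\<i>) g"
    by (simp add: h_def g_def op_scaleC_scaleC op_scaleC_one scaleR_2)
  ultimately have "\<theta> (2 *\<^sub>R x) \<cdot> v = v \<cdot> (2 *\<^sub>R x)"
    using sa[OF hP] sa[OF gP] hP gP P(2) v
    by (simp add: subset_iff aut_add[OF \<theta>] aut_scaleC[OF \<theta>] compose_linear op_scaleC_compose_left op_scaleC_compose_right)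
  hence "2 *\<^sub>R (\<theta> x \<cdot> v) = 2 *\<^sub>R (v \<cdot> x)"
    using xN v
      by (simp add: scaleR_eq_op_scaleC aut_scaleC[OF \<theta>] op_scaleC_compose_left op_scaleC_compose_right)
  thus ?thesis by simp
qed

lemma norm2_parallelogram:
  assumes "x \<in> N" "y \<in> N"
  shows "(norm2 \<tau> (x - y))\<^sup>2 = 2 * (norm2 \<tau> x)\<^sup>2 + 2 * (norm2 \<tau> y)\<^sup>2 - 4 * (norm2 \<tau> ((1/2) *\<^sub>R (x + y)))\<^sup>2"
  using assms tinner_sym[OF assms]
  by (simp add: norm2_square tinner_add_left tinner_add_right tinner_diff_left tinner_diff_right
      tinner_scale_left tinner_scale_right field_simps)

text \<open>
  Let \<open>K\<close> be the convex hull of the elements \<open>\<theta>(u) u\<^sup>\<dagger>\<close>, \<open>u\<close> a unitary of \<open>P\<close>. For every unitary \<open>u\<close> the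
  map \<open>T u\<close> sends \<open>k\<close> to \<open>\<theta>(u) k u\<^sup>\<dagger>\<close>; it preserves \<open>K\<close> and does not increase the trace norm. By the
  parallelogram law a sequence in \<open>K\<close> that minimises the trace norm converges to a limit \<open>v\<close> that does
  not depend on the sequence, so \<open>T u v = v\<close>, which is the intertwining relation for \<open>u\<close>. Every
  element of \<open>K\<close> is a contraction within \<open>\<epsilon>\<close> of the identity, and so is \<open>v\<close>.
\<close>

lemma exists_intertwiner:
  assumes P: "von_neumann_algebra P" "P \<subseteq> N" and \<theta>: "\<theta> \<in> tracial_Aut N \<tau>"
    and close: "\<And>u. u \<in> P \<Longrightarrow> unitary_op u \<Longrightarrow> norm2 \<tau> (\<theta> u - u) \<le> \<epsilon>"
  shows "\<exists>v\<in>N. norm v \<le> 1 \<and> norm2 \<tau> (v - id_blinfun) \<le> \<epsilon> \<and> (\<forall>x\<in>P. \<theta> x \<cdot> v = v \<cdot> x)"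
proof -
  define U where "U = {u \<in> P. unitary_op u}"
  define T where "T = (\<lambda>u k. \<theta> u \<cdot> (k \<cdot> u\<^sup>\<dagger>))"
  define K where "K = convex hull (\<lambda>u. \<theta> u \<cdot> u\<^sup>\<dagger>) ` U"
  define C where "C = {k \<in> N. norm k \<le> 1 \<and> norm2 \<tau> (k - id_blinfun) \<le> \<epsilon>}"
  have U: "u \<in> N" "\<theta> u \<in> N" "u\<^sup>\<dagger> \<cdot> u = id_blinfun" "u \<cdot> u\<^sup>\<dagger> = id_blinfun" "norm u \<le> 1" "norm (u\<^sup>\<dagger>) \<le> 1"
      "norm (\<theta> u) \<le> 1" if "u \<in> U" for u
  proof -
    show uN: "u \<in> N" and u1: "u\<^sup>\<dagger> \<cdot> u = id_blinfun" "u \<cdot> u\<^sup>\<dagger> = id_blinfun" using that P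
      by (auto simp: U_def unitary_op_def)
    show "\<theta> u \<in> N" by (rule aut_mem[OF \<theta> uN])
    show "norm u \<le> 1" "norm (u\<^sup>\<dagger>) \<le> 1" using uN u1 by (auto intro!: norm_isometry_le_one)
    have "(\<theta> u)\<^sup>\<dagger> \<cdot> \<theta> u = id_blinfun"
      using aut_compose[OF \<theta>, of "u\<^sup>\<dagger>" u] uN by (simp add: u1 aut_id[OF \<theta>] aut_adj[OF \<theta>])
    thus "norm (\<theta> u) \<le> 1" using aut_mem[OF \<theta> uN] by (intro norm_isometry_le_one) auto
  qed
  have "convex C"
  proof (rule convexI)
    fix x y and a b :: real assume xy: "x \<in> C" "y \<in> C" and ab: "0 \<le> a" "0 \<le> b" "a + b = 1"
    have N: "x \<in> N" "y \<in> N" using xy by (auto simp: C_def)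
    have "norm (a *\<^sub>R x + b *\<^sub>R y) \<le> a * norm x + b * norm y"
      using norm_triangle_ineq[of "a *\<^sub>R x" "b *\<^sub>R y"] ab by simp
    also have "\<dots> \<le> a * 1 + b * 1" using xy ab by (intro add_mono mult_left_mono) (auto simp: C_def)
    finally have n: "norm (a *\<^sub>R x + b *\<^sub>R y) \<le> 1" using ab by simp
    have "a *\<^sub>R x + b *\<^sub>R y - id_blinfun = a *\<^sub>R x + b *\<^sub>R y - (a + b) *\<^sub>R id_blinfun" using ab
      by simp
    also have "\<dots> = a *\<^sub>R (x - id_blinfun) + b *\<^sub>R (y - id_blinfun)" by (simp add: algebra_simps)
    finally have "norm2 \<tau> (a *\<^sub>R x + b *\<^sub>R y - id_blinfun) \<le> a * norm2 \<tau> (x - id_blinfun) + b * norm2 \<tau> (y - id_blinfun)"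
      using norm2_triangle[of "a *\<^sub>R (x - id_blinfun)" "b *\<^sub>R (y - id_blinfun)"] N ab
        by (simp add: norm2_scale)
    also have "\<dots> \<le> a * \<epsilon> + b * \<epsilon>" using xy ab by (intro add_mono mult_left_mono) (auto simp: C_def)
    also have "\<dots> = \<epsilon>" using ab by (metis distrib_right mult_1)
    finally show "a *\<^sub>R x + b *\<^sub>R y \<in> C" using N n by (simp add: C_def)
  qed
  moreover have "(\<lambda>u. \<theta> u \<cdot> u\<^sup>\<dagger>) ` U \<subseteq> C"
  proof safe
    fix u assume u: "u \<in> U"
    note Uu = U[OF u]
    have "norm (\<theta> u \<cdot> u\<^sup>\<dagger>) \<le> norm (\<theta> u) * norm (u\<^sup>\<dagger>)" by (rule norm_blinfun_compose)
    also have "\<dots> \<le> 1" using mult_mono[OF Uu(7) Uu(6)] by simp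
    finally have n: "norm (\<theta> u \<cdot> u\<^sup>\<dagger>) \<le> 1" .
    have d: "norm2 \<tau> (\<theta> u - u) \<le> \<epsilon>" using close u by (auto simp: U_def)
    have "\<theta> u \<cdot> u\<^sup>\<dagger> - id_blinfun = (\<theta> u - u) \<cdot> u\<^sup>\<dagger>" by (simp add: compose_linear Uu)
    also have "norm2 \<tau> \<dots> \<le> norm (u\<^sup>\<dagger>) * norm2 \<tau> (\<theta> u - u)" using Uu
      by (intro norm2_compose_right) auto
    also have "\<dots> \<le> 1 * norm2 \<tau> (\<theta> u - u)" using Uu by (intro mult_right_mono norm2_nonneg) auto
    finally show "\<theta> u \<cdot> u\<^sup>\<dagger> \<in> C" using n d Uu by (simp add: C_def)
  qed
  ultimately have KC: "K \<subseteq> C" unfolding K_def by (intro hull_minimal)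
  hence KN: "k \<in> N" if "k \<in> K" for k using that by (auto simp: C_def)
  have Kconv: "convex K" unfolding K_def by (rule convex_convex_hull)
  have idU: "id_blinfun \<in> U" using vna_id[OF P(1)] by (simp add: U_def unitary_op_def op_adj_id)
  hence Kne: "K \<noteq> {}" by (auto simp: K_def)
  have TK: "T u k \<in> K" if u: "u \<in> U" and k: "k \<in> K" for u k
  proof -
    have lin: "linear (T u)" unfolding T_def by (rule linearI) (simp_all add: compose_linear)
    have "K \<subseteq> T u -` K"
      unfolding K_def
    proof (rule hull_minimal)
      show "convex (T u -` (convex hull (\<lambda>u. \<theta> u \<cdot> u\<^sup>\<dagger>) ` U))"
        by (rule convex_linear_vimage[OF lin convex_convex_hull])
      show "(\<lambda>u. \<theta> u \<cdot> u\<^sup>\<dagger>) ` U \<subseteq> T u -` (convex hull (\<lambda>u. \<theta> u \<cdot> u\<^sup>\<dagger>) ` U)"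
      proof (safe, unfold vimage_eq)
        fix w assume w: "w \<in> U"
        have "u \<cdot> w \<in> P" using u w by (auto simp: U_def intro: vna_compose[OF P(1)])
        moreover have "unitary_op (u \<cdot> w)"
        proof -
          have "(u \<cdot> w)\<^sup>\<dagger> \<cdot> (u \<cdot> w) = w\<^sup>\<dagger> \<cdot> (u\<^sup>\<dagger> \<cdot> u) \<cdot> w" using U(1)[OF u] U(1)[OF w]
            by (simp add: compose_assoc)
          moreover have "(u \<cdot> w) \<cdot> (u \<cdot> w)\<^sup>\<dagger> = u \<cdot> (w \<cdot> w\<^sup>\<dagger>) \<cdot> u\<^sup>\<dagger>" using U(1)[OF u] U(1)[OF w]
            by (simp add: compose_assoc)
          ultimately show ?thesis using U(3,4)[OF u] U(3,4)[OF w] by (simp add: unitary_op_def)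
        qed
        ultimately have "u \<cdot> w \<in> U" by (simp add: U_def)
        moreover have "T u (\<theta> w \<cdot> w\<^sup>\<dagger>) = \<theta> (u \<cdot> w) \<cdot> (u \<cdot> w)\<^sup>\<dagger>"
          using U(1)[OF u] U(1)[OF w] by (simp add: T_def aut_compose[OF \<theta>] compose_assoc)
        ultimately show "T u (\<theta> w \<cdot> w\<^sup>\<dagger>) \<in> convex hull (\<lambda>u. \<theta> u \<cdot> u\<^sup>\<dagger>) ` U"
          by (auto intro: hull_inc)
      qed
    qed
    thus ?thesis using k by blast
  qed
  have Tle: "norm2 \<tau> (T u k) \<le> norm2 \<tau> k" if u: "u \<in> U" and k: "k \<in> N" for u k
  proof -
    note Uu = U[OF u]
    have "norm2 \<tau> (T u k) \<le> norm (\<theta> u) * norm2 \<tau> (k \<cdot> u\<^sup>\<dagger>)" unfolding T_def using Uu k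
      by (intro norm2_compose_left) auto
    also have "\<dots> \<le> 1 * (norm (u\<^sup>\<dagger>) * norm2 \<tau> k)"
      using Uu k by (intro mult_mono norm2_compose_right norm2_nonneg) auto
    also have "\<dots> \<le> 1 * (1 * norm2 \<tau> k)" using Uu k
      by (intro mult_left_mono mult_right_mono norm2_nonneg) auto
    finally show ?thesis by simp
  qed
  define D where "D = (\<lambda>k. (norm2 \<tau> k)\<^sup>2) ` K"
  define d where "d = Inf D"
  have Dne: "D \<noteq> {}" using Kne by (auto simp: D_def)
  have bdd: "bdd_below D" by (auto simp: D_def bdd_below_def intro!: exI[of _ 0])
  have dle: "d \<le> (norm2 \<tau> k)\<^sup>2" if "k \<in> K" for k
    unfolding d_def by (rule cInf_lower[OF _ bdd]) (use that in \<open>simp add: D_def\<close>)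
  \<comment> \<open>nearly minimal elements are close to each other: their midpoint lies in \<open>K\<close>\<close>
  have near: "(norm2 \<tau> (x - y))\<^sup>2 \<le> 4 * s"
    if "x \<in> K" "y \<in> K" "(norm2 \<tau> x)\<^sup>2 \<le> d + s" "(norm2 \<tau> y)\<^sup>2 \<le> d + s" for x y s
  proof -
    have "(1/2) *\<^sub>R (x + y) \<in> K" using convexD[OF Kconv that(1,2), of "1/2" "1/2"]
      by (simp add: scaleR_add_right)
    from dle[OF this] show ?thesis
      using norm2_parallelogram[OF KN[OF that(1)] KN[OF that(2)]] that(3,4) by linarith
  qed
  have "\<exists>k\<in>K. (norm2 \<tau> k)\<^sup>2 < d + 1 / Suc n" for n
    using cInf_lessD[OF Dne, of "d + 1 / Suc n"] by (auto simp: d_def D_def)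
  then obtain c where c: "\<And>n. c n \<in> K" "\<And>n. (norm2 \<tau> (c n))\<^sup>2 < d + 1 / Suc n" by metis
  have cN: "c n \<in> N" for n by (rule KN[OF c(1)])
  have "\<exists>K. \<forall>m\<ge>K. \<forall>n\<ge>K. norm2 \<tau> (c m - c n) < e" if e: "e > 0" for e
  proof -
    obtain j where j: "1 / real (Suc j) < e\<^sup>2 / 4" using nat_approx_posE[of "e\<^sup>2/4"] e by auto
    have "norm2 \<tau> (c m - c n) < e" if "m \<ge> j" "n \<ge> j" for m n
    proof -
      have "1 / real (Suc m) \<le> 1 / real (Suc j)" "1 / real (Suc n) \<le> 1 / real (Suc j)"
        using that by (auto intro!: divide_left_mono)
      hence "(norm2 \<tau> (c m - c n))\<^sup>2 \<le> 4 * (1 / real (Suc j))"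
        using c(2)[of m] c(2)[of n] by (intro near c) linarith+
      hence "(norm2 \<tau> (c m - c n))\<^sup>2 < e\<^sup>2" using j by linarith
      thus ?thesis by (rule power2_less_imp_less) (use e in simp)
    qed
    thus ?thesis by blast
  qed
  moreover have "norm (c n) \<le> 1" for n using c(1) KC by (auto simp: C_def)
  ultimately obtain v where v: "v \<in> N" "norm v \<le> 1" and lim: "(\<lambda>n. norm2 \<tau> (c n - v)) \<longlonglongrightarrow> 0"
    using unit_ball_norm2_complete[of c] cN by blast
  have "norm2 \<tau> (v - id_blinfun) \<le> 0 + \<epsilon>"
  proof (rule LIMSEQ_le_const)
    show "(\<lambda>n. norm2 \<tau> (c n - v) + \<epsilon>) \<longlonglongrightarrow> 0 + \<epsilon>" by (intro tendsto_add lim tendsto_const)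
    show "\<exists>n0. \<forall>n\<ge>n0. norm2 \<tau> (v - id_blinfun) \<le> norm2 \<tau> (c n - v) + \<epsilon>"
    proof (intro exI allI impI)
      fix n
      have "norm2 \<tau> (c n - id_blinfun) \<le> \<epsilon>" using c(1) KC by (auto simp: C_def)
      thus "norm2 \<tau> (v - id_blinfun) \<le> norm2 \<tau> (c n - v) + \<epsilon>"
        using norm2_triangle3[of v "c n" id_blinfun] norm2_commute[of v "c n"] v cN by simp
    qed
  qed
  moreover have "\<theta> u \<cdot> v = v \<cdot> u" if u: "u \<in> U" for u
  proof -
    note Uu = U[OF u]
    have TN: "T u k \<in> N" if "k \<in> N" for k using that Uu by (simp add: T_def)
    have Tdiff: "T u (k - l) = T u k - T u l" for k l by (simp add: T_def compose_linear)
    have "norm2 \<tau> (v - T u v) \<le> 2 * 0 + sqrt (4 * 0)"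
    proof (rule LIMSEQ_le_const)
      show "(\<lambda>n. 2 * norm2 \<tau> (c n - v) + sqrt (4 * (1 / real (Suc n)))) \<longlonglongrightarrow> 2 * 0 + sqrt (4 * 0)"
        by (intro tendsto_intros lim LIMSEQ_Suc[OF lim_1_over_n])
      show "\<exists>n0. \<forall>n\<ge>n0. norm2 \<tau> (v - T u v) \<le> 2 * norm2 \<tau> (c n - v) + sqrt (4 * (1 / real (Suc n)))"
      proof (intro exI allI impI)
        fix n
        have "(norm2 \<tau> (T u (c n)))\<^sup>2 \<le> (norm2 \<tau> (c n))\<^sup>2"
          using Tle[OF u cN] TN cN by (intro power_mono norm2_nonneg) auto
        hence "(norm2 \<tau> (c n - T u (c n)))\<^sup>2 \<le> 4 * (1 / real (Suc n))"
          using c(2)[of n] by (intro near c TK u) linarith+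
        hence a: "norm2 \<tau> (c n - T u (c n)) \<le> sqrt (4 * (1 / real (Suc n)))" by (rule real_le_rsqrt)
        have b: "norm2 \<tau> (T u (c n) - T u v) \<le> norm2 \<tau> (c n - v)"
          using Tle[OF u, of "c n - v"] cN v by (simp add: Tdiff)
        have "norm2 \<tau> (v - T u v) \<le> norm2 \<tau> (v - c n) + norm2 \<tau> (c n - T u v)"
          using v cN TN by (intro norm2_triangle3) auto
        also have "norm2 \<tau> (c n - T u v) \<le> norm2 \<tau> (c n - T u (c n)) + norm2 \<tau> (T u (c n) - T u v)"
          using v cN TN by (intro norm2_triangle3) auto
        finally show "norm2 \<tau> (v - T u v) \<le> 2 * norm2 \<tau> (c n - v) + sqrt (4 * (1 / real (Suc n)))"
          using a b norm2_commute[OF v(1) cN[of n]] by linarith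
      qed
    qed
    hence "norm2 \<tau> (v - T u v) = 0" using norm2_nonneg[of "v - T u v"] v TN by simp
    hence "v - T u v = 0" by (rule norm2_eq_zero[rotated]) (use v TN in simp)
    hence "v \<cdot> u = T u v \<cdot> u" by simp
    also have "\<dots> = \<theta> u \<cdot> (v \<cdot> (u\<^sup>\<dagger> \<cdot> u))" by (simp add: T_def compose_assoc)
    finally show ?thesis by (simp add: Uu)
  qed
  hence "\<theta> x \<cdot> v = v \<cdot> x" if "x \<in> P" for x
    by (rule intertwines_of_unitaries[OF P \<theta> v(1) _ that]) (simp add: U_def)
  ultimately show ?thesis using v by auto
qed

end

section \<open>Intertwiners of a deformation\<close>

locale deformation =
  fixes M N :: "'h::complex_hilbert_space operator set" and \<tau>\<^sub>M \<tau> :: "'h operator \<Rightarrow> complex"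
    and \<alpha> :: "real \<Rightarrow> 'h operator \<Rightarrow> 'h operator" and \<beta> :: "'h operator \<Rightarrow> 'h operator"
  assumes inclusion: "tracial_inclusion M \<tau>\<^sub>M N \<tau>"
    and malleable: "s_malleable_deformation M N \<tau> \<alpha> \<beta>"
begin

sublocale tracial_algebra N \<tau>
  using inclusion by unfold_locales (simp add: tracial_inclusion_def)

lemma M_vna: "von_neumann_algebra M" and M_subset: "M \<subseteq> N"
  using inclusion by (auto simp: tracial_inclusion_def tracial_von_neumann_algebra_def)

lemma M_N [simp]: "x \<in> M \<Longrightarrow> x \<in> N"
  using M_subset by blast

lemma alpha_Aut: "\<alpha> t \<in> tracial_Aut N \<tau>" and beta_Aut: "\<beta> \<in> tracial_Aut N \<tau>"
  using malleable by (auto simp: s_malleable_deformation_def)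

lemmas alpha = aut_mem[OF alpha_Aut] aut_compose[OF alpha_Aut] aut_adj[OF alpha_Aut]
  aut_add[OF alpha_Aut] aut_diff[OF alpha_Aut] aut_scaleC[OF alpha_Aut] aut_tau[OF alpha_Aut]
  aut_id[OF alpha_Aut] aut_zero[OF alpha_Aut]
lemmas beta = aut_mem[OF beta_Aut] aut_compose[OF beta_Aut] aut_adj[OF beta_Aut]
  aut_add[OF beta_Aut] aut_diff[OF beta_Aut] aut_scaleC[OF beta_Aut] aut_tau[OF beta_Aut]
  aut_id[OF beta_Aut] aut_zero[OF beta_Aut]
declare alpha [simp] beta [simp]

lemma
  assumes "x \<in> N"
  shows alpha_add: "\<alpha> (s + t) x = \<alpha> s (\<alpha> t x)"
    and beta_alpha: "\<beta> (\<alpha> t x) = \<alpha> (- t) (\<beta> x)"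
  using assms malleable by (auto simp: s_malleable_deformation_def)

lemma beta_M [simp]: "x \<in> M \<Longrightarrow> \<beta> x = x"
  using malleable by (auto simp: s_malleable_deformation_def)

lemma alpha_0 [simp]:
  assumes x: "x \<in> N" shows "\<alpha> 0 x = x"
proof (rule aut_inj[OF alpha_Aut])
  show "\<alpha> 0 (\<alpha> 0 x) = \<alpha> 0 x" using alpha_add[OF x, of 0 0, symmetric] by simp
qed (use x in simp_all)

lemma alpha_inverse [simp]:
  "x \<in> N \<Longrightarrow> \<alpha> (- t) (\<alpha> t x) = x" "x \<in> N \<Longrightarrow> \<alpha> t (\<alpha> (- t) x) = x"
  using alpha_add[of x "- t" t] alpha_add[of x t "- t"] by simp_all

definition intertwiners :: "real \<Rightarrow> 'h operator set \<Rightarrow> 'h operator set" where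
  "intertwiners t P = {w \<in> N. \<forall>x\<in>P. \<alpha> t x \<cdot> w = w \<cdot> x}"

lemma intertwiners_N [simp]: "w \<in> intertwiners t P \<Longrightarrow> w \<in> N"
  by (simp add: intertwiners_def)

lemma intertwinersD: "w \<in> intertwiners t P \<Longrightarrow> x \<in> P \<Longrightarrow> \<alpha> t x \<cdot> w = w \<cdot> x"
  unfolding intertwiners_def by blast

lemma intertwiners_antimono: "Q \<subseteq> P \<Longrightarrow> intertwiners t P \<subseteq> intertwiners t Q"
  unfolding intertwiners_def by blast

lemma intertwiners_adjointD:
  assumes P: "von_neumann_algebra P" "P \<subseteq> N" and w: "w \<in> intertwiners t P" and x: "x \<in> P"
  shows "w\<^sup>\<dagger> \<cdot> \<alpha> t x = x \<cdot> w\<^sup>\<dagger>"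
proof -
  have xN: "x \<in> N" using P x by blast
  have "(\<alpha> t (x\<^sup>\<dagger>) \<cdot> w)\<^sup>\<dagger> = (w \<cdot> x\<^sup>\<dagger>)\<^sup>\<dagger>" using intertwinersD[OF w vna_adj[OF P(1) x]] by simp
  thus ?thesis using xN intertwiners_N[OF w] by simp
qed

text \<open>
  Reversing the direction of the flow: together with \<open>intertwiners_beta\<close> this describes
  \<open>intertwiners (- t) P\<close> in two ways, and comparing the two is how \<open>\<beta>\<close> enters the proof.
\<close>

lemma intertwiners_adjoint:
  assumes P: "von_neumann_algebra P" "P \<subseteq> N" and w: "w \<in> intertwiners t P"
  shows "\<alpha> (- t) (w\<^sup>\<dagger>) \<in> intertwiners (- t) P"
  unfolding intertwiners_def mem_Collect_eq
proof (intro conjI ballI)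
  have wN: "w \<in> N" using w by simp
  thus "\<alpha> (- t) (w\<^sup>\<dagger>) \<in> N" by simp
  fix x assume x: "x \<in> P"
  hence xN: "x \<in> N" using P by blast
  have "\<alpha> (- t) (w\<^sup>\<dagger> \<cdot> \<alpha> t x) = \<alpha> (- t) (x \<cdot> w\<^sup>\<dagger>)" by (simp only: intertwiners_adjointD[OF P w x])
  thus "\<alpha> (- t) x \<cdot> \<alpha> (- t) (w\<^sup>\<dagger>) = \<alpha> (- t) (w\<^sup>\<dagger>) \<cdot> x" using wN xN by simp
qed

lemma intertwiners_beta:
  assumes P: "P \<subseteq> M" and w: "w \<in> intertwiners t P"
  shows "\<beta> w \<in> intertwiners (- t) P"
  unfolding intertwiners_def mem_Collect_eq
proof (intro conjI ballI)
  have wN: "w \<in> N" using w by simp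
  thus "\<beta> w \<in> N" by simp
  fix x assume x: "x \<in> P"
  hence xM: "x \<in> M" using P by blast
  have "\<beta> (\<alpha> t x \<cdot> w) = \<beta> (w \<cdot> x)" using intertwinersD[OF w x] by simp
  thus "\<alpha> (- t) x \<cdot> \<beta> w = \<beta> w \<cdot> x" using wN xM by (simp add: beta_alpha)
qed

text \<open>
  The cocycle identity, which carries information from small to large times.
\<close>

lemma intertwiners_compose:
  assumes P: "P \<subseteq> N" and w': "w' \<in> intertwiners t P" and w: "w \<in> intertwiners s P"
  shows "\<alpha> s w' \<cdot> w \<in> intertwiners (s + t) P"
  unfolding intertwiners_def mem_Collect_eq
proof (intro conjI ballI)
  have N: "w' \<in> N" "w \<in> N" using w w' by simp_all
  thus "\<alpha> s w' \<cdot> w \<in> N" by simp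
  fix x assume x: "x \<in> P"
  hence xN: "x \<in> N" using P by blast
  have "\<alpha> (s + t) x \<cdot> (\<alpha> s w' \<cdot> w) = \<alpha> s (\<alpha> t x \<cdot> w') \<cdot> w"
    using N xN by (simp add: alpha_add compose_assoc)
  also have "\<dots> = \<alpha> s (w' \<cdot> x) \<cdot> w" using intertwinersD[OF w' x] by simp
  also have "\<dots> = \<alpha> s w' \<cdot> (\<alpha> s x \<cdot> w)" using N xN by (simp add: compose_assoc)
  also have "\<dots> = \<alpha> s w' \<cdot> w \<cdot> x" using intertwinersD[OF w x] by (simp add: compose_assoc)
  finally show "\<alpha> (s + t) x \<cdot> (\<alpha> s w' \<cdot> w) = \<alpha> s w' \<cdot> w \<cdot> x" .
qed

text \<open>
  The bridge from intertwiners to \<open>M\<close>: the theorem assumes that the relative commutant of \<open>Q\<close> lies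
  in \<open>M\<close>, where \<open>\<beta>\<close> acts trivially.
\<close>

lemma intertwiners_inner:
  assumes P: "von_neumann_algebra P" "P \<subseteq> N" and v: "v \<in> intertwiners t P" and w: "w \<in> intertwiners t P"
  shows "v\<^sup>\<dagger> \<cdot> w \<in> commutant P \<inter> N"
proof -
  have N: "v \<in> N" "w \<in> N" using w v by simp_all
  have "v\<^sup>\<dagger> \<cdot> w \<cdot> x = x \<cdot> (v\<^sup>\<dagger> \<cdot> w)" if x: "x \<in> P" for x
  proof -
    have "v\<^sup>\<dagger> \<cdot> w \<cdot> x = v\<^sup>\<dagger> \<cdot> \<alpha> t x \<cdot> w" using intertwinersD[OF w x] by (simp add: compose_assoc)
    thus ?thesis by (simp add: intertwiners_adjointD[OF P v x] compose_assoc)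
  qed
  thus ?thesis using N by (simp add: commutant_def bounded_ops_compose bounded_ops_adj)
qed

lemma intertwiners_times_commutant:
  assumes "w \<in> intertwiners t P" "b \<in> commutant P \<inter> N"
  shows "w \<cdot> b \<in> intertwiners t P"
  unfolding intertwiners_def mem_Collect_eq
proof (intro conjI ballI)
  show "w \<cdot> b \<in> N" using assms by simp
  fix x assume x: "x \<in> P"
  have "b \<cdot> x = x \<cdot> b" using assms(2) x by (auto simp: commutant_def)
  thus "\<alpha> t x \<cdot> (w \<cdot> b) = w \<cdot> b \<cdot> x"
    using intertwinersD[OF assms(1) x] by (metis compose_assoc)
qed

lemma RigD:
  assumes "P \<in> Rig M \<tau> \<alpha>"
  shows "von_neumann_algebra P" "P \<subseteq> M" "P \<subseteq> N" "((\<lambda>t. rigidity_defect \<tau> \<alpha> t P) \<longlongrightarrow> 0) (at 0)"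
  using assms M_subset by (auto simp: Rig_def)

lemma norm2_le_rigidity_defect:
  assumes P: "P \<subseteq> N" and x: "x \<in> P" "norm x \<le> 1"
  shows "norm2 \<tau> (\<alpha> t x - x) \<le> rigidity_defect \<tau> \<alpha> t P"
  unfolding rigidity_defect_def
proof (rule cSUP_upper)
  show "bdd_above ((\<lambda>x. norm2 \<tau> (\<alpha> t x - x)) ` {x \<in> P. norm x \<le> 1})"
  proof (rule bdd_aboveI2)
    fix x assume x: "x \<in> {x \<in> P. norm x \<le> 1}"
    hence xN: "x \<in> N" using P by blast
    have "norm2 \<tau> (\<alpha> t x - x) \<le> norm2 \<tau> (\<alpha> t x) + norm2 \<tau> x"
      using norm2_triangle[of "\<alpha> t x" "- x"] xN by (simp add: norm2_minus)
    also have "\<dots> = 2 * norm2 \<tau> x" using xN by (simp add: norm2_aut[OF alpha_Aut])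
    also have "\<dots> \<le> 2" using norm2_le_norm[OF xN] x by simp
    finally show "norm2 \<tau> (\<alpha> t x - x) \<le> 2" .
  qed
qed (use x in simp)

lemma exists_rigid_intertwiner:
  assumes P: "von_neumann_algebra P" "P \<subseteq> N"
  shows "\<exists>v\<in>intertwiners t P. norm v \<le> 1 \<and> norm2 \<tau> (v - id_blinfun) \<le> rigidity_defect \<tau> \<alpha> t P"
proof -
  have "norm2 \<tau> (\<alpha> t u - u) \<le> rigidity_defect \<tau> \<alpha> t P" if u: "u \<in> P" "unitary_op u" for u
    using P u by (intro norm2_le_rigidity_defect[OF P(2)] norm_isometry_le_one)
      (auto simp: unitary_op_def)
  from exists_intertwiner[OF P alpha_Aut this]
  show ?thesis unfolding intertwiners_def by blast
qed

section \<open>Intertwiners of a rigid subalgebra have full support\<close>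

text \<open>
  Let \<open>q t\<close> be the projection onto the joint kernel of \<open>intertwiners t P\<close>. It commutes with \<open>P\<close> and
  therefore with \<open>Q\<close>, so it lies in \<open>M\<close> and is fixed by \<open>\<beta>\<close>. Since \<open>\<beta>\<close> maps intertwiners at time
  \<open>- t\<close> to intertwiners at time \<open>t\<close>, those at time \<open>- t\<close> also vanish on \<open>q t\<close>; taking adjoints,
  \<open>\<alpha> t (q t)\<close> annihilates the ranges of the intertwiners at time \<open>t\<close>. Products of intertwiners then
  show that \<open>q (n s)\<close> is a subprojection of \<open>q s\<close>. An intertwiner at time \<open>s\<close> near the identity vanishes
  on \<open>q s\<close>, so the trace norm of \<open>q s\<close> is at most the rigidity defect, which tends to \<open>0\<close>; with
  \<open>s = t / n\<close> this forces \<open>q t = 0\<close>.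
\<close>

lemma intertwiners_nondegenerate:
  assumes PR: "P \<in> Rig M \<tau> \<alpha>" and QP: "Q \<subseteq> P" and QM: "commutant Q \<inter> N \<subseteq> M"
    and y: "y \<in> N" "\<And>w. w \<in> intertwiners t P \<Longrightarrow> w \<cdot> y = 0"
  shows "y = 0"
proof -
  note P = RigD(1,3)[OF PR]
  have "\<exists>q. q \<in> N \<and> q\<^sup>\<dagger> = q \<and> q \<cdot> q = q \<and> (\<forall>w\<in>intertwiners t P. w \<cdot> q = 0) \<and>
      (\<forall>y\<in>N. (\<forall>w\<in>intertwiners t P. w \<cdot> y = 0) \<longrightarrow> q \<cdot> y = y)" for t
  proof -
    have "intertwiners t P \<subseteq> N" by auto
    from kernel_projection[OF vna this] obtain q where q: "q \<in> N" "q\<^sup>\<dagger> = q" "q \<cdot> q = q"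
      "\<forall>w\<in>intertwiners t P. w \<cdot> q = 0"
      "\<And>\<eta>. (\<forall>w\<in>intertwiners t P. w \<rhd> \<eta> = 0) \<Longrightarrow> q \<rhd> \<eta> = \<eta>" by blast
    have "q \<cdot> y = y" if wy: "\<forall>w\<in>intertwiners t P. w \<cdot> y = 0" for y
    proof (rule blinfun_eqI)
      fix \<xi>
      have "w \<rhd> y \<rhd> \<xi> = 0" if "w \<in> intertwiners t P" for w
        using wy that by (metis blinfun_apply_blinfun_compose blinfun.zero_left)
      thus "(q \<cdot> y) \<rhd> \<xi> = y \<rhd> \<xi>" using q(5) by simp
    qed
    thus ?thesis using q by blast
  qed
  then obtain q where q: "\<And>t. q t \<in> N" "\<And>t. (q t)\<^sup>\<dagger> = q t" "\<And>t. q t \<cdot> q t = q t"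
    and kill: "\<And>t w. w \<in> intertwiners t P \<Longrightarrow> w \<cdot> q t = 0"
    and fix_q: "\<And>t y. y \<in> N \<Longrightarrow> (\<And>w. w \<in> intertwiners t P \<Longrightarrow> w \<cdot> y = 0) \<Longrightarrow> q t \<cdot> y = y"
    by metis
  have nq: "norm (q t) \<le> 1" for t by (rule norm_projection_le_one) (use q in auto)
  have qM: "q t \<in> M" for t
  proof -
    \<comment> \<open>\<open>P\<close> preserves the joint kernel, since an intertwiner can be moved past elements of \<open>P\<close>\<close>
    have half: "q t \<cdot> (x \<cdot> q t) = x \<cdot> q t" if x: "x \<in> P" for x
    proof (rule fix_q)
      show "x \<cdot> q t \<in> N" using x P q by auto
      fix w assume w: "w \<in> intertwiners t P"
      have "w \<cdot> (x \<cdot> q t) = \<alpha> t x \<cdot> (w \<cdot> q t)"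
        using intertwinersD[OF w x] by (metis compose_assoc)
      thus "w \<cdot> (x \<cdot> q t) = 0" by (simp add: kill[OF w])
    qed
    have "q t \<cdot> x = x \<cdot> q t" if x: "x \<in> P" for x
    proof -
      have xN: "x \<in> N" using x P by blast
      have "(q t \<cdot> (x\<^sup>\<dagger> \<cdot> q t))\<^sup>\<dagger> = (x\<^sup>\<dagger> \<cdot> q t)\<^sup>\<dagger>" by (simp only: half[OF vna_adj[OF P(1) x]])
      hence "q t \<cdot> x \<cdot> q t = q t \<cdot> x" using xN q by (simp add: compose_assoc)
      thus ?thesis using half[OF x] by (simp add: compose_assoc)
    qed
    hence "q t \<in> commutant P" using q by (simp add: commutant_def)
    thus ?thesis using commutant_antimono[OF QP] QM q by blast
  qed
  have kill_neg: "w \<cdot> q t = 0" if w: "w \<in> intertwiners (- t) P" for t w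
  proof -
    have wN: "w \<in> N" using w by simp
    have "\<beta> w \<cdot> q t = 0" using intertwiners_beta[OF RigD(2)[OF PR] w] by (intro kill) simp
    hence "\<beta> (\<beta> w \<cdot> q t) = 0" by simp
    thus ?thesis using wN q qM malleable by (simp add: s_malleable_deformation_def)
  qed
  have kill_left: "\<alpha> t (q t) \<cdot> w = 0" if w: "w \<in> intertwiners t P" for t w
  proof -
    have wN: "w \<in> N" using w by simp
    have "\<alpha> (- t) (w\<^sup>\<dagger>) \<cdot> q t = 0" by (rule kill_neg[OF intertwiners_adjoint[OF P w]])
    hence "\<alpha> t (\<alpha> (- t) (w\<^sup>\<dagger>) \<cdot> q t) = 0" by simp
    hence "w\<^sup>\<dagger> \<cdot> \<alpha> t (q t) = 0" using wN q by simp
    hence "(w\<^sup>\<dagger> \<cdot> \<alpha> t (q t))\<^sup>\<dagger> = 0" using adj_diff[of 0 0] by simp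
    thus ?thesis using wN q by (simp add: alpha(3)[symmetric])
  qed
  \<comment> \<open>if \<open>q t \<le> q s\<close>, then \<open>q (s + t) \<le> q s\<close>: intertwiners at time \<open>s + t\<close> factor through both times\<close>
  have step: "q s \<cdot> q (s + t) = q (s + t)" if qq: "q s \<cdot> q t = q t" for s t
  proof (rule fix_q[OF q(1)])
    fix w assume w: "w \<in> intertwiners s P"
    have wN: "w \<in> N" using w by simp
    define y where "y = w \<cdot> q (s + t)"
    have yN: "y \<in> N" using wN q by (simp add: y_def)
    have "q t \<cdot> \<alpha> (- s) y = \<alpha> (- s) y"
    proof (rule fix_q)
      show "\<alpha> (- s) y \<in> N" using yN by simp
      fix w' assume w': "w' \<in> intertwiners t P"
      have w'N: "w' \<in> N" using w' by simp
      have "\<alpha> s w' \<cdot> w \<cdot> q (s + t) = 0" by (rule kill[OF intertwiners_compose[OF P(2) w' w]])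
      hence "\<alpha> (- s) (\<alpha> s w' \<cdot> y) = 0" by (simp add: y_def compose_assoc)
      thus "w' \<cdot> \<alpha> (- s) y = 0" using w'N yN by simp
    qed
    hence "\<alpha> s (q t \<cdot> \<alpha> (- s) y) = \<alpha> s (\<alpha> (- s) y)" by simp
    hence y_fixed: "\<alpha> s (q t) \<cdot> y = y" using q yN by simp
    have "q t \<cdot> q s = q t"
      using arg_cong[OF qq, of op_adj] q by simp
    hence "\<alpha> s (q t) \<cdot> \<alpha> s (q s) = \<alpha> s (q t)" using alpha(2)[of "q t" "q s" s] q by simp
    hence "\<alpha> s (q t) \<cdot> y = \<alpha> s (q t) \<cdot> \<alpha> s (q s) \<cdot> y" by simp
    also have "\<dots> = \<alpha> s (q t) \<cdot> (\<alpha> s (q s) \<cdot> w) \<cdot> q (s + t)"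
      by (simp only: y_def compose_assoc)
    finally have "\<alpha> s (q t) \<cdot> y = 0" by (simp add: kill_left[OF w])
    thus "w \<cdot> q (s + t) = 0" using y_fixed by (simp add: y_def)
  qed
  have multiple: "q s \<cdot> q (real (Suc n) * s) = q (real (Suc n) * s)" for n s
  proof (induction n)
    case 0 show ?case using q by simp
  next
    case (Suc n)
    have "real (Suc (Suc n)) * s = s + real (Suc n) * s" by (simp add: algebra_simps)
    thus ?case using step[OF Suc] by simp
  qed
  have small: "norm2 \<tau> (q s) \<le> rigidity_defect \<tau> \<alpha> s P" for s
  proof -
    obtain v where v: "v \<in> intertwiners s P" "norm2 \<tau> (v - id_blinfun) \<le> rigidity_defect \<tau> \<alpha> s P"
      using exists_rigid_intertwiner[OF P] by blast
    have vN: "v \<in> N" using v by simp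
    have "(v - id_blinfun) \<cdot> q s = - q s" by (simp add: compose_linear kill[OF v(1)])
    hence "norm2 \<tau> (q s) = norm2 \<tau> ((v - id_blinfun) \<cdot> q s)" using q by (simp add: norm2_minus)
    also have "\<dots> \<le> norm (q s) * norm2 \<tau> (v - id_blinfun)" using q vN
      by (intro norm2_compose_right) auto
    also have "\<dots> \<le> 1 * norm2 \<tau> (v - id_blinfun)" using nq vN
      by (intro mult_right_mono norm2_nonneg) auto
    finally show ?thesis using v by simp
  qed
  have "q t = 0" for t
  proof (cases "t = 0")
    case True
    have "id_blinfun \<in> intertwiners 0 P" unfolding intertwiners_def using P by auto
    from kill[OF this] show ?thesis by (simp add: True)
  next
    case False
    have bound: "norm2 \<tau> (q t) \<le> rigidity_defect \<tau> \<alpha> (t / real (Suc n)) P" for n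
    proof -
      have "q t = q (t / real (Suc n)) \<cdot> q t" using multiple[of "t / real (Suc n)" n] by simp
      hence "norm2 \<tau> (q t) = norm2 \<tau> (q (t / real (Suc n)) \<cdot> q t)" by simp
      also have "\<dots> \<le> norm (q t) * norm2 \<tau> (q (t / real (Suc n)))" using q
        by (intro norm2_compose_right)
      also have "\<dots> \<le> 1 * norm2 \<tau> (q (t / real (Suc n)))" using nq q
        by (intro mult_right_mono norm2_nonneg)
      finally show ?thesis using small[of "t / real (Suc n)"] by simp
    qed
    have "(\<lambda>n. t * (1 / real (Suc n))) \<longlonglongrightarrow> t * 0"
      by (intro tendsto_mult tendsto_const LIMSEQ_Suc[OF lim_1_over_n])
    hence "filterlim (\<lambda>n. t / real (Suc n)) (at 0) sequentially"
      using False by (intro filterlim_atI) auto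
    from filterlim_compose[OF RigD(4)[OF PR] this]
    have "(\<lambda>n. rigidity_defect \<tau> \<alpha> (t / real (Suc n)) P) \<longlonglongrightarrow> 0" .
    hence "norm2 \<tau> (q t) \<le> 0" by (rule LIMSEQ_le_const) (use bound in blast)
    hence "norm2 \<tau> (q t) = 0" using norm2_nonneg[OF q(1)] by (simp add: order_antisym)
    thus ?thesis using norm2_eq_zero q by blast
  qed
  thus "y = 0" using fix_q[OF y] by simp
qed

text \<open>
  The products of intertwiners with adjoints of intertwiners are closed under multiplication because
  \<open>w'\<^sup>\<dagger> v\<close> commutes with \<open>P\<close>. Nondegeneracy at time \<open>- t\<close> is full support of the ranges at time \<open>t\<close>.
\<close>

lemma tau_test_on_intertwiners:
  assumes PR: "P \<in> Rig M \<tau> \<alpha>" and QP: "Q \<subseteq> P" and QM: "commutant Q \<inter> N \<subseteq> M"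
    and g: "g \<in> N" "\<And>w w'. w \<in> intertwiners t P \<Longrightarrow> w' \<in> intertwiners t P \<Longrightarrow> \<tau> (g \<cdot> (w \<cdot> w'\<^sup>\<dagger>)) = 0"
  shows "\<tau> g = 0"
proof -
  note P = RigD(1,3)[OF PR]
  define S where "S = {w \<cdot> w'\<^sup>\<dagger> | w w'. w \<in> intertwiners t P \<and> w' \<in> intertwiners t P}"
  have SI: "w \<cdot> w'\<^sup>\<dagger> \<in> S" if "w \<in> intertwiners t P" "w' \<in> intertwiners t P" for w w'
    using that by (auto simp: S_def)
  show ?thesis
  proof (rule tau_vanishes_of_nondegenerate[where S=S])
    show "S \<subseteq> N" by (auto simp: S_def)
    fix a assume "a \<in> S"
    then obtain w w' where a: "a = w \<cdot> w'\<^sup>\<dagger>" "w \<in> intertwiners t P" "w' \<in> intertwiners t P"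
      by (auto simp: S_def)
    have N: "w \<in> N" "w' \<in> N" using a by auto
    show "op_scaleC c a \<in> S" for c
    proof -
      have "op_scaleC c w \<in> intertwiners t P"
        unfolding intertwiners_def mem_Collect_eq
      proof (intro conjI ballI)
        show "op_scaleC c w \<in> N" using N by simp
        fix x assume x: "x \<in> P"
        hence "x \<in> N" using P by blast
        thus "\<alpha> t x \<cdot> op_scaleC c w = op_scaleC c w \<cdot> x"
          using intertwinersD[OF a(2) x]
            by (simp add: op_scaleC_compose_left op_scaleC_compose_right)
      qed
      from SI[OF this a(3)] show ?thesis by (simp add: a op_scaleC_compose_left)
    qed
    show "a\<^sup>\<dagger> \<in> S" using SI[OF a(3,2)] N by (simp add: a)
    show "a \<cdot> b \<in> S" if b: "b \<in> S" for b
    proof -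
      obtain v v' where b: "b = v \<cdot> v'\<^sup>\<dagger>" "v \<in> intertwiners t P" "v' \<in> intertwiners t P" using b
        by (auto simp: S_def)
      have "w \<cdot> (w'\<^sup>\<dagger> \<cdot> v) \<in> intertwiners t P"
        by (rule intertwiners_times_commutant[OF a(2) intertwiners_inner[OF P a(3) b(2)]])
      from SI[OF this b(3)] show ?thesis by (simp add: a b compose_assoc)
    qed
    show "\<tau> (g \<cdot> a) = 0" using g(2)[OF a(2,3)] by (simp add: a)
  next
    fix y assume y: "y \<in> N" "\<And>a. a \<in> S \<Longrightarrow> a \<cdot> y = 0"
    have wy: "w\<^sup>\<dagger> \<cdot> y = 0" if w: "w \<in> intertwiners t P" for w
    proof (rule tau_faithful)
      have wN: "w \<in> N" using w by simp
      thus "w\<^sup>\<dagger> \<cdot> y \<in> N" using y by simp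
      have "(w\<^sup>\<dagger> \<cdot> y)\<^sup>\<dagger> \<cdot> (w\<^sup>\<dagger> \<cdot> y) = y\<^sup>\<dagger> \<cdot> (w \<cdot> w\<^sup>\<dagger> \<cdot> y)" using wN y by (simp add: compose_assoc)
      thus "\<tau> ((w\<^sup>\<dagger> \<cdot> y)\<^sup>\<dagger> \<cdot> (w\<^sup>\<dagger> \<cdot> y)) = 0" by (simp add: y(2)[OF SI[OF w w]] tau_zero)
    qed
    have "\<alpha> (- t) y = 0"
    proof (rule intertwiners_nondegenerate[OF PR QP QM, of _ "- t"])
      show "\<alpha> (- t) y \<in> N" using y by simp
      fix w assume w: "w \<in> intertwiners (- t) P"
      have wN: "w \<in> N" using w by simp
      have "\<alpha> t (w\<^sup>\<dagger>) \<in> intertwiners t P" using intertwiners_adjoint[OF P w] by simp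
      from wy[OF this] have "\<alpha> t w \<cdot> y = 0" using wN by simp
      hence "\<alpha> (- t) (\<alpha> t w \<cdot> y) = 0" by simp
      thus "w \<cdot> \<alpha> (- t) y = 0" using wN y by simp
    qed
    thus "y = 0" using aut_inj[OF alpha_Aut y(1) closed_ops(2), of "- t"] by simp
  qed (use g in auto)
qed

section \<open>The largest rigid extension\<close>

text \<open>
  Being fixed by \<open>\<beta>\<close> becomes a family of linear conditions of the form \<open>\<tau>(g d) = 0\<close>, to which the density
  statements for the trace apply. For the converse take \<open>y\<close> to be the adjoint of \<open>\<beta> d - d\<close>.
\<close>

lemma beta_fixed_iff:
  assumes d: "d \<in> N"
  shows "\<beta> d = d \<longleftrightarrow> (\<forall>y\<in>N. \<tau> ((\<beta> y - y) \<cdot> d) = 0)"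
proof
  assume *: "\<beta> d = d"
  show "\<forall>y\<in>N. \<tau> ((\<beta> y - y) \<cdot> d) = 0"
  proof
    fix y assume y: "y \<in> N"
    have "\<tau> (\<beta> y \<cdot> d) = \<tau> (\<beta> (y \<cdot> d))" using y d by (simp add: * del: beta(7))
    also have "\<dots> = \<tau> (y \<cdot> d)" using y d by (intro beta(7)) auto
    finally show "\<tau> ((\<beta> y - y) \<cdot> d) = 0" using y d by (simp add: compose_linear tau_diff)
  qed
next
  assume *: "\<forall>y\<in>N. \<tau> ((\<beta> y - y) \<cdot> d) = 0"
  define z where "z = \<beta> d - d"
  have zN: "z \<in> N" using d by (simp add: z_def)
  have bb: "\<beta> (\<beta> x) = x" if "x \<in> N" for x using that malleable
    by (simp add: s_malleable_deformation_def)
  have "\<tau> (z\<^sup>\<dagger> \<cdot> \<beta> d) = \<tau> (\<beta> (z\<^sup>\<dagger> \<cdot> \<beta> d))" using zN d by (intro beta(7)[symmetric]) auto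
  also have "\<dots> = \<tau> (\<beta> (z\<^sup>\<dagger>) \<cdot> d)" using zN d by (simp only: beta(1,2) closed_ops bb)
  finally have "\<tau> (z\<^sup>\<dagger> \<cdot> z) = \<tau> ((\<beta> (z\<^sup>\<dagger>) - z\<^sup>\<dagger>) \<cdot> d)"
    using zN d by (subst (2) z_def) (simp add: compose_linear tau_diff del: beta(3))
  also have "\<dots> = 0" using * closed_ops(3)[OF zN] by blast
  finally have "\<tau> (z\<^sup>\<dagger> \<cdot> z) = 0" .
  hence "z = 0" using zN tau_faithful by blast
  thus "\<beta> d = d" by (simp add: z_def)
qed

text \<open>
  If \<open>intertwiners t Q\<close> were \<open>u (Q' \<inter> N)\<close> for a unitary \<open>u\<close>, and \<open>M\<close> were the fixed-point algebra of \<open>\<beta>\<close>,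
  then the condition at time \<open>t\<close> would say that \<open>\<alpha> t x\<close> lies in \<open>u M u\<^sup>\<dagger>\<close>. The arbitrary pairs \<open>v, w\<close> replace
  the unitary, and \<open>\<beta>\<close>-invariance replaces membership in \<open>M\<close>: it is preserved by limits in trace norm
  and is detected by functionals \<open>x \<mapsto> \<tau>(g x)\<close>.
\<close>

definition rigid_envelope :: "'h operator set \<Rightarrow> 'h operator set" where
  "rigid_envelope Q = {x \<in> M. \<forall>t. \<forall>v\<in>intertwiners t Q. \<forall>w\<in>intertwiners t Q.
     \<beta> (v\<^sup>\<dagger> \<cdot> (\<alpha> t x \<cdot> w)) = v\<^sup>\<dagger> \<cdot> (\<alpha> t x \<cdot> w)}"

lemma rigid_envelopeD:
  "x \<in> rigid_envelope Q \<Longrightarrow> v \<in> intertwiners t Q \<Longrightarrow> w \<in> intertwiners t Q \<Longrightarrow>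
    \<beta> (v\<^sup>\<dagger> \<cdot> (\<alpha> t x \<cdot> w)) = v\<^sup>\<dagger> \<cdot> (\<alpha> t x \<cdot> w)"
  unfolding rigid_envelope_def by blast

text \<open>
  By full support, the elements \<open>u u'\<^sup>\<dagger>\<close> generate an approximate identity; it is inserted between \<open>a\<close>
  and \<open>b\<close> under the trace, after the cyclic rearrangement \<open>\<tau>(g a b) = \<tau>(b g a)\<close>.
\<close>

lemma beta_fixed_of_insertion:
  assumes PR: "P \<in> Rig M \<tau> \<alpha>" and QP: "Q \<subseteq> P" and QM: "commutant Q \<inter> N \<subseteq> M"
    and N: "a \<in> N" "b \<in> N"
    and ins: "\<And>u u'. u \<in> intertwiners t P \<Longrightarrow> u' \<in> intertwiners t P \<Longrightarrow>
        \<beta> (a \<cdot> u \<cdot> (u'\<^sup>\<dagger> \<cdot> b)) = a \<cdot> u \<cdot> (u'\<^sup>\<dagger> \<cdot> b)"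
  shows "\<beta> (a \<cdot> b) = a \<cdot> b"
proof -
  have "\<tau> ((\<beta> y - y) \<cdot> (a \<cdot> b)) = 0" if y: "y \<in> N" for y
  proof -
    define g where "g = \<beta> y - y"
    have gN: "g \<in> N" using y by (simp add: g_def)
    have "\<tau> (b \<cdot> (g \<cdot> a)) = 0"
    proof (rule tau_test_on_intertwiners[OF PR QP QM])
      show "b \<cdot> (g \<cdot> a) \<in> N" using N gN by simp
      fix u u' assume u: "u \<in> intertwiners t P" "u' \<in> intertwiners t P"
      have uN: "u \<in> N" "u' \<in> N" using u by auto
      have "\<tau> (b \<cdot> (g \<cdot> a) \<cdot> (u \<cdot> u'\<^sup>\<dagger>)) = \<tau> (b \<cdot> (g \<cdot> (a \<cdot> (u \<cdot> u'\<^sup>\<dagger>))))"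
        by (simp add: compose_assoc)
      also have "\<dots> = \<tau> (g \<cdot> (a \<cdot> (u \<cdot> u'\<^sup>\<dagger>)) \<cdot> b)" using N gN uN by (intro tau_commute) auto
      also have "\<dots> = \<tau> (g \<cdot> (a \<cdot> u \<cdot> (u'\<^sup>\<dagger> \<cdot> b)))" by (simp add: compose_assoc)
      also have "\<dots> = 0" using beta_fixed_iff[of "a \<cdot> u \<cdot> (u'\<^sup>\<dagger> \<cdot> b)"] ins[OF u] N uN y
        unfolding g_def by simp
      finally show "\<tau> (b \<cdot> (g \<cdot> a) \<cdot> (u \<cdot> u'\<^sup>\<dagger>)) = 0" .
    qed
    also have "\<tau> (b \<cdot> (g \<cdot> a)) = \<tau> (g \<cdot> a \<cdot> b)" using N gN by (intro tau_commute) auto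
    finally show ?thesis by (simp add: g_def compose_assoc)
  qed
  thus ?thesis using beta_fixed_iff[of "a \<cdot> b"] N by simp
qed

text \<open>
  An element \<open>x\<close> of \<open>P\<close> can be moved through an intertwiner of \<open>P\<close>, which turns the inserted expression
  into a product of three elements of \<open>M\<close>.
\<close>

lemma rigid_subset_envelope:
  assumes PR: "P \<in> Rig M \<tau> \<alpha>" and Q: "von_neumann_algebra Q" and QP: "Q \<subseteq> P" and QM: "commutant Q \<inter> N \<subseteq> M"
  shows "P \<subseteq> rigid_envelope Q"
proof
  fix x assume x: "x \<in> P"
  note P = RigD(1,2,3)[OF PR]
  have QN: "Q \<subseteq> N" using QP P by blast
  have xM: "x \<in> M" using x P by blast
  show "x \<in> rigid_envelope Q"
    unfolding rigid_envelope_def mem_Collect_eq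
  proof (intro conjI allI ballI xM)
    fix t v w assume v: "v \<in> intertwiners t Q" and w: "w \<in> intertwiners t Q"
    have vN: "v \<in> N" "w \<in> N" using v w by auto
    have "\<beta> (v\<^sup>\<dagger> \<cdot> \<alpha> t x \<cdot> w) = v\<^sup>\<dagger> \<cdot> \<alpha> t x \<cdot> w"
    proof (rule beta_fixed_of_insertion[OF PR QP QM])
      show "v\<^sup>\<dagger> \<cdot> \<alpha> t x \<in> N" "w \<in> N" using vN xM by auto
      fix u u' assume u: "u \<in> intertwiners t P" "u' \<in> intertwiners t P"
      have uQ: "u \<in> intertwiners t Q" "u' \<in> intertwiners t Q" using u intertwiners_antimono[OF QP]
        by auto
      have "v\<^sup>\<dagger> \<cdot> \<alpha> t x \<cdot> u \<cdot> (u'\<^sup>\<dagger> \<cdot> w) = (v\<^sup>\<dagger> \<cdot> u) \<cdot> x \<cdot> (u'\<^sup>\<dagger> \<cdot> w)"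
        using intertwinersD[OF u(1) x] by (simp add: compose_assoc)
      moreover have "v\<^sup>\<dagger> \<cdot> u \<in> M" "u'\<^sup>\<dagger> \<cdot> w \<in> M"
        using intertwiners_inner[OF Q QN v uQ(1)] intertwiners_inner[OF Q QN uQ(2) w] QM by auto
      hence "(v\<^sup>\<dagger> \<cdot> u) \<cdot> x \<cdot> (u'\<^sup>\<dagger> \<cdot> w) \<in> M" using xM vna_compose[OF M_vna] by blast
      ultimately show "\<beta> (v\<^sup>\<dagger> \<cdot> \<alpha> t x \<cdot> u \<cdot> (u'\<^sup>\<dagger> \<cdot> w)) = v\<^sup>\<dagger> \<cdot> \<alpha> t x \<cdot> u \<cdot> (u'\<^sup>\<dagger> \<cdot> w)" by simp
    qed
    thus "\<beta> (v\<^sup>\<dagger> \<cdot> (\<alpha> t x \<cdot> w)) = v\<^sup>\<dagger> \<cdot> (\<alpha> t x \<cdot> w)" by (simp add: compose_assoc)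
  qed
qed

lemma rigid_envelope_M: "x \<in> rigid_envelope Q \<Longrightarrow> x \<in> M"
  unfolding rigid_envelope_def by blast

text \<open>
  Closure under products is the insertion argument with \<open>P = Q\<close>: both factors \<open>v\<^sup>\<dagger> \<alpha> t x u\<close> and
  \<open>u'\<^sup>\<dagger> \<alpha> t y w\<close> are fixed by \<open>\<beta>\<close>. For the bicommutant, the condition on \<open>x\<close> is rewritten as
  \<open>\<tau>(g x) = 0\<close>, where \<open>g\<close> collects the remaining factors and is moved back by \<open>\<alpha> (- t)\<close>.
\<close>

lemma rigid_envelope_vna:
  assumes QR: "Q \<in> Rig M \<tau> \<alpha>" and QM: "commutant Q \<inter> N \<subseteq> M"
  shows "von_neumann_algebra (rigid_envelope Q)"
proof -
  note Q = RigD(1,3)[OF QR]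
  let ?E = "rigid_envelope Q"
  have EN: "x \<in> N" if "x \<in> ?E" for x using that rigid_envelope_M by simp
  have add: "x + y \<in> ?E" if x: "x \<in> ?E" and y: "y \<in> ?E" for x y
    unfolding rigid_envelope_def mem_Collect_eq
  proof (intro conjI allI ballI)
    show "x + y \<in> M" using x y by (intro vna_add[OF M_vna] rigid_envelope_M)
    fix t v w assume vw: "v \<in> intertwiners t Q" "w \<in> intertwiners t Q"
    have e: "v\<^sup>\<dagger> \<cdot> (\<alpha> t (x + y) \<cdot> w) = v\<^sup>\<dagger> \<cdot> (\<alpha> t x \<cdot> w) + v\<^sup>\<dagger> \<cdot> (\<alpha> t y \<cdot> w)"
      using EN[OF x] EN[OF y] by (simp add: compose_linear)
    show "\<beta> (v\<^sup>\<dagger> \<cdot> (\<alpha> t (x + y) \<cdot> w)) = v\<^sup>\<dagger> \<cdot> (\<alpha> t (x + y) \<cdot> w)"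
      unfolding e using rigid_envelopeD[OF x vw] rigid_envelopeD[OF y vw] EN[OF x] EN[OF y]
        intertwiners_N[OF vw(1)] intertwiners_N[OF vw(2)] by (subst beta(4)) (simp_all del: beta)
  qed
  have scale: "op_scaleC c x \<in> ?E" if x: "x \<in> ?E" for c x
    unfolding rigid_envelope_def mem_Collect_eq
  proof (intro conjI allI ballI)
    show "op_scaleC c x \<in> M" using x by (intro vna_scaleC[OF M_vna] rigid_envelope_M)
    fix t v w assume vw: "v \<in> intertwiners t Q" "w \<in> intertwiners t Q"
    have e: "v\<^sup>\<dagger> \<cdot> (\<alpha> t (op_scaleC c x) \<cdot> w) = op_scaleC c (v\<^sup>\<dagger> \<cdot> (\<alpha> t x \<cdot> w))"
      using EN[OF x] intertwiners_N[OF vw(1)]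
        by (simp add: op_scaleC_compose_left op_scaleC_compose_right)
    show "\<beta> (v\<^sup>\<dagger> \<cdot> (\<alpha> t (op_scaleC c x) \<cdot> w)) = v\<^sup>\<dagger> \<cdot> (\<alpha> t (op_scaleC c x) \<cdot> w)"
      unfolding e
        using rigid_envelopeD[OF x vw] EN[OF x] intertwiners_N[OF vw(1)] intertwiners_N[OF vw(2)]
      by (subst beta(6)) (simp_all del: beta)
  qed
  have adj: "x\<^sup>\<dagger> \<in> ?E" if x: "x \<in> ?E" for x
    unfolding rigid_envelope_def mem_Collect_eq
  proof (intro conjI allI ballI)
    show "x\<^sup>\<dagger> \<in> M" using x by (intro vna_adj[OF M_vna] rigid_envelope_M)
    fix t v w assume vw: "v \<in> intertwiners t Q" "w \<in> intertwiners t Q"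
    have e: "v\<^sup>\<dagger> \<cdot> (\<alpha> t (x\<^sup>\<dagger>) \<cdot> w) = (w\<^sup>\<dagger> \<cdot> (\<alpha> t x \<cdot> v))\<^sup>\<dagger>"
      using EN[OF x] intertwiners_N[OF vw(1)] intertwiners_N[OF vw(2)] by (simp add: compose_assoc)
    show "\<beta> (v\<^sup>\<dagger> \<cdot> (\<alpha> t (x\<^sup>\<dagger>) \<cdot> w)) = v\<^sup>\<dagger> \<cdot> (\<alpha> t (x\<^sup>\<dagger>) \<cdot> w)"
      unfolding e
        using rigid_envelopeD[OF x vw(2,1)] EN[OF x] intertwiners_N[OF vw(1)] intertwiners_N[OF vw(2)]
      by (subst beta(3)) (simp_all del: beta adj_simps)
  qed
  have mult: "x \<cdot> y \<in> ?E" if x: "x \<in> ?E" and y: "y \<in> ?E" for x y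
    unfolding rigid_envelope_def mem_Collect_eq
  proof (intro conjI allI ballI)
    show "x \<cdot> y \<in> M" using x y by (intro vna_compose[OF M_vna] rigid_envelope_M)
    fix t v w assume vw: "v \<in> intertwiners t Q" "w \<in> intertwiners t Q"
    have N: "x \<in> N" "y \<in> N" "v \<in> N" "w \<in> N" using EN x y vw by auto
    have "\<beta> ((v\<^sup>\<dagger> \<cdot> \<alpha> t x) \<cdot> (\<alpha> t y \<cdot> w)) = (v\<^sup>\<dagger> \<cdot> \<alpha> t x) \<cdot> (\<alpha> t y \<cdot> w)"
    proof (rule beta_fixed_of_insertion[OF QR order_refl QM])
      fix u u' assume u: "u \<in> intertwiners t Q" "u' \<in> intertwiners t Q"
      have uN: "u \<in> N" "u' \<in> N" using u by auto
      have "\<beta> ((v\<^sup>\<dagger> \<cdot> (\<alpha> t x \<cdot> u)) \<cdot> (u'\<^sup>\<dagger> \<cdot> (\<alpha> t y \<cdot> w)))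
          = \<beta> (v\<^sup>\<dagger> \<cdot> (\<alpha> t x \<cdot> u)) \<cdot> \<beta> (u'\<^sup>\<dagger> \<cdot> (\<alpha> t y \<cdot> w))"
        using N uN by (intro beta(2)) auto
      also have "\<dots> = (v\<^sup>\<dagger> \<cdot> (\<alpha> t x \<cdot> u)) \<cdot> (u'\<^sup>\<dagger> \<cdot> (\<alpha> t y \<cdot> w))"
        by (simp only: rigid_envelopeD[OF x vw(1) u(1)] rigid_envelopeD[OF y u(2) vw(2)])
      finally show "\<beta> (v\<^sup>\<dagger> \<cdot> \<alpha> t x \<cdot> u \<cdot> (u'\<^sup>\<dagger> \<cdot> (\<alpha> t y \<cdot> w))) = v\<^sup>\<dagger> \<cdot> \<alpha> t x \<cdot> u \<cdot> (u'\<^sup>\<dagger> \<cdot> (\<alpha> t y \<cdot> w))"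
        by (simp only: compose_assoc)
    qed (use N in auto)
    thus "\<beta> (v\<^sup>\<dagger> \<cdot> (\<alpha> t (x \<cdot> y) \<cdot> w)) = v\<^sup>\<dagger> \<cdot> (\<alpha> t (x \<cdot> y) \<cdot> w)"
      using N by (simp only: alpha(2) compose_assoc)
  qed
  have id: "id_blinfun \<in> ?E"
    using rigid_subset_envelope[OF QR Q(1) order_refl QM] vna_id[OF Q(1)] by blast
  have zero: "0 \<in> ?E"
  proof -
    have "op_scaleC 0 id_blinfun \<in> ?E" by (rule scale[OF id])
    moreover have "op_scaleC 0 id_blinfun = (0 :: 'h operator)"
      using scaleR_eq_op_scaleC[of 0 "id_blinfun :: 'h operator"] by simp
    ultimately show ?thesis by simp
  qed
  have Eb: "?E \<subseteq> bounded_ops" using EN by auto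
  have "commutant (commutant ?E) \<subseteq> ?E"
  proof
    fix x assume x: "x \<in> commutant (commutant ?E)"
    have "?E \<subseteq> M" using rigid_envelope_M by blast
    hence xM: "x \<in> M"
      using x commutant_antimono[OF commutant_antimono[of ?E M]] vna_bicommutant[OF M_vna] by blast
    show "x \<in> ?E" unfolding rigid_envelope_def mem_Collect_eq
    proof (intro conjI allI ballI xM)
      fix t v w assume vw: "v \<in> intertwiners t Q" "w \<in> intertwiners t Q"
      have N: "x \<in> N" "v \<in> N" "w \<in> N" using xM vw by auto
      have "\<tau> ((\<beta> y - y) \<cdot> (v\<^sup>\<dagger> \<cdot> (\<alpha> t x \<cdot> w))) = 0" if y: "y \<in> N" for y
      proof -
        define g where "g = \<alpha> (- t) (w \<cdot> ((\<beta> y - y) \<cdot> v\<^sup>\<dagger>))"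
        have gN: "g \<in> N" using N y by (simp add: g_def)
        \<comment> \<open>the defining condition, written as a functional of the inner variable\<close>
        have conv: "\<tau> ((\<beta> y - y) \<cdot> (v\<^sup>\<dagger> \<cdot> (\<alpha> t z \<cdot> w))) = \<tau> (g \<cdot> z)" if z: "z \<in> N" for z
        proof -
          have "\<tau> ((\<beta> y - y) \<cdot> (v\<^sup>\<dagger> \<cdot> (\<alpha> t z \<cdot> w))) = \<tau> (((\<beta> y - y) \<cdot> (v\<^sup>\<dagger> \<cdot> \<alpha> t z)) \<cdot> w)"
            by (simp only: compose_assoc)
          also have "\<dots> = \<tau> (w \<cdot> ((\<beta> y - y) \<cdot> (v\<^sup>\<dagger> \<cdot> \<alpha> t z)))" using N y z
            by (intro tau_commute) auto
          also have "\<dots> = \<tau> (\<alpha> (- t) ((w \<cdot> ((\<beta> y - y) \<cdot> v\<^sup>\<dagger>)) \<cdot> \<alpha> t z))"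
            using N y z by (subst alpha(7)) (auto simp: compose_assoc)
          also have "\<dots> = \<tau> (g \<cdot> \<alpha> (- t) (\<alpha> t z))"
            unfolding g_def using N y z by (subst alpha(2)) auto
          finally show ?thesis using z by simp
        qed
        have "\<tau> (g \<cdot> x) = 0"
        proof (rule tau_vanishes_on_bicommutant[OF _ zero add scale mult adj _ gN _ x])
          show "?E \<subseteq> N" using EN by blast
          show "z = 0" if "z \<in> N" "\<And>a. a \<in> ?E \<Longrightarrow> a \<cdot> z = 0" for z using that(2)[OF id] by simp
          fix a assume a: "a \<in> ?E"
          have "v\<^sup>\<dagger> \<cdot> (\<alpha> t a \<cdot> w) \<in> N" using N EN[OF a] by simp
          from beta_fixed_iff[OF this] show "\<tau> (g \<cdot> a) = 0"
            using rigid_envelopeD[OF a vw] y conv[OF EN[OF a]] by simp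
        qed
        thus ?thesis using conv N by simp
      qed
      thus "\<beta> (v\<^sup>\<dagger> \<cdot> (\<alpha> t x \<cdot> w)) = v\<^sup>\<dagger> \<cdot> (\<alpha> t x \<cdot> w)"
        using beta_fixed_iff[of "v\<^sup>\<dagger> \<cdot> (\<alpha> t x \<cdot> w)"] N by simp
    qed
  qed
  thus ?thesis
    unfolding von_neumann_algebra_def using Eb adj subset_bicommutant[OF Eb] by blast
qed

text \<open>
  A form of transversality: \<open>\<alpha> t x\<close> is close to an element \<open>z\<close> fixed by \<open>\<beta>\<close>, and \<open>\<beta>\<close> maps \<open>\<alpha> t x\<close> to
  \<open>\<alpha> (- t) x\<close>, so that \<open>\<alpha> t x\<close> and \<open>\<alpha> (- t) x\<close> are both close to \<open>z\<close>.
\<close>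

lemma norm2_alpha_double_le:
  assumes x: "x \<in> M" and v: "v \<in> N" "norm v \<le> 1"
    and d: "\<beta> (v\<^sup>\<dagger> \<cdot> (\<alpha> t x \<cdot> v)) = v\<^sup>\<dagger> \<cdot> (\<alpha> t x \<cdot> v)" and nx: "norm x \<le> 1"
  shows "norm2 \<tau> (\<alpha> (2 * t) x - x) \<le> 4 * norm2 \<tau> (v - id_blinfun)"
proof -
  have xN: "x \<in> N" using x by simp
  define e where "e = v - id_blinfun"
  define z where "z = v\<^sup>\<dagger> \<cdot> (\<alpha> t x \<cdot> v)"
  have eN: "e \<in> N" and zN: "z \<in> N" using v xN by (auto simp: e_def z_def)
  \<comment> \<open>automorphisms preserve the trace norm, so multiplication by the image of a contraction is
    contractive in that norm\<close>
  have alpha_left: "norm2 \<tau> (\<alpha> t x \<cdot> b) \<le> norm2 \<tau> b" if b: "b \<in> N" for b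
  proof -
    have "norm2 \<tau> (\<alpha> t x \<cdot> b) = norm2 \<tau> (\<alpha> (- t) (\<alpha> t x \<cdot> b))" using b xN
      by (intro norm2_aut[OF alpha_Aut, symmetric]) auto
    also have "\<dots> = norm2 \<tau> (x \<cdot> \<alpha> (- t) b)" using b xN by simp
    also have "\<dots> \<le> norm x * norm2 \<tau> (\<alpha> (- t) b)" using b xN by (intro norm2_compose_left) auto
    also have "\<dots> \<le> 1 * norm2 \<tau> (\<alpha> (- t) b)" using b nx by (intro mult_right_mono norm2_nonneg) auto
    finally show ?thesis using b by (simp add: norm2_aut[OF alpha_Aut])
  qed
  have "\<alpha> t x - z = - (e\<^sup>\<dagger> \<cdot> \<alpha> t x) - v\<^sup>\<dagger> \<cdot> (\<alpha> t x \<cdot> e)"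
    using v by (simp add: e_def z_def compose_linear op_adj_id)
  hence "norm2 \<tau> (\<alpha> t x - z) \<le> norm2 \<tau> (e\<^sup>\<dagger> \<cdot> \<alpha> t x) + norm2 \<tau> (v\<^sup>\<dagger> \<cdot> (\<alpha> t x \<cdot> e))"
    using norm2_triangle[of "- (e\<^sup>\<dagger> \<cdot> \<alpha> t x)" "- (v\<^sup>\<dagger> \<cdot> (\<alpha> t x \<cdot> e))"] eN v xN
      by (simp add: norm2_minus)
  also have "norm2 \<tau> (e\<^sup>\<dagger> \<cdot> \<alpha> t x) \<le> norm2 \<tau> e"
  proof -
    have "norm2 \<tau> (e\<^sup>\<dagger> \<cdot> \<alpha> t x) = norm2 \<tau> (\<alpha> (- t) (e\<^sup>\<dagger> \<cdot> \<alpha> t x))"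
      using eN xN by (intro norm2_aut[OF alpha_Aut, symmetric]) auto
    also have "\<dots> = norm2 \<tau> (\<alpha> (- t) (e\<^sup>\<dagger>) \<cdot> x)" using eN xN by simp
    also have "\<dots> \<le> norm x * norm2 \<tau> (\<alpha> (- t) (e\<^sup>\<dagger>))" using eN xN by (intro norm2_compose_right) auto
    also have "\<dots> \<le> 1 * norm2 \<tau> (\<alpha> (- t) (e\<^sup>\<dagger>))" using eN nx
      by (intro mult_right_mono norm2_nonneg) auto
    finally show ?thesis using eN norm2_aut[OF alpha_Aut, of "e\<^sup>\<dagger>" "- t"]
      by (simp add: norm2_adj del: alpha)
  qed
  also have "norm2 \<tau> (v\<^sup>\<dagger> \<cdot> (\<alpha> t x \<cdot> e)) \<le> norm2 \<tau> e"
  proof -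
    have "norm2 \<tau> (v\<^sup>\<dagger> \<cdot> (\<alpha> t x \<cdot> e)) \<le> norm (v\<^sup>\<dagger>) * norm2 \<tau> (\<alpha> t x \<cdot> e)"
      using v xN eN by (intro norm2_compose_left) auto
    also have "\<dots> \<le> 1 * norm2 \<tau> (\<alpha> t x \<cdot> e)"
      using v norm_op_adj_le[of v] xN eN by (intro mult_right_mono norm2_nonneg) auto
    finally show ?thesis using alpha_left[OF eN] by simp
  qed
  finally have a: "norm2 \<tau> (\<alpha> t x - z) \<le> 2 * norm2 \<tau> e" by simp
  have "\<beta> (\<alpha> t x - z) = \<alpha> (- t) x - z"
    using xN zN d x by (simp add: beta_alpha z_def[symmetric] del: beta(2))
  hence b: "norm2 \<tau> (\<alpha> (- t) x - z) = norm2 \<tau> (\<alpha> t x - z)"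
    using norm2_aut[OF beta_Aut, of "\<alpha> t x - z"] xN zN by (simp del: beta)
  have "\<alpha> (- t) (\<alpha> (2 * t) x - x) = \<alpha> t x - \<alpha> (- t) x"
    using xN alpha_add[of x "- t" "2 * t"] by simp
  hence "norm2 \<tau> (\<alpha> (2 * t) x - x) = norm2 \<tau> (\<alpha> t x - \<alpha> (- t) x)"
    using norm2_aut[OF alpha_Aut, of "\<alpha> (2 * t) x - x" "- t"] xN by (simp del: alpha add: alpha(1))
  also have "\<dots> \<le> norm2 \<tau> (\<alpha> t x - z) + norm2 \<tau> (z - \<alpha> (- t) x)"
    using xN zN by (intro norm2_triangle3) auto
  also have "\<dots> \<le> 4 * norm2 \<tau> e"
    using a b norm2_commute[of z "\<alpha> (- t) x"] xN zN by simp
  finally show ?thesis by (simp add: e_def)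
qed

text \<open>
  The rigidity defect of the envelope is controlled by the one of \<open>Q\<close> alone.
\<close>

lemma rigid_envelope_Rig:
  assumes QR: "Q \<in> Rig M \<tau> \<alpha>" and QM: "commutant Q \<inter> N \<subseteq> M"
  shows "rigid_envelope Q \<in> Rig M \<tau> \<alpha>"
proof -
  note Q = RigD(1,3)[OF QR]
  let ?E = "rigid_envelope Q"
  have E: "von_neumann_algebra ?E" by (rule rigid_envelope_vna[OF QR QM])
  have EM: "?E \<subseteq> M" using rigid_envelope_M by blast
  have up: "rigidity_defect \<tau> \<alpha> s ?E \<le> 4 * rigidity_defect \<tau> \<alpha> (s / 2) Q" for s
  proof -
    obtain v where v: "v \<in> intertwiners (s / 2) Q" "norm v \<le> 1"
      "norm2 \<tau> (v - id_blinfun) \<le> rigidity_defect \<tau> \<alpha> (s / 2) Q"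
      using exists_rigid_intertwiner[OF Q] by blast
    show ?thesis
      unfolding rigidity_defect_def[of _ _ s]
    proof (rule cSUP_least)
      show "{x \<in> ?E. norm x \<le> 1} \<noteq> {}" using vna_zero[OF E] by (auto intro!: exI[of _ 0])
      fix x assume x: "x \<in> {x \<in> ?E. norm x \<le> 1}"
      have "norm2 \<tau> (\<alpha> (2 * (s / 2)) x - x) \<le> 4 * norm2 \<tau> (v - id_blinfun)"
        by (rule norm2_alpha_double_le) (use x EM v rigid_envelopeD[of x Q v "s / 2" v] in auto)
      thus "norm2 \<tau> (\<alpha> s x - x) \<le> 4 * rigidity_defect \<tau> \<alpha> (s / 2) Q" using v(3) by simp
    qed
  qed
  have low: "0 \<le> rigidity_defect \<tau> \<alpha> s ?E" for s
    using norm2_le_rigidity_defect[of ?E 0 s] EM vna_zero[OF E] M_subset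
      by (simp add: norm2_zero subset_iff)
  have "filterlim (\<lambda>s::real. s / 2) (at 0) (at 0)"
    by (rule filterlim_atI) (auto intro!: tendsto_eq_intros simp: eventually_at_filter)
  from filterlim_compose[OF RigD(4)[OF QR] this]
  have "((\<lambda>s. 4 * rigidity_defect \<tau> \<alpha> (s / 2) Q) \<longlongrightarrow> 4 * 0) (at 0)"
    by (intro tendsto_mult tendsto_const)
  hence "((\<lambda>s. rigidity_defect \<tau> \<alpha> s ?E) \<longlongrightarrow> 0) (at 0)"
    by (intro tendsto_sandwich[of "\<lambda>_. 0" "\<lambda>s. rigidity_defect \<tau> \<alpha> s ?E" "at 0" "\<lambda>s. 4 * rigidity_defect \<tau> \<alpha> (s / 2) Q"])
      (auto intro!: always_eventually low up)
  thus ?thesis using E EM by (simp add: Rig_def)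
qed

end

theorem theorem1p2:
  fixes M N Q :: "'h::complex_hilbert_space operator set"
    and \<tau>\<^sub>M \<tau> :: "'h operator \<Rightarrow> complex"
    and \<alpha> :: "real \<Rightarrow> 'h operator \<Rightarrow> 'h operator"
    and \<beta> :: "'h operator \<Rightarrow> 'h operator"
  assumes "tracial_inclusion M \<tau>\<^sub>M N \<tau>"
    and "s_malleable_deformation M N \<tau> \<alpha> \<beta>"
    and "Q \<in> Rig M \<tau> \<alpha>"
    and "commutant Q \<inter> N \<subseteq> M"
  shows "\<exists>!P. P \<in> MaxRig M \<tau> \<alpha> \<and> Q \<subseteq> P"
proof -
  interpret deformation M N \<tau>\<^sub>M \<tau> \<alpha> \<beta> by unfold_locales (fact assms)+
  let ?E = "rigid_envelope Q"
  have Q: "von_neumann_algebra Q" by (rule RigD(1)[OF assms(3)])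
  have E: "?E \<in> Rig M \<tau> \<alpha>" by (rule rigid_envelope_Rig[OF assms(3,4)])
  have largest: "P \<subseteq> ?E" if "P \<in> Rig M \<tau> \<alpha>" "Q \<subseteq> P" for P
    by (rule rigid_subset_envelope[OF that(1) Q that(2) assms(4)])
  have QE: "Q \<subseteq> ?E" by (rule largest[OF assms(3) order_refl])
  show ?thesis
  proof (rule ex1I[of _ ?E])
    show "?E \<in> MaxRig M \<tau> \<alpha> \<and> Q \<subseteq> ?E"
      using E QE largest unfolding MaxRig_def by blast
    show "P = ?E" if "P \<in> MaxRig M \<tau> \<alpha> \<and> Q \<subseteq> P" for P
      using that E largest[of P] unfolding MaxRig_def by blast
  qed
qed

end
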